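(* For $m$ ranging over the positive integers such that $p=2m+1$ is a prime, a random tree with $m+1$ edges asymptotically almost surely decomposes $K_{6m+5}\setminus e$, where $e$ is an edge of the complete graph $K_{6m+5}$; that is, the probability that a random tree with $m+1$ edges decomposes $K_{6m+5}\setminus e$ tends to $1$ as $m\to\infty$ through the integers $m$ such that $2m+1$ is prime.
   Context: A graph $H$ decomposes a graph $G$ if $G$ is the edge-disjoint union of isomorphic copies of $H$ (i.e. the edge set of $G$ can be partitioned into edge sets of subgraphs of $G$ each isomorphic to $H$). A random tree with $k$ edges is an unlabelled tree (isomorphism class of trees) chosen uniformly at random among all unlabelled trees with $k$ edges. $K_{6m+5}\setminus e$ is the complete graph on $6m+5$ vertices with the single edge $e$ removed (the endpoints of $e$ are kept). *)

theory Defs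
  imports
    "HOL-Probability.Probability_Mass_Function"
    "HOL-Library.Disjoint_Sets"
    "HOL-Computational_Algebra.Primes"
begin

record 'a ugraph =
  verts :: "'a set"
  edges :: "'a set set"

definition simple_graph :: "'a ugraph \<Rightarrow> bool" where
  "simple_graph G \<longleftrightarrow> finite (verts G) \<and> (\<forall>e\<in>edges G. e \<subseteq> verts G \<and> card e = 2)"

definition subgraph :: "'a ugraph \<Rightarrow> 'a ugraph \<Rightarrow> bool" where
  "subgraph H G \<longleftrightarrow> simple_graph H \<and> verts H \<subseteq> verts G \<and> edges H \<subseteq> edges G"

definition isomorphic :: "'a ugraph \<Rightarrow> 'b ugraph \<Rightarrow> bool" where
  "isomorphic G H \<longleftrightarrow>
     (\<exists>f. bij_betw f (verts G) (verts H) \<and> edges H = (\<lambda>e. f ` e) ` edges G)"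

definition connected_graph :: "'a ugraph \<Rightarrow> bool" where
  "connected_graph G \<longleftrightarrow> verts G \<noteq> {} \<and>
     (\<forall>u\<in>verts G. \<forall>v\<in>verts G. (u, v) \<in> {(x, y). {x, y} \<in> edges G}\<^sup>*)"

text \<open>A cycle is given by the list of its distinct vertices in cyclic order.\<close>

definition is_cycle :: "'a ugraph \<Rightarrow> 'a list \<Rightarrow> bool" where
  "is_cycle G c \<longleftrightarrow> length c \<ge> 3 \<and> distinct c \<and>
     (\<forall>i<length c. {c ! i, c ! (Suc i mod length c)} \<in> edges G)"

definition is_tree :: "'a ugraph \<Rightarrow> bool" where
  "is_tree G \<longleftrightarrow> simple_graph G \<and> connected_graph G \<and> \<not> (\<exists>c. is_cycle G c)"

definition decomposes :: "'b ugraph \<Rightarrow> 'a ugraph \<Rightarrow> bool" where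
  "decomposes H G \<longleftrightarrow>
     (\<exists>P. partition_on (edges G) P \<and>
          (\<forall>F\<in>P. \<exists>H'. subgraph H' G \<and> edges H' = F \<and> isomorphic H H'))"

definition complete_graph :: "nat \<Rightarrow> nat ugraph" where
  "complete_graph n = \<lparr>verts = {..<n}, edges = {e. e \<subseteq> {..<n} \<and> card e = 2}\<rparr>"

definition delete_edge :: "'a ugraph \<Rightarrow> 'a set \<Rightarrow> 'a ugraph" where
  "delete_edge G e = \<lparr>verts = verts G, edges = edges G - {e}\<rparr>"

text \<open>Every finite tree has an isomorphic copy whose vertices are natural numbers, so
  isomorphism classes of trees are formed inside the type \<^typ>\<open>nat ugraph\<close>.\<close>

definition labelled_trees :: "nat \<Rightarrow> nat ugraph set" where
  "labelled_trees k = {T. is_tree T \<and> card (edges T) = k}"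

definition unlabelled_trees :: "nat \<Rightarrow> nat ugraph set set" where
  "unlabelled_trees k =
     labelled_trees k // {(S, T). S \<in> labelled_trees k \<and> T \<in> labelled_trees k \<and> isomorphic S T}"

text \<open>An isomorphism class decomposes a graph if its members do; as decomposing is invariant
  under isomorphism, it does not matter which member is taken.\<close>

definition class_decomposes :: "'b ugraph set \<Rightarrow> 'a ugraph \<Rightarrow> bool" where
  "class_decomposes C G \<longleftrightarrow> (\<exists>T\<in>C. decomposes T G)"

definition random_tree :: "nat \<Rightarrow> nat ugraph set pmf" where
  "random_tree k = pmf_of_set (unlabelled_trees k)"

lemma isomorphic_refl: "isomorphic G G"
  unfolding isomorphic_def by (rule exI[of _ id]) auto

lemma isomorphic_trans:
  assumes "isomorphic G H" "isomorphic H K"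
  shows "isomorphic G K"
proof -
  obtain f g where f: "bij_betw f (verts G) (verts H)" "edges H = (\<lambda>e. f ` e) ` edges G"
    and g: "bij_betw g (verts H) (verts K)" "edges K = (\<lambda>e. g ` e) ` edges H"
    using assms unfolding isomorphic_def by blast
  have "bij_betw (g \<circ> f) (verts G) (verts K)"
    using f g by (auto intro: bij_betw_trans)
  moreover have "edges K = (\<lambda>e. (g \<circ> f) ` e) ` edges G"
    using f(2) g(2) by (simp add: image_image image_comp)
  ultimately show ?thesis unfolding isomorphic_def by blast
qed

lemma isomorphic_sym:
  assumes "isomorphic G H" "simple_graph G"
  shows "isomorphic H G"
proof -
  obtain f where f: "bij_betw f (verts G) (verts H)" "edges H = (\<lambda>e. f ` e) ` edges G"
    using assms unfolding isomorphic_def by blast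
  define g where "g = inv_into (verts G) f"
  have "g ` f ` e = e" if "e \<in> edges G" for e
    using that assms(2) f(1) unfolding g_def simple_graph_def bij_betw_def
    by (simp add: inv_into_image_cancel)
  hence "edges G = (\<lambda>e. g ` e) ` edges H"
    unfolding f(2) image_image by (simp cong: image_cong)
  moreover have "bij_betw g (verts H) (verts G)"
    using f(1) unfolding g_def by (rule bij_betw_inv_into)
  ultimately show ?thesis unfolding isomorphic_def by blast
qed

lemma decomposes_isomorphic:
  assumes "decomposes S G" "isomorphic S T" "simple_graph S"
  shows "decomposes T G"
  using assms isomorphic_sym[OF assms(2,3)] isomorphic_trans unfolding decomposes_def by metis

lemma equiv_labelled_trees:
  "equiv (labelled_trees k)
     {(S, T). S \<in> labelled_trees k \<and> T \<in> labelled_trees k \<and> isomorphic S T}"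
  by (rule equivI)
     (auto simp: refl_on_def sym_def trans_def labelled_trees_def is_tree_def
       intro: isomorphic_refl isomorphic_sym isomorphic_trans)

lemma labelled_tree_card_verts:
  assumes "T \<in> labelled_trees k"
  shows "card (verts T) \<le> Suc (2 * k)"
proof -
  have T: "simple_graph T" "connected_graph T" and k: "card (edges T) = k"
    using assms by (auto simp: labelled_trees_def is_tree_def)
  have "edges T \<subseteq> Pow (verts T)" and fv: "finite (verts T)"
    using T(1) by (auto simp: simple_graph_def)
  hence fe: "finite (edges T)" by (meson finite_Pow_iff finite_subset)
  obtain r where r: "r \<in> verts T" using T(2) by (auto simp: connected_graph_def)
  have "verts T \<subseteq> insert r (\<Union>(edges T))"
  proof
    fix v assume "v \<in> verts T"
    hence "(v, r) \<in> {(x, y). {x, y} \<in> edges T}\<^sup>*"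
      using T(2) r by (auto simp: connected_graph_def)
    thus "v \<in> insert r (\<Union>(edges T))"
      by (cases rule: converse_rtranclE) auto
  qed
  moreover have "finite (\<Union>(edges T))"
    using T(1) fv by (meson Union_least finite_subset simple_graph_def)
  ultimately have "card (verts T) \<le> card (insert r (\<Union>(edges T)))"
    by (intro card_mono) auto
  also have "\<dots> \<le> Suc (card (\<Union>(edges T)))"
    using \<open>finite (\<Union>(edges T))\<close> by (simp add: card_insert_if)
  also have "card (\<Union>(edges T)) \<le> (\<Sum>e\<in>edges T. card e)"
    using card_UN_le[OF fe, of id] by simp
  also have "\<dots> = 2 * k"
    using T(1) k by (simp add: simple_graph_def)
  finally show ?thesis by simp
qed

lemma finite_unlabelled_trees: "finite (unlabelled_trees k)"
proof -
  define R where
    "R = {(S, T). S \<in> labelled_trees k \<and> T \<in> labelled_trees k \<and> isomorphic S T}"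
  define B where "B = (\<lambda>(V, E). \<lparr>verts = V, edges = E\<rparr>) `
    (Pow {..<Suc (2 * k)} \<times> Pow (Pow {..<Suc (2 * k)}))"
  have eq: "equiv (labelled_trees k) R" unfolding R_def by (rule equiv_labelled_trees)
  have "finite B" unfolding B_def by simp
  have "labelled_trees k // R \<subseteq> (\<lambda>S. {T\<in>labelled_trees k. isomorphic S T}) ` B"
  proof
    fix C assume "C \<in> labelled_trees k // R"
    then obtain T where T: "T \<in> labelled_trees k" and C: "C = R `` {T}"
      by (rule quotientE)
    have sT: "simple_graph T" using T by (auto simp: labelled_trees_def is_tree_def)
    obtain f where f: "bij_betw f (verts T) {0..<card (verts T)}"
      using sT ex_bij_betw_finite_nat by (metis simple_graph_def)
    define S where "S = \<lparr>verts = f ` verts T, edges = (\<lambda>e. f ` e) ` edges T\<rparr>"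
    have iso: "isomorphic T S"
      unfolding isomorphic_def S_def using f by (auto simp: bij_betw_def)
    have "f ` verts T \<subseteq> {..<Suc (2 * k)}"
      using f labelled_tree_card_verts[OF T] by (auto simp: bij_betw_def)
    moreover have "f ` e \<subseteq> f ` verts T" if "e \<in> edges T" for e
      using that sT by (intro image_mono) (auto simp: simple_graph_def)
    ultimately have "(f ` verts T, (\<lambda>e. f ` e) ` edges T)
        \<in> Pow {..<Suc (2 * k)} \<times> Pow (Pow {..<Suc (2 * k)})" by blast
    hence "S \<in> B" unfolding B_def S_def by (rule rev_image_eqI) simp
    moreover have "C = {T'\<in>labelled_trees k. isomorphic S T'}"
      unfolding C R_def using T iso isomorphic_sym[OF iso sT] by (auto intro: isomorphic_trans)
    ultimately show "C \<in> (\<lambda>S. {T\<in>labelled_trees k. isomorphic S T}) ` B" by blast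
  qed
  thus ?thesis
    unfolding unlabelled_trees_def R_def[symmetric] using \<open>finite B\<close> by (meson finite_surj)
qed

lemma unlabelled_trees_nonempty: "unlabelled_trees k \<noteq> {}"
proof -
  define S :: "nat ugraph" where
    "S = \<lparr>verts = {..k}, edges = (\<lambda>i. {0, i}) ` {1..k}\<rparr>"
  have simple: "simple_graph S" unfolding simple_graph_def S_def by auto
  have path: "(u, 0) \<in> {(x, y). {x, y} \<in> edges S}\<^sup>*" "(0, u) \<in> {(x, y). {x, y} \<in> edges S}\<^sup>*"
    if "u \<in> verts S" for u
  proof -
    have "u = 0 \<or> {u, 0} \<in> edges S" using that by (auto simp: S_def insert_commute)
    thus "(u, 0) \<in> {(x, y). {x, y} \<in> edges S}\<^sup>*" "(0, u) \<in> {(x, y). {x, y} \<in> edges S}\<^sup>*"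
      by (auto simp: insert_commute)
  qed
  have "connected_graph S"
    unfolding connected_graph_def using path by (auto simp: S_def intro: rtrancl_trans)
  moreover have "\<not> is_cycle S c" for c
  proof
    assume c: "is_cycle S c"
    define n where "n = length c"
    have n: "n \<ge> 3" and d: "distinct c" using c by (auto simp: is_cycle_def n_def)
    have z: "c ! i = 0 \<or> c ! (Suc i mod n) = 0" if "i < n" for i
    proof -
      have "{c ! i, c ! (Suc i mod n)} \<in> edges S" using c that by (simp add: is_cycle_def n_def)
      then obtain j where "{c ! i, c ! (Suc i mod n)} = {0, j}" by (auto simp: S_def)
      thus ?thesis by (metis insertI1 insertE singletonD)
    qed
    have inj: "i = j" if "c ! i = 0" "c ! j = 0" "i < n" "j < n" for i j
      using that d by (metis n_def nth_eq_iff_index_eq)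
    have "c ! 0 = 0 \<or> c ! 1 = 0" "c ! 1 = 0 \<or> c ! 2 = 0" "c ! 2 = 0 \<or> c ! (3 mod n) = 0"
      using z[of 0] z[of 1] z[of 2] n by (auto simp: numeral_eq_Suc)
    moreover have "3 mod n = 0 \<or> 3 mod n = 3 \<and> 3 < n" using n by (cases "n = 3") auto
    ultimately show False
      using inj[of 0 2] inj[of 1 2] inj[of 1 "3 mod n"] n by auto
  qed
  moreover have "card (edges S) = k"
    unfolding S_def by (simp add: card_image inj_on_def doubleton_eq_iff)
  ultimately have "S \<in> labelled_trees k"
    using simple by (auto simp: labelled_trees_def is_tree_def)
  thus ?thesis unfolding unlabelled_trees_def by (auto simp: quotient_def)
qed

end

theory Submission
  imports Defs "Jordan_Normal_Form.Determinant"
begin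

text \<open>
  Write \<open>p = 2m + 1\<close> and let \<open>T\<close> be a tree with \<open>m + 1\<close> edges, at least a third of them
  pendant. The tree without its leaves is labelled greedily and injectively by residues modulo \<open>p\<close>
  so that edge differences are distinct up to sign. All leaves but one are then placed by Alon's
  theorem on additive Latin transversals, which uses up the remaining differences and keeps the
  labels of these leaves pairwise distinct; a leaf may only collide with an inner vertex.
  The image of the tree is 3-degenerate, hence 4-colourable, and the colours are turned into the
  four directions of the affine plane over \<open>F\<^sub>3\<close>: this yields nine copies of the tree in
  \<open>Z\<^sub>p \<times> F\<^sub>3\<close> whose translates modulo \<open>p\<close> partition all edges between different residues.
  The remaining edges, \<open>p\<close> triangles and the two stars at the ends of \<open>e\<close>, are supplied by the
  last leaf.

  That few trees have fewer leaves is a comparison of growth rates of rooted trees, seen as nested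
  multisets. The generating function with weight \<open>u\<close> per leaf is bounded by a supersolution of
  its functional equation at \<open>z = 0.465\<close>, \<open>u = (3/4)\<^sup>3\<close>, so trees on \<open>n\<close> vertices with at
  most \<open>n/3\<close> leaves number \<open>O(0.34875\<^sup>-\<^sup>n)\<close>; the series without leaf weights diverges at \<open>0.346\<close>,
  and supermultiplicativity turns this into at least \<open>c 0.347\<^sup>-\<^sup>n\<close> rooted trees for all \<open>n\<close>.
  Passing to unrooted trees costs a factor of at most \<open>n\<close>.
\<close>

section \<open>Additive Latin transversals\<close>

text \<open>Counting fixes the shape. With \<open>p = 2m + 1\<close> there are \<open>3p + 2\<close>
  vertices and \<open>9p(m + 1)\<close> edges, so \<open>9p\<close> copies are needed. Modulo
  \<open>p\<close> there are only \<open>m\<close> nonzero residues up to sign, one too few for the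
  \<open>m + 1\<close> edges of the tree; hence one leaf is set aside. The \<open>9p\<close> images
  of its edge are exactly the \<open>3p\<close> triangle edges and the \<open>6p\<close> edges at
  the ends of \<open>e\<close>. The threshold of one third comes from the greedy labelling: a tree
  with \<open>E\<close> edges needs about \<open>3E\<close> residues, and at most
  \<open>2(m + 1)/3\<close> inner edges just fit. A transversal separates leaves only from each
  other. The third coordinate repairs this: a leaf that shares its label with an inner vertex is
  moved one layer up. Two affine functions on the plane over \<open>F_3\<close> take each pair of
  values exactly once when their directions differ, and the plane has just four directions, so four
  colours have to suffice. In the counting, 0.34875 and 0.347 differ by half a percent only, which
  is why second-order terms of the functional equation are kept on both sides.\<close>

lemma det_monic_polys:
  fixes P :: "nat \<Rightarrow> 'a::idom poly" and c :: "nat \<Rightarrow> 'a"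
  assumes deg: "\<And>j. j < K \<Longrightarrow> degree (P j) = j" and mon: "\<And>j. j < K \<Longrightarrow> lead_coeff (P j) = 1"
  shows "det (mat K K (\<lambda>(i, j). poly (P i) (c j))) = det (mat K K (\<lambda>(i, j). c j ^ i))"
proof -
  \<comment> \<open>Row \<open>i\<close> of \<open>A\<close> lists the coefficients of
    \<open>P i\<close>, so \<open>A\<close> is lower triangular with unit diagonal.\<close>
  define A where "A = mat K K (\<lambda>(i, l). coeff (P i) l)"
  define B where "B = mat K K (\<lambda>(l, j). c j ^ l)"
  have "mat K K (\<lambda>(i, j). poly (P i) (c j)) = A * B"
  proof (rule eq_matI)
    fix i j assume "i < dim_row (A * B)" "j < dim_col (A * B)"
    hence ij: "i < K" "j < K" by (auto simp: A_def B_def)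
    have "poly (P i) (c j) = (\<Sum>l\<le>i. coeff (P i) l * c j ^ l)"
      using deg[OF ij(1)] by (simp add: poly_altdef)
    also have "\<dots> = (\<Sum>l\<in>{0..<K}. coeff (P i) l * c j ^ l)"
      using ij(1) deg[OF ij(1)] by (intro sum.mono_neutral_left) (auto simp: coeff_eq_0)
    finally show "mat K K (\<lambda>(i, j). poly (P i) (c j)) $$ (i, j) = (A * B) $$ (i, j)"
      using ij by (simp add: A_def B_def scalar_prod_def)
  qed (auto simp: A_def B_def)
  moreover have "det A = 1"
  proof -
    have "det A = prod_list (diag_mat A)"
      using deg by (intro det_lower_triangular[of K]) (auto simp: A_def coeff_eq_0)
    also have "\<dots> = (\<Prod>i<K. A $$ (i, i))"
      by (simp add: prod_list_diag_prod A_def atLeast0LessThan)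
    also have "\<dots> = 1"
      using deg mon by (intro prod.neutral) (auto simp: A_def)
    finally show ?thesis .
  qed
  moreover have "det (A * B) = det A * det B"
    by (rule det_mult[of _ K]) (auto simp: A_def B_def)
  ultimately show ?thesis by (simp add: B_def)
qed

text \<open>Newton's basis makes the matrix triangular: \<open>P i\<close> vanishes at
  \<open>c j\<close> for \<open>j < i\<close>.\<close>

lemma vandermonde_det:
  fixes c :: "nat \<Rightarrow> 'a::idom"
  shows "det (mat K K (\<lambda>(i, j). c j ^ i)) = (\<Prod>j<K. \<Prod>l<j. c j - c l)"
proof -
  define P where "P = (\<lambda>i. \<Prod>l<i. [:- c l, 1:])"
  have lead: "lead_coeff (P i) = 1" for i
    by (simp add: P_def lead_coeff_prod)
  have "degree (P i) = i" for i
    by (simp add: P_def degree_prod_eq_sum_degree)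
  hence "det (mat K K (\<lambda>(i, j). c j ^ i)) = det (mat K K (\<lambda>(i, j). poly (P i) (c j)))"
    using lead by (subst det_monic_polys) auto
  also have "\<dots> = prod_list (diag_mat (mat K K (\<lambda>(i, j). poly (P i) (c j))))"
    by (rule det_upper_triangular[of _ K]) (force simp: P_def poly_prod intro!: prod_zero)+
  also have "\<dots> = (\<Prod>j<K. \<Prod>l<j. c j - c l)"
    by (simp add: prod_list_diag_prod P_def poly_prod atLeast0LessThan)
  finally show ?thesis .
qed

text \<open>The transpose puts the permutation into the exponents. When \<open>c i\<close> is later
  replaced by a sum that itself involves a permutation, each summand stays a plain product over
  \<open>i\<close>.\<close>

lemma vandermonde_expansion:
  fixes c :: "nat \<Rightarrow> 'a::idom"
  shows "(\<Prod>j<K. \<Prod>l<j. c j - c l) =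
    (\<Sum>\<tau> | \<tau> permutes {0..<K}. signof \<tau> * (\<Prod>i<K. c i ^ \<tau> i))"
proof -
  have "(\<Prod>j<K. \<Prod>l<j. c j - c l) = det (transpose_mat (mat K K (\<lambda>(i, j). c j ^ i)))"
    by (subst det_transpose[of _ K]) (auto simp: vandermonde_det)
  also have "\<dots> = (\<Sum>\<tau> | \<tau> permutes {0..<K}. signof \<tau> * (\<Prod>i<K. c i ^ \<tau> i))"
    unfolding det_def by (auto intro!: sum.cong prod.cong simp: atLeast0LessThan permutes_in_image
      dest: permutes_in_image)
  finally show ?thesis .
qed

text \<open>The dependence on \<open>a\<close> cancels. After expanding over \<open>\<tau>\<close>
  and writing \<open>\<pi> = \<rho> \<circ> \<tau>\<close>, the sum over \<open>\<rho>\<close> is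
  the determinant of monic polynomials \<open>(X + a i) ^ j\<close>, with
  \<open>\<tau> i = j\<close>, at the points of \<open>b\<close>, hence the Vandermonde product of
  \<open>b\<close>. Each of the \<open>K!\<close> permutations \<open>\<tau>\<close> contributes
  this product once, since its sign occurs twice.\<close>

lemma signed_sum_vandermonde_shift:
  fixes a b :: "nat \<Rightarrow> 'a::{idom, ring_char_0}"
  shows "(\<Sum>\<pi> | \<pi> permutes {0..<K}. signof \<pi> *
      (\<Prod>j<K. \<Prod>l<j. (a j + b (\<pi> j)) - (a l + b (\<pi> l)))) =
    fact K * (\<Prod>j<K. \<Prod>l<j. b j - b l)"
proof -
  define S where "S = {\<pi>. \<pi> permutes {0..<K}}"
  have inner: "(\<Sum>\<pi>\<in>S. signof \<pi> * (\<Prod>i<K. (a i + b (\<pi> i)) ^ \<tau> i)) =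
      signof \<tau> * (\<Prod>j<K. \<Prod>l<j. b j - b l)" if \<tau>: "\<tau> permutes {0..<K}" for \<tau>
  proof -
    define P where "P = (\<lambda>j. [:a (inv_into UNIV \<tau> j), 1:] ^ j)"
    have "(\<Sum>\<pi>\<in>S. signof \<pi> * (\<Prod>i<K. (a i + b (\<pi> i)) ^ \<tau> i)) =
        (\<Sum>\<rho>\<in>S. signof (\<rho> \<circ> \<tau>) * (\<Prod>i<K. (a i + b ((\<rho> \<circ> \<tau>) i)) ^ \<tau> i))"
      unfolding S_def by (rule sum_permutations_compose_right[OF \<tau>])
    also have "\<dots> = (\<Sum>\<rho>\<in>S. signof \<tau> * (signof \<rho> * (\<Prod>j<K. poly (P j) (b (\<rho> j)))))"
    proof (rule sum.cong[OF refl])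
      fix \<rho> assume "\<rho> \<in> S"
      hence \<rho>: "\<rho> permutes {0..<K}" by (simp add: S_def)
      have "(\<Prod>j<K. poly (P j) (b (\<rho> j))) = (\<Prod>i<K. poly (P (\<tau> i)) (b (\<rho> (\<tau> i))))"
        using prod.permute[OF \<tau>, of "\<lambda>j. poly (P j) (b (\<rho> j))"]
        by (simp add: atLeast0LessThan o_def)
      moreover have "poly (P (\<tau> i)) (b (\<rho> (\<tau> i))) = (a i + b (\<rho> (\<tau> i))) ^ \<tau> i" for i
        using permutes_inverses[OF \<tau>] by (simp add: P_def)
      moreover have "signof (\<rho> \<circ> \<tau>) = (signof \<rho> * signof \<tau> :: 'a)"
        using signof_compose[OF \<rho> \<tau>] by (simp add: o_def)
      ultimately show "signof (\<rho> \<circ> \<tau>) * (\<Prod>i<K. (a i + b ((\<rho> \<circ> \<tau>) i)) ^ \<tau> i) =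
          signof \<tau> * (signof \<rho> * (\<Prod>j<K. poly (P j) (b (\<rho> j))))"
        by (simp add: algebra_simps)
    qed
    also have "\<dots> = signof \<tau> * det (mat K K (\<lambda>(i, j). poly (P i) (b j)))"
      unfolding det_def S_def sum_distrib_left[symmetric]
      by (auto intro!: sum.cong prod.cong arg_cong2[of _ _ _ _ "(*)"]
        simp: atLeast0LessThan permutes_in_image dest: permutes_in_image)
    also have "det (mat K K (\<lambda>(i, j). poly (P i) (b j))) = (\<Prod>j<K. \<Prod>l<j. b j - b l)"
      by (subst det_monic_polys)
        (auto simp: P_def degree_linear_power coeff_linear_power vandermonde_det lead_coeff_power)
    finally show ?thesis .
  qed
  have "(\<Sum>\<pi>\<in>S. signof \<pi> * (\<Prod>j<K. \<Prod>l<j. (a j + b (\<pi> j)) - (a l + b (\<pi> l)))) =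
      (\<Sum>\<pi>\<in>S. \<Sum>\<tau>\<in>S. signof \<tau> * (signof \<pi> * (\<Prod>i<K. (a i + b (\<pi> i)) ^ \<tau> i)))"
    by (simp only: vandermonde_expansion[where c = "\<lambda>i. a i + b (\<pi> i)" for \<pi>] S_def
        sum_distrib_left mult.left_commute)
  also have "\<dots> = (\<Sum>\<tau>\<in>S. signof \<tau> * (\<Sum>\<pi>\<in>S. signof \<pi> * (\<Prod>i<K. (a i + b (\<pi> i)) ^ \<tau> i)))"
    by (subst sum.swap) (simp add: sum_distrib_left)
  also have "\<dots> = (\<Sum>\<tau>\<in>S. \<Prod>j<K. \<Prod>l<j. b j - b l)"
  proof (rule sum.cong[OF refl])
    fix \<tau> assume "\<tau> \<in> S"
    hence "\<tau> permutes {0..<K}" by (simp add: S_def)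
    moreover have "signof \<tau> * signof \<tau> = (1 :: 'a)"
      by (auto simp: sign_def)
    ultimately show "signof \<tau> * (\<Sum>\<pi>\<in>S. signof \<pi> * (\<Prod>i<K. (a i + b (\<pi> i)) ^ \<tau> i)) =
        (\<Prod>j<K. \<Prod>l<j. b j - b l)"
      by (simp add: inner mult.assoc[symmetric])
  qed
  also have "\<dots> = fact K * (\<Prod>j<K. \<Prod>l<j. b j - b l)"
    using card_permutations[of "{0..<K}" K] by (simp add: S_def)
  finally show ?thesis by (simp add: S_def)
qed

text \<open>If every permutation failed, the prime would divide each Vandermonde product in the signed sum
  above, hence also \<open>K!\<close> times the Vandermonde product of \<open>b\<close>.\<close>

lemma additive_latin_transversal:
  fixes a b :: "nat \<Rightarrow> int" and p :: nat
  assumes p: "prime p" and "K < p"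
    and b: "\<And>i j. i < K \<Longrightarrow> j < K \<Longrightarrow> b i mod int p = b j mod int p \<Longrightarrow> i = j"
  shows "\<exists>\<pi>. \<pi> permutes {0..<K} \<and> inj_on (\<lambda>i. (a i + b (\<pi> i)) mod int p) {0..<K}"
proof (rule ccontr)
  assume no: "\<not> ?thesis"
  have pp: "prime (int p)" using p by simp
  have "int p dvd (\<Prod>j<K. \<Prod>l<j. (a j + b (\<pi> j)) - (a l + b (\<pi> l)))"
    if "\<pi> permutes {0..<K}" for \<pi>
  proof -
    from that no have "\<not> inj_on (\<lambda>i. (a i + b (\<pi> i)) mod int p) {0..<K}" by blast
    then obtain l j where lj: "l < j" "j < K"
      "(a j + b (\<pi> j)) mod int p = (a l + b (\<pi> l)) mod int p"
      unfolding inj_on_def by (metis atLeastLessThan_iff linorder_neqE_nat)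
    hence "int p dvd (a j + b (\<pi> j)) - (a l + b (\<pi> l))" by (simp add: mod_eq_dvd_iff)
    thus ?thesis using lj by (meson dvd_prod_eqI dvd_trans finite_lessThan lessThan_iff dvd_prodI)
  qed
  hence "int p dvd (\<Sum>\<pi> | \<pi> permutes {0..<K}. signof \<pi> *
      (\<Prod>j<K. \<Prod>l<j. (a j + b (\<pi> j)) - (a l + b (\<pi> l))))"
    by (intro dvd_sum) simp
  hence "int p dvd fact K * (\<Prod>j<K. \<Prod>l<j. b j - b l)"
    by (simp only: signed_sum_vandermonde_shift)
  \<comment> \<open>The bound \<open>K < p\<close> enters here: from \<open>K = p\<close> on, the
    factor \<open>K!\<close> would itself be divisible by \<open>p\<close>.\<close>
  moreover have "\<not> int p dvd fact K"
    using prime_dvd_fact_iff[OF p, of K] \<open>K < p\<close>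
    by (metis int_dvd_int_iff not_le of_nat_fact)
  moreover have "\<not> int p dvd (\<Prod>j<K. \<Prod>l<j. b j - b l)"
    by (auto simp: prime_dvd_prod_iff[OF _ pp] mod_eq_dvd_iff[symmetric])
      (metis b less_irrefl less_trans)
  ultimately show False using pp prime_dvd_multD by blast
qed

section \<open>Trees and their leaves\<close>

definition leaf_set :: "'a ugraph \<Rightarrow> 'a set" where
  "leaf_set G = {v \<in> verts G. \<exists>!w. {v, w} \<in> edges G}"

definition del_verts :: "'a ugraph \<Rightarrow> 'a set \<Rightarrow> 'a ugraph" where
  "del_verts G S = \<lparr>verts = verts G - S, edges = {e \<in> edges G. e \<inter> S = {}}\<rparr>"

lemma simple_graphD:
  assumes "simple_graph G" "{v, w} \<in> edges G"
  shows "v \<in> verts G" "w \<in> verts G" "v \<noteq> w"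
  using assms by (auto simp: simple_graph_def card_insert_if split: if_splits)

text \<open>The end of a longest path is a leaf: a second neighbour would either prolong the path or
  close a cycle with an initial segment of it.\<close>

lemma tree_exists_leaf:
  assumes G: "is_tree G" and "card (verts G) \<ge> 2"
  shows "leaf_set G \<noteq> {}"
proof -
  have simple: "simple_graph G" and conn: "connected_graph G" and acyc: "\<And>c. \<not> is_cycle G c"
    using G by (auto simp: is_tree_def)
  have fin: "finite (verts G)" using simple by (simp add: simple_graph_def)
  define Q where "Q = (\<lambda>xs. distinct xs \<and> set xs \<subseteq> verts G \<and>
      successively (\<lambda>x y. {x, y} \<in> edges G) xs)"
  have bound: "length xs < Suc (card (verts G))" if "Q xs" for xs
    using that card_mono[OF fin, of "set xs"] by (simp add: Q_def distinct_card)
  obtain u v where uv: "u \<in> verts G" "v \<in> verts G" "u \<noteq> v"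
    using assms(2) fin by (metis card_le_Suc0_iff_eq not_less_eq_eq numeral_2_eq_2)
  hence "(u, v) \<in> {(x, y). {x, y} \<in> edges G}\<^sup>*"
    using conn by (auto simp: connected_graph_def)
  then obtain w where "{u, w} \<in> edges G"
    using uv(3) by (cases rule: converse_rtranclE) auto
  hence Q0: "Q [u, w]"
    using simple_graphD[OF simple] by (auto simp: Q_def)
  obtain xs where xs: "Q xs" and max: "\<And>ys. Q ys \<Longrightarrow> length ys \<le> length xs"
    using ex_has_greatest_nat[of Q, OF Q0, of length] bound by blast
  have "length xs \<ge> 2" using max[OF Q0] by simp
  then obtain x y zs where xs_eq: "xs = x # y # zs"
    by (metis Suc_le_length_iff numeral_2_eq_2)
  have xy: "{x, y} \<in> edges G" using xs by (simp add: Q_def xs_eq)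
  have uniq: "z = y" if z: "{x, z} \<in> edges G" for z
  proof (rule ccontr)
    assume "z \<noteq> y"
    have zV: "z \<in> verts G" "z \<noteq> x" using simple_graphD[OF simple z] by auto
    show False
    proof (cases "z \<in> set xs")
      case False
      hence "Q (z # xs)" using xs zV z by (auto simp: Q_def xs_eq insert_commute)
      thus False using max by force
    next
      case True
      then obtain j where j: "j < length xs" "xs ! j = z" by (auto simp: in_set_conv_nth)
      have "xs ! 0 = x" "xs ! 1 = y" by (simp_all add: xs_eq)
      hence "j \<noteq> 0" "j \<noteq> 1" using j(2) zV(2) \<open>z \<noteq> y\<close> by metis+
      hence j2: "j \<ge> 2" by simp
      have step: "{xs ! i, xs ! Suc i} \<in> edges G" if "Suc i < length xs" for i
        using xs that by (auto simp: Q_def successively_conv_nth)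
      have "is_cycle G (take (Suc j) xs)"
        unfolding is_cycle_def
      proof (intro conjI allI impI)
        show "3 \<le> length (take (Suc j) xs)" using j j2 by simp
        show "distinct (take (Suc j) xs)" using xs by (simp add: Q_def)
        fix i assume i: "i < length (take (Suc j) xs)"
        have len: "length (take (Suc j) xs) = Suc j" using j by simp
        show "{take (Suc j) xs ! i, take (Suc j) xs ! (Suc i mod length (take (Suc j) xs))} \<in> edges G"
        proof (cases "i = j")
          case True
          moreover have "take (Suc j) xs ! j = z" "take (Suc j) xs ! 0 = x"
            using j(2) \<open>xs ! 0 = x\<close> by simp_all
          moreover have "{z, x} \<in> edges G" using z by (simp add: insert_commute)
          ultimately show ?thesis using True by (simp only: len mod_self)
        next
          case False
          hence "i < j" using i len by simp
          thus ?thesis using step[of i] j unfolding len by simp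
        qed
      qed
      thus False using acyc by blast
    qed
  qed
  have "\<exists>!z. {x, z} \<in> edges G" using xy uniq by (intro ex1I[of "\<lambda>z. {x, z} \<in> edges G" y])
  hence "x \<in> leaf_set G" using simple_graphD(1)[OF simple xy] by (simp add: leaf_set_def)
  thus ?thesis by blast
qed

lemma tree_delete_leaf:
  assumes G: "is_tree G" and l: "l \<in> leaf_set G"
  shows "is_tree (del_verts G {l})"
proof -
  have simple: "simple_graph G" and conn: "connected_graph G" and acyc: "\<And>c. \<not> is_cycle G c"
    using G by (auto simp: is_tree_def)
  obtain w where w: "{l, w} \<in> edges G" and uniq: "\<And>z. {l, z} \<in> edges G \<Longrightarrow> z = w"
    using l by (auto simp: leaf_set_def)
  have wV: "w \<in> verts G" "w \<noteq> l" using simple_graphD[OF simple w] by auto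
  let ?H = "del_verts G {l}"
  \<comment> \<open>A walk is pushed off \<open>l\<close> by standing at \<open>w\<close> whenever
    it visits \<open>l\<close>.\<close>
  have reach: "(u, if v = l then w else v) \<in> {(x, y). {x, y} \<in> edges ?H}\<^sup>*"
    if "(u, v) \<in> {(x, y). {x, y} \<in> edges G}\<^sup>*" and "u \<noteq> l" for u v
    using that(1)
  proof (induction rule: rtrancl_induct)
    case base
    show ?case using \<open>u \<noteq> l\<close> by simp
  next
    case (step y z)
    have yz: "{y, z} \<in> edges G" using step.hyps(2) by simp
    hence zy: "{z, y} \<in> edges G" by (simp add: insert_commute)
    consider "z = l" "y = w" | "y = l" "z = w" | "y \<noteq> l" "z \<noteq> l"
      using uniq[of y] uniq[of z] yz zy by blast
    thus ?case
    proof cases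
      case 3
      hence "{y, z} \<in> edges ?H" using yz by (auto simp: del_verts_def)
      with 3 step.IH show ?thesis by (auto intro: rtrancl_into_rtrancl)
    qed (use step.IH wV in auto)
  qed
  have "connected_graph ?H"
    unfolding connected_graph_def
  proof (intro conjI ballI)
    show "verts ?H \<noteq> {}" using wV by (auto simp: del_verts_def)
    fix u v assume "u \<in> verts ?H" "v \<in> verts ?H"
    thus "(u, v) \<in> {(x, y). {x, y} \<in> edges ?H}\<^sup>*"
      using reach[of u v] conn by (auto simp: del_verts_def connected_graph_def)
  qed
  moreover have "simple_graph ?H"
    using simple by (auto simp: simple_graph_def del_verts_def)
  moreover have "\<not> is_cycle ?H c" for c
    using acyc[of c] by (auto simp: is_cycle_def del_verts_def)
  ultimately show ?thesis by (simp add: is_tree_def)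
qed

text \<open>Trees are grown leaf by leaf. The records are spelled out so that every induction sees
  the new vertex and the new edge explicitly.\<close>

lemma tree_induct [consumes 1, case_names single leaf]:
  assumes "is_tree G"
    and single: "\<And>v. P \<lparr>verts = {v}, edges = {}\<rparr>"
    and leaf: "\<And>V E l w. is_tree \<lparr>verts = V, edges = E\<rparr> \<Longrightarrow> l \<notin> V \<Longrightarrow> w \<in> V \<Longrightarrow>
      P \<lparr>verts = V, edges = E\<rparr> \<Longrightarrow> P \<lparr>verts = insert l V, edges = insert {l, w} E\<rparr>"
  shows "P G"
  using assms(1)
proof (induction "card (verts G)" arbitrary: G)
  case 0
  hence "finite (verts G)" "verts G \<noteq> {}"
    by (auto simp: is_tree_def simple_graph_def connected_graph_def)
  thus ?case using 0 by simp
next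
  case (Suc n)
  have simple: "simple_graph G" using Suc.prems by (simp add: is_tree_def)
  show ?case
  proof (cases "n = 0")
    case True
    then obtain v where v: "verts G = {v}" using Suc.hyps(2) by (metis One_nat_def card_1_singletonE)
    have "edges G = {}"
    proof (rule ccontr)
      assume "edges G \<noteq> {}"
      then obtain e where "e \<in> edges G" by blast
      hence "e \<subseteq> {v}" "card e = 2" using simple v by (auto simp: simple_graph_def)
      thus False using card_mono[of "{v}" e] by simp
    qed
    hence "G = \<lparr>verts = {v}, edges = {}\<rparr>" using v by (cases G) simp
    thus ?thesis using single by simp
  next
    case False
    then obtain l where l: "l \<in> leaf_set G"
      using tree_exists_leaf[OF Suc.prems] Suc.hyps(2) by fastforce
    then obtain w where w: "{l, w} \<in> edges G" and uniq: "\<And>z. {l, z} \<in> edges G \<Longrightarrow> z = w"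
      by (auto simp: leaf_set_def)
    have V: "l \<in> verts G" "w \<in> verts G" "l \<noteq> w" using simple_graphD[OF simple w] by auto
    let ?H = "del_verts G {l}"
    have H: "is_tree ?H" by (rule tree_delete_leaf[OF Suc.prems l])
    have "n = card (verts ?H)" using Suc.hyps(2) V simple
      by (simp add: del_verts_def simple_graph_def)
    hence PH: "P ?H" using Suc.hyps(1) H by blast
    have rec: "\<lparr>verts = verts X, edges = edges X\<rparr> = X" for X :: "'a ugraph" by (cases X) simp
    have "edges G = insert {l, w} (edges ?H)"
    proof
      show "edges G \<subseteq> insert {l, w} (edges ?H)"
      proof
        fix e assume e: "e \<in> edges G"
        show "e \<in> insert {l, w} (edges ?H)"
        proof (cases "l \<in> e")
          case True
          have "card e = 2" using e simple by (auto simp: simple_graph_def)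
          then obtain z where "e = {l, z}" using True
            by (auto simp: card_2_iff)
          thus ?thesis using uniq e by auto
        qed (use e in \<open>simp add: del_verts_def\<close>)
      qed
    qed (use w in \<open>auto simp: del_verts_def\<close>)
    moreover have "insert l (verts ?H) = verts G" using V by (auto simp: del_verts_def)
    ultimately show ?thesis
      using leaf[of "verts ?H" "edges ?H" l w, unfolded rec, OF H _ _ PH] V rec[of G]
      by (simp add: del_verts_def)
  qed
qed

lemma tree_card:
  assumes "is_tree G"
  shows "card (verts G) = Suc (card (edges G))"
proof -
  \<comment> \<open>The inclusion of the edges in the vertex set is carried along because it shows
    that \<open>{l, w}\<close> is a new edge.\<close>
  have "finite (verts G) \<and> finite (edges G) \<and> \<Union>(edges G) \<subseteq> verts G \<and>
      card (verts G) = Suc (card (edges G))"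
    using assms
  proof (induction rule: tree_induct)
    case (leaf V E l w)
    hence "{l, w} \<notin> E" by auto
    thus ?case using leaf by auto
  qed auto
  thus ?thesis by blast
qed

lemma tree_finite:
  assumes "is_tree G"
  shows "finite (verts G)" "finite (edges G)"
proof -
  show "finite (verts G)" using assms by (simp add: is_tree_def simple_graph_def)
  moreover have "edges G \<subseteq> Pow (verts G)" using assms by (auto simp: is_tree_def simple_graph_def)
  ultimately show "finite (edges G)" by (meson finite_Pow_iff finite_subset)
qed

text \<open>Two adjacent leaves would form a whole component, which has only two vertices.\<close>

lemma leaf_nbr_not_leaf:
  assumes G: "is_tree G" and "card (verts G) \<ge> 3" and l: "l \<in> leaf_set G" and e: "{l, w} \<in> edges G"
  shows "w \<notin> leaf_set G"
proof
  assume w: "w \<in> leaf_set G"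
  have "{w, l} \<in> edges G" using e by (simp add: insert_commute)
  hence ul: "z = w" if "{l, z} \<in> edges G" for z using l e that by (auto simp: leaf_set_def)
  have uw: "z = l" if "{w, z} \<in> edges G" for z
    using w \<open>{w, l} \<in> edges G\<close> that by (auto simp: leaf_set_def)
  have lV: "l \<in> verts G" using l by (simp add: leaf_set_def)
  have "v \<in> {l, w}" if "(l, v) \<in> {(x, y). {x, y} \<in> edges G}\<^sup>*" for v
    using that
  proof (induction rule: rtrancl_induct)
    case (step y z)
    thus ?case using ul[of z] uw[of z] by auto
  qed simp
  hence "verts G \<subseteq> {l, w}" using G lV by (auto simp: is_tree_def connected_graph_def)
  hence "card (verts G) \<le> card {l, w}" by (intro card_mono) auto
  also have "\<dots> \<le> 2" by (simp add: card_insert_if)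
  finally show False using assms(2) by simp
qed

text \<open>Leaves can be removed one at a time: no removed vertex is the neighbour of another leaf,
  so the remaining ones stay leaves.\<close>

lemma tree_delete_leaves:
  assumes G: "is_tree G" and c: "card (verts G) \<ge> 3" and S: "S \<subseteq> leaf_set G"
  shows "is_tree (del_verts G S)"
proof -
  have "finite S"
    using S tree_finite(1)[OF G] by (auto simp: leaf_set_def intro: finite_subset)
  thus ?thesis using S
  proof (induction S)
    case empty
    have "del_verts G {} = G" by (cases G) (simp add: del_verts_def)
    thus ?case using G by simp
  next
    case (insert l S)
    have l: "l \<in> leaf_set G" using insert.prems by simp
    then obtain w where w: "{l, w} \<in> edges G" and uniq: "\<And>z. {l, z} \<in> edges G \<Longrightarrow> z = w"
      by (auto simp: leaf_set_def)
    have "w \<notin> leaf_set G" by (rule leaf_nbr_not_leaf[OF G c l w])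
    hence "w \<notin> S" using insert.prems by blast
    hence "{l, w} \<in> edges (del_verts G S)" using w insert.hyps by (simp add: del_verts_def)
    hence "l \<in> leaf_set (del_verts G S)"
      using uniq l insert.hyps by (auto simp: leaf_set_def del_verts_def)
    hence "is_tree (del_verts (del_verts G S) {l})"
      using insert by (intro tree_delete_leaf) auto
    moreover have "del_verts (del_verts G S) {l} = del_verts G (insert l S)"
      by (auto simp: del_verts_def)
    ultimately show ?case by simp
  qed
qed

section \<open>Rainbow labellings\<close>

text \<open>As \<open>a, b\<close> range over ordered pairs, differences of distinct edges also have to differ
  after a change of sign.\<close>

definition rainbow :: "int \<Rightarrow> 'a set set \<Rightarrow> ('a \<Rightarrow> int) \<Rightarrow> bool" where
  "rainbow q E f \<longleftrightarrow> (\<forall>a b c d. {a, b} \<in> E \<longrightarrow> {c, d} \<in> E \<longrightarrow>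
     (f b - f a) mod q = (f d - f c) mod q \<longrightarrow> {a, b} = {c, d})"

lemma rainbowD:
  "rainbow q E f \<Longrightarrow> {a, b} \<in> E \<Longrightarrow> {c, d} \<in> E \<Longrightarrow> (f b - f a) mod q = (f d - f c) mod q \<Longrightarrow>
    {a, b} = {c, d}"
  unfolding rainbow_def by blast

lemma card_ordered_pairs_le:
  assumes "finite E" "\<And>e. e \<in> E \<Longrightarrow> card e = 2"
  shows "finite {(c, d). {c, d} \<in> E}" "card {(c, d). {c, d} \<in> E} \<le> 2 * card E"
proof -
  have eq: "{(c, d). {c, d} \<in> E} = (\<Union>e\<in>E. {(c, d). {c, d} = e})" by auto
  have pair: "finite {(c, d). {c, d} = e} \<and> card {(c, d). {c, d} = e} \<le> 2" if eE: "e \<in> E" for e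
  proof -
    obtain u v where e: "e = {u, v}" using assms(2)[OF eE] by (auto simp: card_2_iff)
    have sub: "{(c, d). {c, d} = e} \<subseteq> {(u, v), (v, u)}" by (auto simp: e doubleton_eq_iff)
    have "card {(u, v), (v, u)} \<le> 2" using card_length[of "[(u, v), (v, u)]"] by simp
    moreover have "card {(c, d). {c, d} = e} \<le> card {(u, v), (v, u)}"
      by (rule card_mono[OF _ sub]) simp
    moreover have "finite {(c, d). {c, d} = e}" by (rule finite_subset[OF sub]) simp
    ultimately show ?thesis by simp
  qed
  show "finite {(c, d). {c, d} \<in> E}" unfolding eq using assms(1) pair by blast
  have "card {(c, d). {c, d} \<in> E} \<le> (\<Sum>e\<in>E. card {(c, d). {c, d} = e})"
    unfolding eq by (rule card_UN_le[OF assms(1)])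
  also have "\<dots> \<le> (\<Sum>e\<in>E. 2)" using pair by (intro sum_mono) blast
  finally show "card {(c, d). {c, d} \<in> E} \<le> 2 * card E" by simp
qed

lemma tree_edgeD:
  assumes "is_tree G"
  shows "e \<in> edges G \<Longrightarrow> card e = 2" "e \<in> edges G \<Longrightarrow> e \<subseteq> verts G"
  using assms by (auto simp: is_tree_def simple_graph_def)

text \<open>A new leaf has to avoid the \<open>card E + 1\<close> labels in use and, for each old
  edge, the two labels that would repeat its difference in one direction or the other. These are at
  most \<open>3 * card E + 1\<close> values, one fewer than the hypothesis on \<open>q\<close>
  provides.\<close>

lemma greedy_rainbow:
  assumes "is_tree G" and "3 * card (edges G) \<le> q + 1" and "q > 0"
  shows "\<exists>f. inj_on f (verts G) \<and> f ` verts G \<subseteq> {0..<int q} \<and> rainbow (int q) (edges G) f"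
  using assms(1,2)
proof (induction rule: tree_induct)
  case (single v)
  show ?case using \<open>q > 0\<close> by (intro exI[of _ "\<lambda>_. 0"]) (simp add: rainbow_def)
next
  case (leaf V E l w)
  have T: "is_tree \<lparr>verts = V, edges = E\<rparr>" by (rule leaf.hyps)
  have fin: "finite V" "finite E" using tree_finite[OF T] by simp_all
  have E: "card e = 2" "e \<subseteq> V" if "e \<in> E" for e using tree_edgeD[OF T, of e] that by simp_all
  have "{l, w} \<notin> E" using E leaf.hyps(2) by blast
  hence q: "3 * card E + 2 \<le> q" using leaf.prems fin by simp
  then obtain f where f: "inj_on f V" "f ` V \<subseteq> {0..<int q}" "rainbow (int q) E f"
    using leaf.IH by auto
  define bad where "bad = f ` V \<union> (\<lambda>(c, d). (f w + f d - f c) mod int q) ` {(c, d). {c, d} \<in> E}"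
  have "card (f ` V) \<le> card E + 1" using card_image_le[OF fin(1), of f] tree_card[OF T] by simp
  moreover have "card ((\<lambda>(c, d). (f w + f d - f c) mod int q) ` {(c, d). {c, d} \<in> E}) \<le> 2 * card E"
    using card_ordered_pairs_le[OF fin(2) E(1)] by (meson card_image_le le_trans)
  ultimately have "card bad \<le> 3 * card E + 1"
    unfolding bad_def
    using card_Un_le[of "f ` V" "(\<lambda>(c, d). (f w + f d - f c) mod int q) ` {(c, d). {c, d} \<in> E}"]
    by linarith
  hence "card bad < card {0..<int q}" using q by simp
  moreover have "finite bad" unfolding bad_def using fin card_ordered_pairs_le[OF fin(2) E(1)] by simp
  ultimately obtain x where x: "x \<in> {0..<int q}" "x \<notin> bad"
    by (meson card_mono leD subsetI)
  have off: "(x - f w) mod int q \<noteq> (f d - f c) mod int q" if "{c, d} \<in> E" for c d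
  proof
    assume "(x - f w) mod int q = (f d - f c) mod int q"
    hence "(x - f w + f w) mod int q = (f d - f c + f w) mod int q" by (rule mod_add_cong) simp
    hence "x = (f w + f d - f c) mod int q" using x(1) by (simp add: algebra_simps)
    thus False using x(2) that by (auto simp: bad_def)
  qed
  have off': "(f w - x) mod int q \<noteq> (f d - f c) mod int q" if "{c, d} \<in> E" for c d
  proof
    assume "(f w - x) mod int q = (f d - f c) mod int q"
    hence "(- (f w - x)) mod int q = (- (f d - f c)) mod int q" by (rule mod_minus_cong)
    thus False using off[of d c] that by (simp add: insert_commute)
  qed
  have ne: "a \<noteq> l \<and> b \<noteq> l" if "{a, b} \<in> E" for a b using E(2)[OF that] leaf.hyps(2) by auto
  let ?f = "f(l := x)"
  have "inj_on ?f (insert l V)"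
    using f(1) x(2) leaf.hyps(2) by (auto simp: inj_on_def bad_def)
  moreover have "?f ` insert l V \<subseteq> {0..<int q}"
    using f(2) x(1) leaf.hyps(2) by auto
  moreover have "rainbow (int q) (insert {l, w} E) ?f"
    unfolding rainbow_def
  proof (intro allI impI)
    fix a b c d
    assume ab: "{a, b} \<in> insert {l, w} E" and cd: "{c, d} \<in> insert {l, w} E"
      and eq: "(?f b - ?f a) mod int q = (?f d - ?f c) mod int q"
    have wl: "w \<noteq> l" using leaf.hyps by blast
    have new: "False" if "{c, d} \<in> E" "{a, b} = {l, w}" 
       "(?f b - ?f a) mod int q = (?f d - ?f c) mod int q" for a b c d
    proof -
      have "a = l \<and> b = w \<or> a = w \<and> b = l" using that(2) by (auto simp: doubleton_eq_iff)
      thus False using that(3) ne[OF that(1)] off[OF that(1)] off'[OF that(1)] wl by auto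
    qed
    consider "{a, b} \<in> E" "{c, d} \<in> E" | "{a, b} \<in> E" "{c, d} = {l, w}" |
       "{a, b} = {l, w}" "{c, d} \<in> E" | "{a, b} = {l, w}" "{c, d} = {l, w}"
      using ab cd by blast
    thus "{a, b} = {c, d}"
    proof cases
      case 1
      thus ?thesis using eq ne[OF 1(1)] ne[OF 1(2)] rainbowD[OF f(3), of a b c d] by simp
    next
      case 2
      thus ?thesis using new[of a b c d] eq by simp
    next
      case 3
      thus ?thesis using new[of c d a b] eq by simp
    qed simp
  qed
  ultimately show ?case unfolding ugraph.simps by (intro exI[of _ ?f] conjI)
qed

text \<open>The interval from 1 to \<open>m\<close> serves as a set of representatives of the
  nonzero residues up to sign, by which edge differences are counted.\<close>

lemma half_residues_distinct:
  fixes x y q :: int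
  assumes "q = 2 * m + 1" "x \<in> {1..m}" "y \<in> {1..m}"
    and "x mod q = y mod q \<or> x mod q = (- y) mod q"
  shows "x = y"
proof -
  have "x mod q = x" "y mod q = y" using assms by auto
  moreover have "(- y) mod q = q - y"
    using assms(1,3) by (subst zmod_zminus1_eq_if) auto
  ultimately show ?thesis using assms by auto
qed

text \<open>The old edges occupy at most \<open>card E\<close> of the \<open>m\<close> residues up
  to sign, so at least \<open>card S\<close> are free. Assigning them to the leaves in any order
  keeps the labelling rainbow, and this freedom is what the transversal theorem exploits to make the
  labels \<open>f (s l) + \<beta> l\<close> distinct. Such a label may still coincide with a label
  on \<open>V\<close>.\<close>

lemma rainbow_extend_leaves:
  fixes V :: "'a set" and f :: "'a \<Rightarrow> int"
  assumes q: "prime (2 * m + 1)" and finE: "finite E" and E: "\<And>e. e \<in> E \<Longrightarrow> card e = 2 \<and> e \<subseteq> V"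
    and f: "f ` V \<subseteq> {0..<int (2 * m + 1)}" "rainbow (int (2 * m + 1)) E f"
    and S: "finite S" "S \<inter> V = {}" "\<And>l. l \<in> S \<Longrightarrow> s l \<in> V" and card: "card S + card E = m"
  shows "\<exists>g. (\<forall>v\<in>V. g v = f v) \<and> g ` (V \<union> S) \<subseteq> {0..<int (2 * m + 1)} \<and> inj_on g S \<and>
    rainbow (int (2 * m + 1)) (E \<union> (\<lambda>l. {l, s l}) ` S) g \<and> (\<forall>l\<in>S. g l \<noteq> g (s l))"
proof -
  define q where "q = int (2 * m + 1)"
  have qm: "q = 2 * int m + 1" by (simp add: q_def)
  define U where "U = (\<Union>e\<in>E. {r \<in> {1..int m}. \<exists>a b. e = {a, b} \<and> (f b - f a) mod q = r mod q})"
  have one: "card {r \<in> {1..int m}. \<exists>a b. e = {a, b} \<and> (f b - f a) mod q = r mod q} \<le> 1"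
    if "e \<in> E" for e
  proof -
    let ?R = "{r \<in> {1..int m}. \<exists>a b. e = {a, b} \<and> (f b - f a) mod q = r mod q}"
    have fin: "finite ?R" by (rule finite_subset[of _ "{1..int m}"]) auto
    have all: "\<forall>x\<in>?R. \<forall>y\<in>?R. x = y"
    proof (intro ballI, clarsimp)
      fix x y a b c d
      assume xy: "1 \<le> x" "x \<le> int m" "1 \<le> y" "y \<le> int m" and e: "{a, b} = {c, d}"
        and x: "(f b - f a) mod q = x mod q" and y: "(f d - f c) mod q = y mod q"
      have "x mod q = y mod q \<or> x mod q = (- y) mod q"
      proof (cases "a = c \<and> b = d")
        case False
        hence "f b - f a = - (f d - f c)" using e by (auto simp: doubleton_eq_iff)
        hence "x mod q = (- (f d - f c)) mod q" using x by simp
        also have "\<dots> = (- y) mod q" using y by (rule mod_minus_cong)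
        finally show ?thesis ..
      qed (use x y in auto)
      thus "x = y" using half_residues_distinct[of q "int m" x y] xy by (simp add: q_def)
    qed
    show ?thesis unfolding One_nat_def by (rule iffD2[OF card_le_Suc0_iff_eq[OF fin] all])
  qed
  have "finite U" by (rule finite_subset[of _ "{1..int m}"]) (auto simp: U_def)
  have "card U \<le> (\<Sum>e\<in>E. 1)"
    unfolding U_def using one by (intro order.trans[OF card_UN_le[OF finE]] sum_mono)
  moreover have "card ({1..int m} - U) = m - card U"
    by (subst card_Diff_subset) (use \<open>finite U\<close> in \<open>auto simp: U_def\<close>)
  ultimately have "card S \<le> card ({1..int m} - U)" using card by simp
  then obtain D where D: "D \<subseteq> {1..int m} - U" "card D = card S"
    by (meson obtain_subset_with_card_n)
  define K where "K = card S"
  have "finite D" using D(1) by (meson finite_Diff finite_atLeastAtMost_int finite_subset)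
  then obtain b where b: "bij_betw b {0..<K} D"
    using ex_bij_betw_nat_finite D(2) K_def by metis
  obtain t where t: "bij_betw t {0..<K} S"
    using ex_bij_betw_nat_finite S(1) K_def by metis
  have bD: "b i \<in> D" if "i < K" for i using b that by (auto simp: bij_betw_def)
  have bhalf: "b i \<in> {1..int m}" if "i < K" for i using bD[OF that] D(1) by blast
  have binj: "i = j" if "i < K" "j < K" "b i = b j" for i j
    using b that by (auto simp: bij_betw_def inj_on_def)
  have bdist: "i = j" if "i < K" "j < K" "b i mod q = b j mod q \<or> b i mod q = (- b j) mod q" for i j
    using binj[OF that(1,2) half_residues_distinct[OF qm bhalf[OF that(1)] bhalf[OF that(2)] that(3)]] .
  have "K < 2 * m + 1" using card K_def by simp
  \<comment> \<open>The values \<open>f (s (t i))\<close> may repeat, as several leaves can share a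
    neighbour; only the values \<open>b\<close> have to be distinct modulo \<open>q\<close>.\<close>
  then obtain \<pi> where \<pi>: "\<pi> permutes {0..<K}"
    and inj: "inj_on (\<lambda>i. (f (s (t i)) + b (\<pi> i)) mod q) {0..<K}"
    using additive_latin_transversal[OF assms(1), of K b "\<lambda>i. f (s (t i))"] bdist
    unfolding q_def by blast
  define idx where "idx = inv_into {0..<K} t"
  have idx: "idx l < K" "t (idx l) = l" if "l \<in> S" for l
    using t that bij_betwE[OF bij_betw_inv_into[OF t]]
    by (auto simp: idx_def bij_betw_def f_inv_into_f)
  have \<pi>K: "\<pi> i < K" if "i < K" for i using permutes_in_image[OF \<pi>, of i] that by simp
  define \<beta> where "\<beta> = (\<lambda>l. b (\<pi> (idx l)))"
  define g where "g = (\<lambda>v. if v \<in> S then (f (s v) + \<beta> v) mod q else f v)"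
  have \<beta>D: "\<beta> l \<in> D" if "l \<in> S" for l using bD \<pi>K idx(1)[OF that] by (simp add: \<beta>_def)
  have \<beta>dist: "l = l'" if "l \<in> S" "l' \<in> S" "\<beta> l mod q = \<beta> l' mod q \<or> \<beta> l mod q = (- \<beta> l') mod q" for l l'
  proof -
    have "\<pi> (idx l) = \<pi> (idx l')"
      using bdist[of "\<pi> (idx l)" "\<pi> (idx l')"] that \<pi>K idx(1) by (simp add: \<beta>_def)
    hence "idx l = idx l'" using permutes_inj[OF \<pi>] by (simp add: inj_eq)
    thus ?thesis using idx(2) that by metis
  qed
  have gV: "g v = f v" if "v \<in> V" for v using that S(2) by (auto simp: g_def)
  have gS: "(g l - g (s l)) mod q = \<beta> l mod q" if "l \<in> S" for l
  proof -
    have "g (s l) = f (s l)" using gV S(3)[OF that] by simp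
    moreover have "((f (s l) + \<beta> l) mod q - f (s l)) mod q = \<beta> l mod q"
      by (simp add: mod_diff_left_eq)
    ultimately show ?thesis using that by (simp add: g_def)
  qed
  have gS': "(g (s l) - g l) mod q = (- \<beta> l) mod q" if "l \<in> S" for l
    using mod_minus_cong[OF gS[OF that]] by simp
  have \<beta>U: "(g b - g a) mod q \<noteq> \<beta> l mod q" if "l \<in> S" "{a, b} \<in> E" for a b l
  proof
    assume "(g b - g a) mod q = \<beta> l mod q"
    moreover have "a \<in> V" "b \<in> V" using E[OF that(2)] by auto
    ultimately have "\<beta> l \<in> U" using gV \<beta>D[OF that(1)] D(1) that(2) by (auto simp: U_def)
    thus False using \<beta>D[OF that(1)] D(1) by blast
  qed
  have \<beta>U': "(g b - g a) mod q \<noteq> (- \<beta> l) mod q" if "l \<in> S" "{a, b} \<in> E" for a b l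
  proof
    assume "(g b - g a) mod q = (- \<beta> l) mod q"
    from mod_minus_cong[OF this] show False using \<beta>U[of l b a] that by (simp add: insert_commute)
  qed
  have leafcase: "\<exists>l\<in>S. {a, b} = {l, s l} \<and>
      ((g b - g a) mod q = \<beta> l mod q \<or> (g b - g a) mod q = (- \<beta> l) mod q)"
    if "{a, b} \<in> (\<lambda>l. {l, s l}) ` S" for a b
  proof -
    from that obtain l where l: "l \<in> S" "{a, b} = {l, s l}" by blast
    hence "a = l \<and> b = s l \<or> a = s l \<and> b = l" by (auto simp: doubleton_eq_iff)
    thus ?thesis using gS[OF l(1)] gS'[OF l(1)] l by auto
  qed
  \<comment> \<open>Two residues that agree up to sign with a third agree up to sign with each
    other; \<open>z\<close> will be the common difference of two leaf edges.\<close>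
  have neg2: "x mod q = y mod q \<or> x mod q = (- y) mod q"
    if "z mod q = x mod q \<or> z mod q = (- x) mod q" "z mod q = y mod q \<or> z mod q = (- y) mod q" for x y z :: int
    using that mod_minus_cong[of "- x" q y] mod_minus_cong[of "- x" q "- y"] by auto
  have "rainbow q (E \<union> (\<lambda>l. {l, s l}) ` S) g"
    unfolding rainbow_def
  proof (intro allI impI)
    fix a b c d
    assume ab: "{a, b} \<in> E \<union> (\<lambda>l. {l, s l}) ` S" and cd: "{c, d} \<in> E \<union> (\<lambda>l. {l, s l}) ` S"
      and eq: "(g b - g a) mod q = (g d - g c) mod q"
    consider "{a, b} \<in> E" "{c, d} \<in> E" | "{a, b} \<in> E" "{c, d} \<in> (\<lambda>l. {l, s l}) ` S" |
       "{a, b} \<in> (\<lambda>l. {l, s l}) ` S" "{c, d} \<in> E" |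
       "{a, b} \<in> (\<lambda>l. {l, s l}) ` S" "{c, d} \<in> (\<lambda>l. {l, s l}) ` S"
      using ab cd by blast
    thus "{a, b} = {c, d}"
    proof cases
      case 1
      hence "a \<in> V" "b \<in> V" "c \<in> V" "d \<in> V" using E[OF 1(1)] E[OF 1(2)] by auto
      thus ?thesis using rainbowD[OF f(2)] 1 eq gV by (simp add: q_def)
    next
      case 2
      thus ?thesis using leafcase[OF 2(2)] \<beta>U[OF _ 2(1)] \<beta>U'[OF _ 2(1)] eq by auto
    next
      case 3
      thus ?thesis using leafcase[OF 3(1)] \<beta>U[OF _ 3(2)] \<beta>U'[OF _ 3(2)] eq by auto
    next
      case 4
      obtain l where l: "l \<in> S" "{a, b} = {l, s l}"
        "(g b - g a) mod q = \<beta> l mod q \<or> (g b - g a) mod q = (- \<beta> l) mod q"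
        using leafcase[OF 4(1)] by blast
      obtain l' where l': "l' \<in> S" "{c, d} = {l', s l'}"
        "(g d - g c) mod q = \<beta> l' mod q \<or> (g d - g c) mod q = (- \<beta> l') mod q"
        using leafcase[OF 4(2)] by blast
      have "l = l'" using \<beta>dist[OF l(1) l'(1)] neg2[OF l(3)] l'(3) eq by simp
      thus ?thesis using l l' by simp
    qed
  qed
  moreover have "inj_on g S"
  proof (rule inj_onI)
    fix l l' assume l: "l \<in> S" "l' \<in> S" "g l = g l'"
    have "idx l = idx l'"
      using inj_onD[OF inj, of "idx l" "idx l'"] l idx by (simp add: g_def \<beta>_def)
    thus "l = l'" using idx(2) l by metis
  qed
  moreover have "g ` (V \<union> S) \<subseteq> {0..<q}"
    using f(1) gV by (auto simp: g_def q_def)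
  moreover have "g l \<noteq> g (s l)" if "l \<in> S" for l
  proof
    assume "g l = g (s l)"
    hence "\<beta> l mod q = 0" using gS[OF that] by simp
    moreover have "\<beta> l \<in> {1..int m}" using \<beta>D[OF that] D(1) by blast
    ultimately show False by (simp add: q_def)
  qed
  ultimately show ?thesis using gV unfolding q_def by (intro exI[of _ g] conjI ballI)
qed

section \<open>Four-colouring the labels\<close>

text \<open>By counting: the \<open>m\<close> edges read in both directions give
  \<open>2 * m\<close> nonzero differences. They are pairwise distinct, since \<open>q\<close> is
  odd and a nonzero difference is not its own negative, so they exhaust the \<open>q - 1\<close>
  nonzero residues.\<close>

lemma rainbow_covers:
  fixes m :: nat and f :: "'a \<Rightarrow> int"
  assumes q: "q = 2 * int m + 1" and r: "rainbow q E f" and "finite E" and card: "card E = m"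
    and E: "\<And>e. e \<in> E \<Longrightarrow> card e = 2"
    and f: "\<And>a b. {a, b} \<in> E \<Longrightarrow> f a \<in> {0..<q} \<and> f b \<in> {0..<q} \<and> f a \<noteq> f b"
    and d: "d \<in> {1..<q}"
  shows "\<exists>a b. {a, b} \<in> E \<and> (f b - f a) mod q = d"
proof -
  have qpos: "0 < q" using q by simp
  define A where "A = {(a, b). {a, b} \<in> E}"
  define F where "F = (\<lambda>(a, b). (f b - f a) mod q)"
  have finA: "finite A" unfolding A_def by (rule card_ordered_pairs_le[OF \<open>finite E\<close> E])
  have sub: "F ` A \<subseteq> {1..<q}"
  proof
    fix x assume "x \<in> F ` A"
    then obtain a b where ab: "{a, b} \<in> E" "x = (f b - f a) mod q" by (auto simp: A_def F_def)
    have "x \<noteq> 0"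
    proof
      assume "x = 0"
      hence "f b mod q = f a mod q" using ab(2) by (simp add: mod_eq_dvd_iff mod_eq_0_iff_dvd)
      thus False using f[OF ab(1)] by simp
    qed
    moreover have "0 \<le> x" "x < q"
      unfolding ab(2) by (rule pos_mod_sign[OF qpos], rule pos_mod_bound[OF qpos])
    ultimately show "x \<in> {1..<q}" by simp
  qed
  have inj: "inj_on F A"
  proof (rule inj_onI)
    fix x y assume xy: "x \<in> A" "y \<in> A" "F x = F y"
    obtain a b c d where x: "x = (a, b)" and y: "y = (c, d)" by fastforce
    have ab: "{a, b} \<in> E" and cd: "{c, d} \<in> E" using xy x y by (auto simp: A_def)
    have eq: "(f b - f a) mod q = (f d - f c) mod q" using xy(3) by (simp add: x y F_def)
    have e: "{a, b} = {c, d}" by (rule rainbowD[OF r ab cd eq])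
    show "x = y"
    proof (rule ccontr)
      assume "x \<noteq> y"
      hence "c = b" "d = a" using e x y by (auto simp: doubleton_eq_iff)
      hence "q dvd 2 * (f b - f a)" using eq by (simp add: mod_eq_dvd_iff algebra_simps)
      moreover have "coprime q 2" using q by simp
      ultimately have "q dvd f b - f a" by (simp only: coprime_dvd_mult_right_iff)
      hence "f b mod q = f a mod q" by (simp add: mod_eq_dvd_iff)
      thus False using f[OF ab] by simp
    qed
  qed
  have "card A = 2 * m"
  proof -
    have eq: "A = (\<Union>e\<in>E. {(a, b). {a, b} = e})" by (auto simp: A_def)
    have "finite {(a, b). {a, b} = e} \<and> card {(a, b). {a, b} = e} = 2" if "e \<in> E" for e
    proof -
      obtain u v where e: "e = {u, v}" "u \<noteq> v" using E[OF \<open>e \<in> E\<close>] by (auto simp: card_2_iff)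
      have "{(a, b). {a, b} = e} = {(u, v), (v, u)}" by (auto simp: e doubleton_eq_iff)
      thus ?thesis using e(2) by simp
    qed
    hence "card A = (\<Sum>e\<in>E. 2)"
      unfolding eq using \<open>finite E\<close> by (subst card_UN_disjoint) auto
    thus ?thesis using card by simp
  qed
  hence "card (F ` A) = card {1..<q}" using card_image[OF inj] q by simp
  hence "F ` A = {1..<q}" using sub by (intro card_subset_eq) auto
  hence "d \<in> F ` A" using d by simp
  thus ?thesis by (auto simp: A_def F_def)
qed

lemma degenerate_four_colouring:
  fixes adj :: "'a \<Rightarrow> 'a \<Rightarrow> bool"
  assumes "finite P" and sym: "\<And>y z. adj y z \<Longrightarrow> adj z y" and irr: "\<And>y. \<not> adj y y"
    and deg: "\<And>Q. Q \<subseteq> P \<Longrightarrow> Q \<noteq> {} \<Longrightarrow> \<exists>y\<in>Q. card {z \<in> Q. adj y z} \<le> 3"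
  shows "\<exists>\<delta>. (\<forall>y. \<delta> y < (4 :: nat)) \<and> (\<forall>y\<in>P. \<forall>z\<in>P. adj y z \<longrightarrow> \<delta> y \<noteq> \<delta> z)"
  using assms(1) deg
proof (induction "card P" arbitrary: P)
  case 0
  hence "P = {}" by simp
  thus ?case by (intro exI[of _ "\<lambda>_. 0"]) simp
next
  case (Suc n)
  hence "P \<noteq> {}" by auto
  then obtain y where y: "y \<in> P" "card {z \<in> P. adj y z} \<le> 3" using Suc.prems(2)[of P] by blast
  have "n = card (P - {y})" using Suc.hyps(2) y(1) Suc.prems(1) by simp
  moreover have "\<exists>y\<in>Q. card {z \<in> Q. adj y z} \<le> 3" if "Q \<subseteq> P - {y}" "Q \<noteq> {}" for Q
    using Suc.prems(2)[of Q] that by blast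
  ultimately obtain \<delta> where \<delta>: "\<forall>y. \<delta> y < (4 :: nat)"
    "\<forall>u\<in>P - {y}. \<forall>z\<in>P - {y}. adj u z \<longrightarrow> \<delta> u \<noteq> \<delta> z"
    using Suc.hyps(1)[of "P - {y}"] Suc.prems(1) by auto
  have "card (\<delta> ` {z \<in> P. adj y z}) \<le> 3"
    using y(2) Suc.prems(1) card_image_le[of "{z \<in> P. adj y z}" \<delta>] by simp
  hence "card (\<delta> ` {z \<in> P. adj y z}) < card {..<4::nat}" by simp
  moreover have "finite (\<delta> ` {z \<in> P. adj y z})" using Suc.prems(1) by simp
  ultimately have "\<not> {..<4} \<subseteq> \<delta> ` {z \<in> P. adj y z}" using card_mono leD by blast
  then obtain c where c: "c < 4" "c \<notin> \<delta> ` {z \<in> P. adj y z}" by auto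
  show ?case
  proof (intro exI[of _ "\<delta>(y := c)"] conjI allI ballI impI)
    fix u show "(\<delta>(y := c)) u < 4" using \<delta>(1) c(1) by simp
  next
    fix u z assume uz: "u \<in> P" "z \<in> P" "adj u z"
    consider "u = y" "z \<noteq> y" | "u \<noteq> y" "z = y" | "u \<noteq> y" "z \<noteq> y" using uz(3) irr by blast
    thus "(\<delta>(y := c)) u \<noteq> (\<delta>(y := c)) z"
    proof cases
      case 1
      thus ?thesis using uz c(2) by auto
    next
      case 2
      thus ?thesis using uz c(2) sym by auto
    next
      case 3
      thus ?thesis using uz \<delta>(2) by simp
    qed
  qed
qed

text \<open>An induced subgraph of a tree is a forest; induction along leaves avoids splitting it
  into components.\<close>

lemma tree_induced_edges:
  assumes "is_tree G" "W \<subseteq> verts G" "W \<noteq> {}"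
  shows "card {e \<in> edges G. e \<subseteq> W} < card W"
  using assms
proof (induction arbitrary: W rule: tree_induct)
  case (single v)
  thus ?case by (auto simp: subset_singleton_iff)
next
  case (leaf V E l w)
  have T: "is_tree \<lparr>verts = V, edges = E\<rparr>" by (rule leaf.hyps)
  have fin: "finite V" "finite E" using tree_finite[OF T] by simp_all
  have E: "e \<subseteq> V" if "e \<in> E" for e using tree_edgeD[OF T, of e] that by simp_all
  have wl: "w \<noteq> l" using leaf.hyps by blast
  have finW: "finite W" using leaf.prems(1) fin(1) by (simp add: finite_subset)
  show ?case
  proof (cases "l \<in> W")
    case False
    hence "{e \<in> insert {l, w} E. e \<subseteq> W} = {e \<in> E. e \<subseteq> W}" by auto
    moreover have "W \<subseteq> V" using False leaf.prems(1) by auto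
    ultimately show ?thesis using leaf.IH[of W] leaf.prems(2) by simp
  next
    case True
    show ?thesis
    proof (cases "W = {l}")
      case True
      have "\<not> e \<subseteq> {l}" if "e \<in> insert {l, w} E" for e
      proof
        assume "e \<subseteq> {l}"
        hence "e \<in> E" using that wl by auto
        hence "card e = 2" "e \<subseteq> V" using tree_edgeD[OF T, of e] by simp_all
        thus False using \<open>e \<subseteq> {l}\<close> leaf.hyps(2) by (auto simp: subset_singleton_iff)
      qed
      hence none: "{e \<in> insert {l, w} E. e \<subseteq> {l}} = {}" by blast
      show ?thesis unfolding ugraph.simps True none by simp
    next
      case False
      have "{e \<in> insert {l, w} E. e \<subseteq> W} \<subseteq> insert {l, w} {e \<in> E. e \<subseteq> W - {l}}"
        using E leaf.hyps(2) by blast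
      hence "card {e \<in> insert {l, w} E. e \<subseteq> W} \<le> card (insert {l, w} {e \<in> E. e \<subseteq> W - {l}})"
        using fin by (intro card_mono) auto
      also have "\<dots> \<le> Suc (card {e \<in> E. e \<subseteq> W - {l}})"
        using fin by (simp add: card_insert_if)
      also have "card {e \<in> E. e \<subseteq> W - {l}} < card (W - {l})"
        using leaf.IH[of "W - {l}"] leaf.prems False True by auto
      also have "Suc (card (W - {l})) = card W" by (rule card_Suc_Diff1[OF finW True])
      finally show ?thesis by simp
    qed
  qed
qed

text \<open>Inside a set \<open>Q\<close> of labels there are at most \<open>|Q| - 1\<close> edges of the base tree and at most
  \<open>|Q|\<close> leaf edges, so the average degree is below four.\<close>

lemma leaf_extension_four_colouring:
  fixes G :: "'a ugraph" and f :: "'a \<Rightarrow> 'b"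
  assumes G: "is_tree G" and S: "finite S" "S \<inter> verts G = {}" "\<And>l. l \<in> S \<Longrightarrow> s l \<in> verts G"
    and f: "inj_on f (verts G)" "inj_on f S" "\<And>l. l \<in> S \<Longrightarrow> f l \<noteq> f (s l)"
  shows "\<exists>\<delta>. (\<forall>y. \<delta> y < (4 :: nat)) \<and>
    (\<forall>a b. {a, b} \<in> edges G \<union> (\<lambda>l. {l, s l}) ` S \<longrightarrow> \<delta> (f a) \<noteq> \<delta> (f b))"
proof -
  define E where "E = edges G \<union> (\<lambda>l. {l, s l}) ` S"
  define adj where "adj = (\<lambda>y z. \<exists>a b. {a, b} \<in> E \<and> y = f a \<and> z = f b)"
  define P where "P = f ` (verts G \<union> S)"
  have fin: "finite (verts G)" "finite (edges G)" using tree_finite[OF G] by auto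
  have neq: "f a \<noteq> f b" if "{a, b} \<in> E" for a b
  proof (cases "{a, b} \<in> edges G")
    case True
    hence "a \<in> verts G" "b \<in> verts G" "a \<noteq> b" using G simple_graphD[of G a b] by (auto simp: is_tree_def)
    thus ?thesis using f(1) by (auto dest: inj_onD)
  next
    case False
    then obtain l where "l \<in> S" "{a, b} = {l, s l}" using \<open>{a, b} \<in> E\<close> by (auto simp: E_def)
    thus ?thesis using f(3)[of l] by (auto simp: doubleton_eq_iff)
  qed
  have EP: "f a \<in> P" "f b \<in> P" if "{a, b} \<in> E" for a b
  proof -
    have "{a, b} \<subseteq> verts G \<union> S"
      using that tree_edgeD(2)[OF G, of "{a, b}"] S(3) by (auto simp: E_def doubleton_eq_iff)
    thus "f a \<in> P" "f b \<in> P" by (auto simp: P_def)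
  qed
  have "\<exists>\<delta>. (\<forall>y. \<delta> y < (4 :: nat)) \<and> (\<forall>y\<in>P. \<forall>z\<in>P. adj y z \<longrightarrow> \<delta> y \<noteq> \<delta> z)"
  proof (rule degenerate_four_colouring)
    show "finite P" using fin S(1) by (simp add: P_def)
    show "adj z y" if yz: "adj y z" for y z
    proof -
      obtain a b where ab: "{a, b} \<in> E" "y = f a" "z = f b" using yz by (auto simp: adj_def)
      hence "{b, a} \<in> E" by (simp add: insert_commute)
      thus ?thesis using ab unfolding adj_def by blast
    qed
    show "\<not> adj y y" for y using neq by (auto simp: adj_def)
    fix Q assume Q: "Q \<subseteq> P" "Q \<noteq> {}"
    have finQ: "finite Q" using Q(1) \<open>finite P\<close> by (rule finite_subset)
    define EQ where "EQ = {e \<in> E. f ` e \<subseteq> Q}"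
    have finEQ: "finite EQ" using fin S(1) by (simp add: E_def EQ_def)
    have EQ2: "card e = 2" if eQ: "e \<in> EQ" for e
    proof (cases "e \<in> edges G")
      case False
      then obtain l where l: "l \<in> S" "e = {l, s l}" using eQ by (auto simp: EQ_def E_def)
      have "s l \<in> verts G" by (rule S(3)[OF l(1)])
      hence "l \<noteq> s l" using S(2) l(1) by auto
      thus ?thesis using l by simp
    qed (rule tree_edgeD(1)[OF G])
    note finpairs = card_ordered_pairs_le[OF finEQ EQ2]
    show "\<exists>y\<in>Q. card {z \<in> Q. adj y z} \<le> 3"
    proof (rule ccontr)
      assume "\<not> ?thesis"
      hence "4 \<le> card {z \<in> Q. adj y z}" if "y \<in> Q" for y using that by force
      hence "(\<Sum>y\<in>Q. 4) \<le> (\<Sum>y\<in>Q. card {z \<in> Q. adj y z})" by (intro sum_mono) auto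
      also have "\<dots> = card (SIGMA y:Q. {z \<in> Q. adj y z})" using finQ by simp
      \<comment> \<open>Distinct edges may carry the same pair of labels, so the adjacent pairs are
        an image of the ordered edges, and their number is bounded rather than computed.\<close>
      also have "\<dots> \<le> card ((\<lambda>(a, b). (f a, f b)) ` {(a, b). {a, b} \<in> EQ})"
        using finpairs by (intro card_mono) (auto simp: adj_def EQ_def)
      also have "\<dots> \<le> card {(a, b). {a, b} \<in> EQ}" by (rule card_image_le[OF finpairs(1)])
      also have "\<dots> \<le> 2 * card EQ" by (rule finpairs(2))
      finally have "2 * card Q \<le> card EQ" by simp
      moreover have "card EQ < 2 * card Q"
      proof -
        define W where "W = {v \<in> verts G. f v \<in> Q}"
        define SQ where "SQ = {l \<in> S. f l \<in> Q}"
        have "card (f ` SQ) = card SQ" using f(2) by (intro card_image) (auto simp: SQ_def inj_on_def)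
        moreover have "card (f ` SQ) \<le> card Q" using finQ by (intro card_mono) (auto simp: SQ_def)
        ultimately have SQ: "card SQ \<le> card Q" by simp
        have "card (f ` W) = card W" using f(1) by (intro card_image) (auto simp: W_def inj_on_def)
        moreover have "card (f ` W) \<le> card Q" using finQ by (intro card_mono) (auto simp: W_def)
        ultimately have W: "card W \<le> card Q" by simp
        have "card {e \<in> edges G. e \<subseteq> W} < card Q"
        proof (cases "W = {}")
          case True
          hence none: "{e \<in> edges G. e \<subseteq> W} = {}" using tree_edgeD(1)[OF G] by fastforce
          show ?thesis unfolding none using Q(2) finQ by (simp add: card_gt_0_iff)
        next
          case False
          thus ?thesis using tree_induced_edges[OF G, of W] W by (auto simp: W_def)
        qed
        moreover have "EQ \<subseteq> {e \<in> edges G. e \<subseteq> W} \<union> (\<lambda>l. {l, s l}) ` SQ"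
          using tree_edgeD(2)[OF G] by (fastforce simp: EQ_def E_def W_def SQ_def)
        hence "card EQ \<le> card ({e \<in> edges G. e \<subseteq> W} \<union> (\<lambda>l. {l, s l}) ` SQ)"
          using fin S(1) by (intro card_mono) (auto simp: SQ_def)
        moreover have "\<dots> \<le> card {e \<in> edges G. e \<subseteq> W} + card ((\<lambda>l. {l, s l}) ` SQ)"
          by (rule card_Un_le)
        moreover have "card ((\<lambda>l. {l, s l}) ` SQ) \<le> card SQ"
          using S(1) by (intro card_image_le) (simp add: SQ_def)
        ultimately show ?thesis using SQ by linarith
      qed
      finally show False by simp
    qed
  qed
  then obtain \<delta> where \<delta>: "\<forall>y. \<delta> y < (4 :: nat)" "\<forall>y\<in>P. \<forall>z\<in>P. adj y z \<longrightarrow> \<delta> y \<noteq> \<delta> z" by blast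
  have "\<delta> (f a) \<noteq> \<delta> (f b)" if "{a, b} \<in> E" for a b
    using \<delta>(2) EP[OF that] that by (auto simp: adj_def)
  thus ?thesis using \<delta>(1) unfolding E_def by (intro exI[of _ \<delta>] conjI allI impI) simp_all
qed

text \<open>Here \<open>v\<close> is the leaf set aside, \<open>\<delta>\<close> colours the labels, and \<open>\<gamma>\<close> is 0 on inner vertices and 1 on
  leaves; at most one vertex of each kind carries a given label.\<close>

lemma tree_labelling:
  fixes T :: "'a ugraph"
  assumes T: "is_tree T" and k: "card (edges T) = m + 1" "m > 0" and p: "prime (2 * m + 1)"
    and leaves: "m + 1 \<le> 3 * card (leaf_set T)" and q: "q = 2 * int m + 1"
  shows "\<exists>u v (f :: 'a \<Rightarrow> int) (\<gamma> :: 'a \<Rightarrow> int) (\<delta> :: int \<Rightarrow> nat).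
    {u, v} \<in> edges T \<and> (\<forall>e\<in>edges T. v \<in> e \<longrightarrow> e = {u, v}) \<and> f ` (verts T - {v}) \<subseteq> {0..<q} \<and>
    (\<forall>d\<in>{1..<q}. \<exists>a b. {a, b} \<in> edges T - {{u, v}} \<and> (f b - f a) mod q = d) \<and>
    (\<forall>y. \<delta> y < 4) \<and> (\<forall>a b. {a, b} \<in> edges T - {{u, v}} \<longrightarrow> \<delta> (f a) \<noteq> \<delta> (f b)) \<and>
    \<gamma> u = 0 \<and> (\<forall>a. \<gamma> a \<in> {0, 1}) \<and>
    (\<forall>a\<in>verts T - {v}. \<forall>b\<in>verts T - {v}. f a = f b \<longrightarrow> \<gamma> a = \<gamma> b \<longrightarrow> a = b)"
proof -
  define L where "L = leaf_set T"
  define G where "G = del_verts T L"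
  have simple: "simple_graph T" using T by (simp add: is_tree_def)
  have cV: "card (verts T) = m + 2" using tree_card[OF T] k by simp
  hence c3: "card (verts T) \<ge> 3" using k by simp
  have G: "is_tree G" unfolding G_def by (rule tree_delete_leaves[OF T c3]) (simp add: L_def)
  have VG: "verts G = verts T - L" by (simp add: G_def del_verts_def)
  have EG: "edges G = {e \<in> edges T. e \<inter> L = {}}" by (simp add: G_def del_verts_def)
  have LV: "L \<subseteq> verts T" by (auto simp: L_def leaf_set_def)
  have finL: "finite L" using LV tree_finite(1)[OF T] by (rule finite_subset)
  have "card (verts G) = m + 2 - card L" unfolding VG using finL LV cV by (simp add: card_Diff_subset)
  hence cG: "card (edges G) + card L = m + 1"
    using tree_card[OF G] card_mono[OF tree_finite(1)[OF T] LV] cV by simp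
  define s where "s = (\<lambda>l. THE w. {l, w} \<in> edges T)"
  have s: "{l, s l} \<in> edges T" "\<And>w. {l, w} \<in> edges T \<Longrightarrow> w = s l" if "l \<in> L" for l
  proof -
    have ex: "\<exists>!w. {l, w} \<in> edges T" using that by (simp add: L_def leaf_set_def)
    show "{l, s l} \<in> edges T" unfolding s_def by (rule theI'[OF ex])
    thus "\<And>w. {l, w} \<in> edges T \<Longrightarrow> w = s l" using ex by blast
  qed
  have sG: "s l \<in> verts G" if "l \<in> L" for l
    using leaf_nbr_not_leaf[OF T c3, of l "s l"] s(1)[OF that] that simple_graphD(2)[OF simple]
    by (simp add: VG L_def)
  have edge_leaf: "e = {l, s l}" if e: "e \<in> edges T" "l \<in> e" "l \<in> L" for e l
  proof -
    have "card e = 2" by (rule tree_edgeD(1)[OF T e(1)])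
    then obtain w where w: "e = {l, w}" using e(2) by (auto simp: card_2_iff)
    thus ?thesis using s(2)[OF e(3), of w] e(1) by simp
  qed
  have cL: "card L > 0" using leaves k by (simp add: L_def)
  then obtain v where v: "v \<in> L" by (auto simp: card_gt_0_iff)
  define u where "u = s v"
  define S where "S = L - {v}"
  have cS: "card S + card (edges G) = m" using cG cL v finL by (simp add: S_def)
  \<comment> \<open>The leaf hypothesis is spent here:
    \<open>3 * (m + 1 - card L) \<le> 2 * (m + 1)\<close>, exactly what the greedy labelling asks
    for with \<open>q = 2 * m + 1\<close>.\<close>
  have "3 * card (edges G) \<le> (2 * m + 1) + 1" using cG leaves by (simp add: L_def)
  then obtain f0 where f0: "inj_on f0 (verts G)" "f0 ` verts G \<subseteq> {0..<int (2 * m + 1)}"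
    "rainbow (int (2 * m + 1)) (edges G) f0"
    using greedy_rainbow[OF G, of "2 * m + 1"] by auto
  have EG2: "card e = 2 \<and> e \<subseteq> verts G" if "e \<in> edges G" for e using tree_edgeD[OF G that] by simp
  have SG: "finite S" "S \<inter> verts G = {}" "\<And>l. l \<in> S \<Longrightarrow> s l \<in> verts G"
    using finL sG by (auto simp: S_def VG)
  define E where "E = edges G \<union> (\<lambda>l. {l, s l}) ` S"
  have "\<exists>f. (\<forall>w\<in>verts G. f w = f0 w) \<and> f ` (verts G \<union> S) \<subseteq> {0..<int (2 * m + 1)} \<and>
    inj_on f S \<and> rainbow (int (2 * m + 1)) E f \<and> (\<forall>l\<in>S. f l \<noteq> f (s l))"
    unfolding E_def
    by (rule rainbow_extend_leaves[where s = s and S = S, OF p tree_finite(2)[OF G] EG2 f0(2,3) SG cS])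
  then obtain f where f: "\<forall>w\<in>verts G. f w = f0 w" "f ` (verts G \<union> S) \<subseteq> {0..<int (2 * m + 1)}"
    "inj_on f S" "rainbow (int (2 * m + 1)) E f" "\<forall>l\<in>S. f l \<noteq> f (s l)"
    by (elim exE conjE)
  have qm: "int (2 * m + 1) = q" using q by simp
  have injG: "inj_on f (verts G)" using f0(1) f(1) by (simp add: inj_on_def)
  have uv: "{u, v} \<in> edges T" using s(1)[OF v] by (simp add: u_def insert_commute)
  have v_only: "e = {u, v}" if "e \<in> edges T" "v \<in> e" for e
    using edge_leaf[OF that v] by (simp add: u_def insert_commute)
  have ET: "E = edges T - {{u, v}}"
  proof
    show "E \<subseteq> edges T - {{u, v}}"
    proof
      fix e assume "e \<in> E"
      hence "e \<in> edges T \<and> v \<notin> e"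
      proof (cases "e \<in> edges G")
        case False
        then obtain l where l: "l \<in> S" "e = {l, s l}" using \<open>e \<in> E\<close> by (auto simp: E_def)
        have "v \<noteq> l" "v \<noteq> s l" using l(1) v SG(3)[OF l(1)] by (auto simp: S_def VG)
        thus ?thesis using l s(1)[of l] by (simp add: S_def)
      qed (use v in \<open>auto simp: EG\<close>)
      thus "e \<in> edges T - {{u, v}}" by auto
    qed
    show "edges T - {{u, v}} \<subseteq> E"
    proof
      fix e assume e: "e \<in> edges T - {{u, v}}"
      show "e \<in> E"
      proof (cases "e \<inter> L = {}")
        case False
        then obtain l where l: "l \<in> e" "l \<in> L" by blast
        have el: "e = {l, s l}" using edge_leaf[OF _ l] e by blast
        have "l \<noteq> v" using e v_only[of e] l(1) by blast
        hence "l \<in> S" using l(2) by (simp add: S_def)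
        thus ?thesis using el by (auto simp: E_def)
      qed (use e in \<open>simp add: E_def EG\<close>)
    qed
  qed
  have VT: "verts T - {v} = verts G \<union> S" using LV v by (auto simp: VG S_def)
  have range: "f ` (verts T - {v}) \<subseteq> {0..<q}" using f(2) unfolding VT qm .
  have E2: "card e = 2" if "e \<in> E" for e using that tree_edgeD(1)[OF T] by (simp add: ET)
  have finE: "finite E" using tree_finite(2)[OF T] by (simp add: ET)
  have cE: "card E = m" using k uv tree_finite(2)[OF T] by (simp add: ET)
  have "\<exists>\<delta>. (\<forall>y. \<delta> y < (4 :: nat)) \<and> (\<forall>a b. {a, b} \<in> E \<longrightarrow> \<delta> (f a) \<noteq> \<delta> (f b))"
    unfolding E_def
    by (rule leaf_extension_four_colouring[where s = s and S = S, OF G SG injG f(3) bspec[OF f(5)]])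
  then obtain \<delta> where \<delta>: "\<forall>y. \<delta> y < (4 :: nat)" "\<forall>a b. {a, b} \<in> E \<longrightarrow> \<delta> (f a) \<noteq> \<delta> (f b)"
    by (elim exE conjE)
  have ends: "f a \<in> {0..<q} \<and> f b \<in> {0..<q} \<and> f a \<noteq> f b" if "{a, b} \<in> E" for a b
  proof -
    have e: "{a, b} \<in> edges T" "{a, b} \<noteq> {u, v}" using that by (auto simp: ET)
    have "a \<noteq> v" "b \<noteq> v" using e v_only[OF e(1)] by auto
    hence "a \<in> verts T - {v}" "b \<in> verts T - {v}" using simple_graphD[OF simple e(1)] by auto
    moreover have "f a \<noteq> f b" using \<delta>(2) that by metis
    ultimately show ?thesis using range by blast
  qed
  have cover: "\<exists>a b. {a, b} \<in> E \<and> (f b - f a) mod q = d" if "d \<in> {1..<q}" for d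
    using rainbow_covers[OF q f(4)[unfolded qm] finE cE E2 ends that] .
  define \<gamma> where "\<gamma> = (\<lambda>a. if a \<in> L then 1 else 0 :: int)"
  have "\<gamma> u = 0" using sG[OF v] by (simp add: \<gamma>_def u_def VG)
  moreover have "\<forall>a. \<gamma> a \<in> {0, 1}" by (simp add: \<gamma>_def)
  moreover have "\<forall>a\<in>verts T - {v}. \<forall>b\<in>verts T - {v}. f a = f b \<longrightarrow> \<gamma> a = \<gamma> b \<longrightarrow> a = b"
  proof (intro ballI impI)
    fix a b assume ab: "a \<in> verts T - {v}" "b \<in> verts T - {v}" "f a = f b" "\<gamma> a = \<gamma> b"
    have "a \<in> verts G \<and> b \<in> verts G \<or> a \<in> S \<and> b \<in> S"
      using ab(1,2,4) by (auto simp: VT \<gamma>_def VG S_def split: if_splits)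
    thus "a = b" using injG f(3) ab(3) by (auto dest: inj_onD)
  qed
  moreover have "\<forall>e\<in>edges T. v \<in> e \<longrightarrow> e = {u, v}" using v_only by blast
  moreover have "\<forall>d\<in>{1..<q}. \<exists>a b. {a, b} \<in> edges T - {{u, v}} \<and> (f b - f a) mod q = d"
    using cover by (simp only: ET) blast
  moreover note uv range \<delta>(1) \<delta>(2)[unfolded ET]
  ultimately show ?thesis
    by (intro exI[of _ u] exI[of _ v] exI[of _ f] exI[of _ \<gamma>] exI[of _ \<delta>] conjI)
qed

section \<open>Decomposition into nine rotated families\<close>

text \<open>Disjointness of the copies comes from counting: they cover all edges of
  \<open>G\<close>, and together they have no more edges than \<open>G\<close>, so no edge is
  covered twice.\<close>

lemma decomposes_by_copies:
  assumes I: "finite I" and H: "simple_graph H" and G: "simple_graph G"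
    and inj: "\<And>i. i \<in> I \<Longrightarrow> inj_on (\<phi> i) (verts H)"
    and verts: "\<And>i. i \<in> I \<Longrightarrow> \<phi> i ` verts H \<subseteq> verts G"
    and into: "\<And>i e. i \<in> I \<Longrightarrow> e \<in> edges H \<Longrightarrow> \<phi> i ` e \<in> edges G"
    and onto: "\<And>e. e \<in> edges G \<Longrightarrow> \<exists>i\<in>I. \<exists>e'\<in>edges H. e = \<phi> i ` e'"
    and card: "card I * card (edges H) \<le> card (edges G)" and ne: "edges H \<noteq> {}"
  shows "decomposes H G"
proof -
  have finH: "finite (edges H)"
    by (rule finite_subset[of _ "Pow (verts H)"]) (use H in \<open>auto simp: simple_graph_def\<close>)
  define \<Phi> where "\<Phi> = (\<lambda>(i, e). \<phi> i ` e)"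
  have img: "\<Phi> ` (I \<times> edges H) = edges G"
    using into onto by (auto simp: \<Phi>_def) blast
  have "card (\<Phi> ` (I \<times> edges H)) = card (I \<times> edges H)"
    using card card_image_le[of "I \<times> edges H" \<Phi>] I finH
    by (simp add: img card_cartesian_product)
  hence injP: "inj_on \<Phi> (I \<times> edges H)" using I finH by (simp add: eq_card_imp_inj_on)
  define F where "F = (\<lambda>i. (\<lambda>e. \<phi> i ` e) ` edges H)"
  have "partition_on (edges G) (F ` I)"
    unfolding partition_on_def
  proof (intro conjI)
    show "\<Union> (F ` I) = edges G" unfolding img[symmetric] by (auto simp: F_def \<Phi>_def)
    show "{} \<notin> F ` I" using ne by (auto simp: F_def)
    show "disjoint (F ` I)"
    proof (rule disjointI)
      fix A B assume "A \<in> F ` I" "B \<in> F ` I" and AB: "A \<noteq> B"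
      then obtain i j where ij: "i \<in> I" "j \<in> I" "A = F i" "B = F j" by blast
      show "A \<inter> B = {}"
      proof (rule ccontr)
        assume "A \<inter> B \<noteq> {}"
        then obtain e e' where e: "e \<in> edges H" "e' \<in> edges H" "\<phi> i ` e = \<phi> j ` e'"
          unfolding ij F_def by blast
        hence "\<Phi> (i, e) = \<Phi> (j, e')" by (simp add: \<Phi>_def)
        hence "(i, e) = (j, e')" using injP e(1,2) ij(1,2) by (auto dest: inj_onD)
        thus False using AB ij by simp
      qed
    qed
  qed
  moreover have "\<exists>H'. subgraph H' G \<and> edges H' = A \<and> isomorphic H H'" if A: "A \<in> F ` I" for A
  proof -
    obtain i where i: "i \<in> I" "A = F i" using A by blast
    define H' where "H' = \<lparr>verts = \<phi> i ` verts H, edges = F i\<rparr>"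
    have "card (\<phi> i ` e) = 2 \<and> \<phi> i ` e \<subseteq> \<phi> i ` verts H" if "e \<in> edges H" for e
    proof -
      have "e \<subseteq> verts H" "card e = 2" using H that by (auto simp: simple_graph_def)
      thus ?thesis using card_image[OF inj_on_subset[OF inj[OF i(1)]], of e] by auto
    qed
    hence "simple_graph H'" using H by (auto simp: simple_graph_def H'_def F_def)
    moreover have "verts H' \<subseteq> verts G" using verts[OF i(1)] by (simp add: H'_def)
    moreover have "edges H' \<subseteq> edges G" using into[OF i(1)] by (auto simp: H'_def F_def)
    moreover have "isomorphic H H'"
      unfolding isomorphic_def H'_def F_def
      by (rule exI[of _ "\<phi> i"]) (simp add: bij_betw_def inj[OF i(1)])
    ultimately show ?thesis using i(2) by (intro exI[of _ H']) (simp add: subgraph_def H'_def)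
  qed
  ultimately show ?thesis unfolding decomposes_def by blast
qed

lemma decomposes_isomorphic_host:
  assumes dec: "decomposes H G" and h: "bij_betw h (verts G) (verts G')"
    and E: "edges G' = (\<lambda>e. h ` e) ` edges G" and G: "simple_graph G"
  shows "decomposes H G'"
proof -
  obtain P where P: "partition_on (edges G) P"
    "\<forall>F\<in>P. \<exists>H'. subgraph H' G \<and> edges H' = F \<and> isomorphic H H'"
    using dec by (auto simp: decomposes_def)
  have injh: "inj_on h (verts G)" using h by (simp add: bij_betw_def)
  have injE: "inj_on (\<lambda>e. h ` e) (edges G)"
    by (rule inj_on_subset[OF inj_on_image_Pow[OF injh]]) (use G in \<open>auto simp: simple_graph_def\<close>)
  have "partition_on (edges G') ((\<lambda>F. (\<lambda>e. h ` e) ` F) ` P)"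
  proof -
    have "{} \<notin> (\<lambda>F. (\<lambda>e. h ` e) ` F) ` P" using partition_onD3[OF P(1)] by auto
    thus ?thesis unfolding E using partition_on_inj_image[OF P(1) injE] by simp
  qed
  moreover have "\<exists>H''. subgraph H'' G' \<and> edges H'' = A \<and> isomorphic H H''"
    if A: "A \<in> (\<lambda>F. (\<lambda>e. h ` e) ` F) ` P" for A
  proof -
    obtain F where F: "F \<in> P" "A = (\<lambda>e. h ` e) ` F" using A by blast
    then obtain H' where H': "subgraph H' G" "edges H' = F" "isomorphic H H'" using P(2) by blast
    define H'' where "H'' = \<lparr>verts = h ` verts H', edges = (\<lambda>e. h ` e) ` F\<rparr>"
    have inj': "inj_on h (verts H')" using injh H'(1) by (auto simp: subgraph_def intro: inj_on_subset)
    have sH': "simple_graph H'" using H'(1) by (simp add: subgraph_def)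
    have "card (h ` e) = 2 \<and> h ` e \<subseteq> h ` verts H'" if "e \<in> F" for e
    proof -
      have "e \<subseteq> verts H'" "card e = 2" using sH' that H'(2) by (auto simp: simple_graph_def)
      thus ?thesis using card_image[OF inj_on_subset[OF inj'], of e] by auto
    qed
    hence "simple_graph H''" using sH' by (auto simp: simple_graph_def H''_def)
    moreover have "verts H'' \<subseteq> verts G'"
      using H'(1) h by (auto simp: subgraph_def H''_def bij_betw_def)
    moreover have "edges H'' \<subseteq> edges G'"
      using H'(1,2) unfolding E by (auto simp: subgraph_def H''_def)
    moreover have iso: "isomorphic H' H''"
      unfolding isomorphic_def H''_def
      by (rule exI[of _ h]) (simp add: bij_betw_def inj' H'(2))
    moreover have "edges H'' = A" by (simp add: F(2) H''_def)
    ultimately show ?thesis unfolding subgraph_def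
      by (intro exI[of _ H''] conjI isomorphic_trans[OF H'(3) iso])
  qed
  ultimately show ?thesis unfolding decomposes_def
    by (intro exI[of _ "(\<lambda>F. (\<lambda>e. h ` e) ` F) ` P"] conjI ballI)
qed

text \<open>Four pairwise independent linear forms on the plane over \<open>F\<^sub>3\<close>, evaluated in the integers.\<close>

definition direction :: "nat \<Rightarrow> int \<Rightarrow> int \<Rightarrow> int" where
  "direction k s t = (if k = 0 then s else if k = 1 then t else if k = 2 then s + t else s + 2 * t)"

lemma directions_independent_base:
  "\<forall>k\<in>{0, 1, 2, 3}. \<forall>l\<in>{0, 1, 2, 3}. \<forall>i\<in>{0, 1, 2}. \<forall>j\<in>{0, 1, 2}. k \<noteq> l \<longrightarrow>
    (\<exists>s\<in>{0, 1, 2}. \<exists>t\<in>{0, 1, 2}. direction k s t mod 3 = i \<and> direction l s t mod 3 = j)"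
  by code_simp

text \<open>The constants \<open>a\<close> and \<open>b\<close> are subtracted from the prescribed
  values, which leaves two independent linear forms over \<open>F_3\<close>; these take every pair
  of values.\<close>

lemma directions_independent:
  assumes "k < 4" "l < 4" "k \<noteq> l" "i \<in> {0..<3}" "j \<in> {0..<3}"
  shows "\<exists>s\<in>{0..<3}. \<exists>t\<in>{0..<3}.
    (direction k s t + a) mod 3 = i \<and> (direction l s t + b) mod 3 = j"
proof -
  have three: "x \<in> {0, 1, 2}" if "0 \<le> x" "x < 3" for x :: int using that by auto
  have "(i - a) mod 3 \<in> {0, 1, 2}" "(j - b) mod 3 \<in> {0, 1, 2}" by (rule three; simp)+
  moreover have "k \<in> {0, 1, 2, 3}" "l \<in> {0, 1, 2, 3}" using assms(1,2) by auto
  ultimately obtain s t where st: "s \<in> {0, 1, 2}" "t \<in> {0, 1, 2}"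
    "direction k s t mod 3 = (i - a) mod 3" "direction l s t mod 3 = (j - b) mod 3"
    using directions_independent_base assms(3) by meson
  have "(direction k s t + a) mod 3 = (i - a + a) mod 3" by (rule mod_add_cong[OF st(3)]) simp
  moreover have "(direction l s t + b) mod 3 = (j - b + b) mod 3" by (rule mod_add_cong[OF st(4)]) simp
  moreover have "s \<in> {0..<3}" "t \<in> {0..<3}" using st(1,2) by auto
  ultimately show ?thesis using assms(4,5) by (intro bexI[of _ s] bexI[of _ t]) auto
qed

text \<open>The vertex \<open>(x, i)\<close> with \<open>i < 3\<close> stands for the residue \<open>x\<close> in layer \<open>i\<close>; layer 3 holds
  the ends of the missing edge. In the copy \<open>\<phi> (x, s, t)\<close> the leaf \<open>v\<close> may go two layers above its
  neighbour \<open>u\<close> because only the layer directly above can be occupied, by a leaf.\<close>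

lemma tree_decomposes_layered_graph:
  fixes T :: "'a ugraph" and q :: int
  defines "W \<equiv> {0..<q} \<times> {0..<3 :: int} \<union> {(0, 3), (1, 3)}"
  assumes T: "is_tree T" and k: "card (edges T) = m + 1" "m > 0" and p: "prime (2 * m + 1)"
    and leaves: "m + 1 \<le> 3 * card (leaf_set T)" and q: "q = 2 * int m + 1"
  shows "decomposes T \<lparr>verts = W, edges = {e. e \<subseteq> W \<and> card e = 2} - {{(0, 3), (1, 3)}}\<rparr>"
proof -
  have simple: "simple_graph T" using T by (simp add: is_tree_def)
  have qpos: "q > 0" using q by simp
  from tree_labelling[OF T k p leaves q]
  obtain u v and f \<gamma> :: "'a \<Rightarrow> int" and \<delta> :: "int \<Rightarrow> nat" where
    uv: "{u, v} \<in> edges T" and v_only: "\<forall>e\<in>edges T. v \<in> e \<longrightarrow> e = {u, v}" and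
    range: "f ` (verts T - {v}) \<subseteq> {0..<q}" and
    cover: "\<forall>d\<in>{1..<q}. \<exists>a b. {a, b} \<in> edges T - {{u, v}} \<and> (f b - f a) mod q = d" and
    \<delta>4: "\<forall>y. \<delta> y < 4" and
    \<delta>: "\<forall>a b. {a, b} \<in> edges T - {{u, v}} \<longrightarrow> \<delta> (f a) \<noteq> \<delta> (f b)" and
    \<gamma>u: "\<gamma> u = 0" and \<gamma>01: "\<forall>a. \<gamma> a \<in> {0, 1}" and
    sep: "\<forall>a\<in>verts T - {v}. \<forall>b\<in>verts T - {v}. f a = f b \<longrightarrow> \<gamma> a = \<gamma> b \<longrightarrow> a = b"
    by (elim exE conjE)
  define G where "G = \<lparr>verts = W, edges = {e. e \<subseteq> W \<and> card e = 2} - {{(0, 3), (1, 3)}}\<rparr>"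
  \<comment> \<open>A direction different from that of \<open>u\<close>, so that
    \<open>layer s t u\<close> and \<open>\<kappa> s t\<close> can be prescribed independently. It
    belongs to the edge \<open>{u, v}\<close> and not to a label, since \<open>v\<close> has
    none.\<close>
  define \<delta>' where "\<delta>' = (\<delta> (f u) + 1) mod 4"
  have \<delta>': "\<delta>' < 4" "\<delta>' \<noteq> \<delta> (f u)" using \<delta>4[rule_format, of "f u"] unfolding \<delta>'_def by presburger+
  define layer where "layer = (\<lambda>s t a. (direction (\<delta> (f a)) s t + \<gamma> a) mod 3)"
  define \<kappa> where "\<kappa> = (\<lambda>s t. (direction \<delta>' s t + 0) mod 3)"
  \<comment> \<open>For \<open>\<kappa> s t = 0\<close> the edge \<open>{u, v}\<close> lands in the
    triangle over a single residue; the values 1 and 2 send \<open>v\<close> to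
    \<open>(0, 3)\<close> and \<open>(1, 3)\<close>.\<close>
  define \<phi> where "\<phi> = (\<lambda>(x, s, t) a. if a \<noteq> v then ((f a + x) mod q, layer s t a)
     else if \<kappa> s t = 0 then ((f u + x) mod q, (layer s t u + 2) mod 3) else (\<kappa> s t - 1, 3))"
  define I where "I = {0..<q} \<times> {0..<3 :: int} \<times> {0..<3 :: int}"
  have uvV: "u \<in> verts T" "v \<in> verts T" "u \<noteq> v" using simple_graphD[OF simple uv] by auto
  have layer3: "0 \<le> layer s t a" "layer s t a < 3" for s t a by (simp_all add: layer_def)
  have \<kappa>3: "0 \<le> \<kappa> s t" "\<kappa> s t < 3" for s t by (simp_all add: \<kappa>_def)
  have \<phi>_ne: "\<phi> (x, s, t) a = ((f a + x) mod q, layer s t a)" if "a \<noteq> v" for x s t a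
    using that by (simp add: \<phi>_def)
  have \<phi>_v: "\<phi> (x, s, t) v = (if \<kappa> s t = 0 then ((f u + x) mod q, (layer s t u + 2) mod 3)
      else (\<kappa> s t - 1, 3))" for x s t
    by (simp add: \<phi>_def)
  have shift: "f a = f b" if "a \<in> verts T - {v}" "b \<in> verts T - {v}" "(f a + x) mod q = (f b + x) mod q"
    for a b x
  proof -
    have "(f a + x - x) mod q = (f b + x - x) mod q" by (rule mod_diff_cong[OF that(3)]) simp
    moreover have "f a \<in> {0..<q}" "f b \<in> {0..<q}" using range that(1,2) by auto
    ultimately show ?thesis by simp
  qed
  have ne_v: "\<phi> (x, s, t) a \<noteq> \<phi> (x, s, t) v" if a: "a \<in> verts T" "a \<noteq> v" for x s t a
  proof
    assume eq: "\<phi> (x, s, t) a = \<phi> (x, s, t) v"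
    hence \<kappa>0: "\<kappa> s t = 0" using layer3(2)[of s t a] a(2) by (auto simp: \<phi>_ne \<phi>_v split: if_splits)
    hence "(f a + x) mod q = (f u + x) mod q" and l: "layer s t a = (layer s t u + 2) mod 3"
      using eq a(2) by (auto simp: \<phi>_ne \<phi>_v)
    hence "f a = f u" using shift[of a u x] a uvV by simp
    hence "(direction (\<delta> (f u)) s t + \<gamma> a) mod 3 = (direction (\<delta> (f u)) s t mod 3 + 2) mod 3"
      using l by (simp add: layer_def \<gamma>u)
    moreover have "\<gamma> a = 0 \<or> \<gamma> a = 1" using \<gamma>01 by auto
    ultimately show False by presburger
  qed
  have inj: "inj_on (\<phi> (x, s, t)) (verts T)" for x s t
  proof (rule inj_onI)
    fix a b assume ab: "a \<in> verts T" "b \<in> verts T" and eq: "\<phi> (x, s, t) a = \<phi> (x, s, t) b"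
    consider "a = v" "b = v" | "a = v" "b \<noteq> v" | "a \<noteq> v" "b = v" | "a \<noteq> v" "b \<noteq> v" by blast
    thus "a = b"
    proof cases
      case 2
      thus ?thesis using ne_v[of b x s t] ab eq by simp
    next
      case 3
      thus ?thesis using ne_v[of a x s t] ab eq by simp
    next
      case 4
      have "(f a + x) mod q = (f b + x) mod q" and l: "layer s t a = layer s t b"
        using eq 4 by (auto simp: \<phi>_ne)
      hence fab: "f a = f b" using shift[of a b x] ab 4 by simp
      hence "(direction (\<delta> (f b)) s t + \<gamma> a) mod 3 = (direction (\<delta> (f b)) s t + \<gamma> b) mod 3"
        using l by (simp add: layer_def)
      moreover have "\<gamma> a = 0 \<or> \<gamma> a = 1" "\<gamma> b = 0 \<or> \<gamma> b = 1" using \<gamma>01 by auto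
      ultimately have "\<gamma> a = \<gamma> b" by presburger
      thus ?thesis using sep ab 4 fab by blast
    qed simp
  qed
  have base: "\<phi> (x, s, t) a \<in> {0..<q} \<times> {0..<3}" if "a \<noteq> v" for x s t a
    using that layer3 qpos by (simp add: \<phi>_ne)
  have verts: "\<phi> i ` verts T \<subseteq> W" for i
  proof -
    obtain x s t where i: "i = (x, s, t)" by (metis prod_cases3)
    have "\<phi> (x, s, t) v \<in> W"
    proof (cases "\<kappa> s t = 0")
      case True
      thus ?thesis using qpos by (simp add: \<phi>_v W_def)
    next
      case False
      hence "\<kappa> s t = 1 \<or> \<kappa> s t = 2" using \<kappa>3[of s t] by linarith
      thus ?thesis by (auto simp: \<phi>_v W_def)
    qed
    moreover have "\<phi> (x, s, t) a \<in> W" if "a \<noteq> v" for a using base[OF that] by (simp add: W_def)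
    ultimately have "\<phi> (x, s, t) a \<in> W" for a by (cases "a = v") simp_all
    thus ?thesis unfolding i by (intro image_subsetI)
  qed
  have finW: "finite W" by (simp add: W_def)
  have cW: "card W = 6 * m + 5"
  proof -
    have "card W = card ({0..<q} \<times> {0..<3::int}) + card {(0::int, 3::int), (1, 3)}"
      unfolding W_def by (rule card_Un_disjoint) auto
    thus ?thesis using q by (simp add: card_cartesian_product)
  qed
  have infW: "{(0, 3), (1, 3)} \<subseteq> W" by (simp add: W_def)
  \<comment> \<open>The number equals that of the copies, \<open>9 * (2 * m + 1)\<close>, times the
    \<open>m + 1\<close> edges of \<open>T\<close>, so it is enough that the copies cover
    everything.\<close>
  have cE: "card (edges G) = 9 * (2 * m + 1) * (m + 1)"
  proof -
    have "card {e. e \<subseteq> W \<and> card e = 2} = (6 * m + 5) choose 2"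
      using n_subsets[OF finW, of 2] by (simp add: cW)
    also have "\<dots> = (6 * m + 5) * (3 * m + 2)"
      by (simp add: choose_two algebra_simps)
    finally have "card {e. e \<subseteq> W \<and> card e = 2} = (6 * m + 5) * (3 * m + 2)" .
    moreover have "{(0, 3), (1, 3)} \<in> {e. e \<subseteq> W \<and> card e = 2}" using infW by simp
    ultimately have "card (edges G) = (6 * m + 5) * (3 * m + 2) - 1"
      using finW by (simp add: G_def card_Diff_singleton)
    thus ?thesis by (simp add: algebra_simps)
  qed
  have "decomposes T G"
  proof (rule decomposes_by_copies[where I = I and \<phi> = \<phi>])
    show "finite I" by (simp add: I_def)
    show "simple_graph T" by (rule simple)
    show "simple_graph G" using finW by (auto simp: simple_graph_def G_def)
    show "inj_on (\<phi> i) (verts T)" for i by (cases i) (simp add: inj)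
    show "\<phi> i ` verts T \<subseteq> verts G" for i using verts by (simp add: G_def)
    show "edges T \<noteq> {}" using uv by blast
    have "card I = nat q * 9" by (simp add: I_def card_cartesian_product)
    hence "card I = 9 * (2 * m + 1)" using q by simp
    thus "card I * card (edges T) \<le> card (edges G)" using cE k(1) by simp
    show "\<phi> i ` e \<in> edges G" if e: "e \<in> edges T" for i e
    proof -
      have eV: "e \<subseteq> verts T" "card e = 2" using simple e by (auto simp: simple_graph_def)
      obtain x s t where i: "i = (x, s, t)" by (metis prod_cases3)
      have "card (\<phi> i ` e) = 2"
        using card_image[OF inj_on_subset[OF inj eV(1)], of x s t] eV(2) by (simp add: i)
      moreover have "\<phi> i ` e \<subseteq> W" using verts[of i] eV(1) by blast
      moreover have "\<phi> i ` e \<noteq> {(0, 3), (1, 3)}"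
      proof
        assume eq: "\<phi> i ` e = {(0, 3), (1, 3)}"
        obtain a b where ab: "e = {a, b}" "a \<noteq> b" using eV(2) by (auto simp: card_2_iff)
        hence "a \<noteq> v \<or> b \<noteq> v" by blast
        then obtain c where c: "c \<in> e" "c \<noteq> v" using ab by blast
        hence "\<phi> i c \<in> {(0, 3), (1, 3)}" using eq by blast
        thus False using base[OF c(2), of x s t] i by auto
      qed
      ultimately show ?thesis by (simp add: G_def)
    qed
    have indep: "\<exists>s\<in>{0..<3}. \<exists>t\<in>{0..<3}. layer s t a = i \<and> layer s t b = j"
      if "{a, b} \<in> edges T - {{u, v}}" "i \<in> {0..<3}" "j \<in> {0..<3}" for a b i j
      unfolding layer_def using directions_independent[of "\<delta> (f a)" "\<delta> (f b)" i j] \<delta>4 \<delta> that by blast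
    have indep': "\<exists>s\<in>{0..<3}. \<exists>t\<in>{0..<3}. layer s t u = i \<and> \<kappa> s t = j"
      if "i \<in> {0..<3}" "j \<in> {0..<3}" for i j
      unfolding layer_def \<kappa>_def using directions_independent[of "\<delta> (f u)" \<delta>' i j] \<delta>4 \<delta>' that by blast
    have place: "(f a + (x - f a) mod q) mod q = x" if "x \<in> {0..<q}" for a x
      using that by (simp add: mod_add_right_eq)
    \<comment> \<open>The difference \<open>y - x\<close> selects a tree edge with its orientation,
      the layers \<open>i1\<close> and \<open>j1\<close> select \<open>(s, t)\<close>, and the
      position of \<open>x\<close> selects the translation.\<close>
    have cross: "\<exists>i\<in>I. \<exists>e\<in>edges T. {(x, i1), (y, j1)} = \<phi> i ` e"
      if xy: "x \<in> {0..<q}" "y \<in> {0..<q}" "x \<noteq> y" "i1 \<in> {0..<3}" "j1 \<in> {0..<3}" for x y i1 j1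
    proof -
      have "(y - x) mod q \<noteq> 0"
      proof
        assume "(y - x) mod q = 0"
        hence "y mod q = x mod q" by (simp add: mod_eq_dvd_iff mod_eq_0_iff_dvd)
        thus False using xy by simp
      qed
      moreover have "0 \<le> (y - x) mod q" "(y - x) mod q < q" using qpos by simp_all
      ultimately have "(y - x) mod q \<in> {1..<q}" by simp
      then obtain a b where ab: "{a, b} \<in> edges T - {{u, v}}" "(f b - f a) mod q = (y - x) mod q"
        using cover by blast
      obtain s t where st: "s \<in> {0..<3}" "t \<in> {0..<3}" "layer s t a = i1" "layer s t b = j1"
        using indep[OF ab(1) xy(4,5)] by blast
      have abv: "a \<noteq> v" "b \<noteq> v" using ab(1) v_only by auto
      define z where "z = (x - f a) mod q"
      have "(f b + z) mod q = (f b - f a + x) mod q"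
        by (simp add: z_def mod_add_right_eq algebra_simps)
      also have "\<dots> = (y - x + x) mod q" by (rule mod_add_cong[OF ab(2)]) simp
      also have "\<dots> = y" using xy by simp
      finally have "\<phi> (z, s, t) b = (y, j1)" using abv st by (simp add: \<phi>_ne)
      moreover have "\<phi> (z, s, t) a = (x, i1)" using abv st place[OF xy(1)] by (simp add: \<phi>_ne z_def)
      moreover have "(z, s, t) \<in> I" using st qpos by (simp add: I_def z_def)
      ultimately show ?thesis using ab(1)
        by (intro bexI[of _ "(z, s, t)"] bexI[of _ "{a, b}"]) auto
    qed
    \<comment> \<open>Here \<open>j\<close> is the value prescribed for \<open>\<kappa>\<close>: it
      decides which of the three possible places the leaf \<open>v\<close> takes above a given image
      of \<open>u\<close>.\<close>
    have extra: "\<exists>i\<in>I. \<exists>e\<in>edges T. {(x, i1), R} = \<phi> i ` e"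
      if xi: "x \<in> {0..<q}" "i1 \<in> {0..<3}"
        and R: "R = (x, (i1 + 2) mod 3) \<and> j = 0 \<or> R = (j - 1, 3) \<and> (j = 1 \<or> j = 2)" for x i1 R j
    proof -
      have "j \<in> {0..<3}" using R by auto
      then obtain s t where st: "s \<in> {0..<3}" "t \<in> {0..<3}" "layer s t u = i1" "\<kappa> s t = j"
        using indep'[OF xi(2)] by blast
      define z where "z = (x - f u) mod q"
      have z: "(f u + z) mod q = x" unfolding z_def by (rule place[OF xi(1)])
      have "\<phi> (z, s, t) u = (x, i1)" using uvV(3) st z by (simp add: \<phi>_ne)
      moreover have "\<phi> (z, s, t) v = R" using R st z by (auto simp: \<phi>_v)
      moreover have "(z, s, t) \<in> I" using st qpos by (simp add: I_def z_def)
      ultimately show ?thesis using uv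
        by (intro bexI[of _ "(z, s, t)"] bexI[of _ "{u, v}"]) auto
    qed
    have pair: "\<exists>i\<in>I. \<exists>e\<in>edges T. {(x, i1), (y, j1)} = \<phi> i ` e"
      if xy: "x \<in> {0..<q}" "y \<in> {0..<q}" "i1 \<in> {0..<3}" "j1 \<in> {0..<3}" "(x, i1) \<noteq> (y, j1)" for x y i1 j1
    proof (cases "x = y")
      case True
      hence "i1 \<noteq> j1" using xy(5) by simp
      moreover have "i1 = 0 \<or> i1 = 1 \<or> i1 = 2" "j1 = 0 \<or> j1 = 1 \<or> j1 = 2"
        using xy(3,4) by (simp_all add: atLeastLessThan_iff) linarith+
      \<comment> \<open>Modulo 3, distinct layers differ by 2 or by -2, so every triangle edge is
        the image of \<open>{u, v}\<close> seen from one of its two ends.\<close>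
      ultimately have "j1 = (i1 + 2) mod 3 \<or> i1 = (j1 + 2) mod 3" by (elim disjE) simp_all
      thus ?thesis
      proof
        assume "j1 = (i1 + 2) mod 3"
        thus ?thesis using extra[OF xy(1,3), of "(y, j1)" 0] True by simp
      next
        assume "i1 = (j1 + 2) mod 3"
        thus ?thesis using extra[OF xy(2,4), of "(x, i1)" 0] True by (simp add: insert_commute)
      qed
    next
      case False
      show ?thesis by (rule cross[OF xy(1,2) False xy(3,4)])
    qed
    have inf: "\<exists>i\<in>I. \<exists>e\<in>edges T. {(x, i1), R} = \<phi> i ` e"
      if "x \<in> {0..<q}" "i1 \<in> {0..<3}" "R = (0, 3) \<or> R = (1, 3)" for x i1 R
      using extra[OF that(1,2), of R 1] extra[OF that(1,2), of R 2] that(3) by auto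
    show "\<exists>i\<in>I. \<exists>e'\<in>edges T. e = \<phi> i ` e'" if e: "e \<in> edges G" for e
    proof -
      have eG: "card e = 2" "e \<subseteq> W" "e \<noteq> {(0, 3), (1, 3)}" using e by (simp_all add: G_def)
      obtain P R where PR: "e = {P, R}" "P \<noteq> R"
        using eG(1) unfolding card_2_iff by (elim exE conjE)
      have PRW: "P \<in> W" "R \<in> W" using eG(2) by (simp_all add: PR(1))
      obtain x i1 where P: "P = (x, i1)" by (cases P)
      obtain y j1 where R: "R = (y, j1)" by (cases R)
      consider "P \<in> {0..<q} \<times> {0..<3}" "R \<in> {0..<q} \<times> {0..<3}"
        | "P \<in> {0..<q} \<times> {0..<3}" "R = (0, 3) \<or> R = (1, 3)"
        | "R \<in> {0..<q} \<times> {0..<3}" "P = (0, 3) \<or> P = (1, 3)"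
        | "P = (0, 3) \<or> P = (1, 3)" "R = (0, 3) \<or> R = (1, 3)"
        using PRW unfolding W_def by blast
      thus ?thesis
      proof cases
        case 1
        thus ?thesis using pair[of x y i1 j1] PR(1,2) P R by simp
      next
        case 2
        thus ?thesis using inf[of x i1 R] PR(1) P by simp
      next
        case 3
        thus ?thesis using inf[of y j1 P] PR(1) R by (simp add: insert_commute)
      next
        case 4
        hence "e = {(0, 3), (1, 3)}" using PR by (elim disjE) (simp_all add: insert_commute)
        thus ?thesis using eG(3) by contradiction
      qed
    qed
  qed
  thus ?thesis unfolding G_def .
qed

text \<open>What remains is to name the vertices: a bijection takes the two points of layer 3 to the
  ends of the given edge \<open>e\<close> and the other points arbitrarily to the remaining
  vertices.\<close>

theorem leafy_tree_decomposes:
  fixes T :: "'a ugraph"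
  assumes T: "is_tree T" and k: "card (edges T) = m + 1" "m > 0" and p: "prime (2 * m + 1)"
    and leaves: "m + 1 \<le> 3 * card (leaf_set T)"
    and e: "e \<in> edges (complete_graph (6 * m + 5))"
  shows "decomposes T (delete_edge (complete_graph (6 * m + 5)) e)"
proof -
  define q where "q = 2 * int m + 1"
  define W where "W = {0..<q} \<times> {0..<3 :: int} \<union> {(0, 3), (1, 3)}"
  define G where "G = \<lparr>verts = W, edges = {e. e \<subseteq> W \<and> card e = 2} - {{(0, 3), (1, 3)}}\<rparr>"
  have dec: "decomposes T G"
    unfolding G_def W_def by (rule tree_decomposes_layered_graph[OF T k p leaves q_def])
  obtain a b where ab: "e = {a, b}" "a \<noteq> b" "a < 6 * m + 5" "b < 6 * m + 5"
    using e by (auto simp: complete_graph_def card_2_iff)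
  have finW: "finite W" by (simp add: W_def)
  have "card ({0..<q} \<times> {0..<3 :: int}) = 6 * m + 3"
    by (simp add: q_def card_cartesian_product)
  moreover have "card ({..<6 * m + 5} - {a, b}) = 6 * m + 3" using ab by simp
  ultimately obtain h0 where h0: "bij_betw h0 ({0..<q} \<times> {0..<3 :: int}) ({..<6 * m + 5} - {a, b})"
    using finite_same_card_bij[of "{0..<q} \<times> {0..<3 :: int}" "{..<6 * m + 5} - {a, b}"] by auto
  define h where "h = (\<lambda>P. if P = (0, 3) then a else if P = (1, 3) then b else h0 P)"
  have "bij_betw h ({0..<q} \<times> {0..<3 :: int}) ({..<6 * m + 5} - {a, b})"
    using h0 by (rule bij_betw_cong[THEN iffD1, rotated]) (auto simp: h_def)
  moreover have "bij_betw h {(0, 3), (1, 3)} {a, b}"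
    using ab(2) by (auto simp: bij_betw_def h_def)
  ultimately have "bij_betw h W (({..<6 * m + 5} - {a, b}) \<union> {a, b})"
    unfolding W_def by (rule bij_betw_combine) auto
  moreover have "({..<6 * m + 5} - {a, b}) \<union> {a, b} = {..<6 * m + 5}" using ab by auto
  ultimately have h: "bij_betw h W {..<6 * m + 5}" by simp
  have injW: "inj_on h W" and imgW: "h ` W = {..<6 * m + 5}" using h by (auto simp: bij_betw_def)
  have pairs: "(\<lambda>e. h ` e) ` {e. e \<subseteq> W \<and> card e = 2} = {e. e \<subseteq> {..<6 * m + 5} \<and> card e = 2}"
  proof
    show "(\<lambda>e. h ` e) ` {e. e \<subseteq> W \<and> card e = 2} \<subseteq> {e. e \<subseteq> {..<6 * m + 5} \<and> card e = 2}"
      using imgW by (auto simp: card_image[OF inj_on_subset[OF injW]])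
    show "{e. e \<subseteq> {..<6 * m + 5} \<and> card e = 2} \<subseteq> (\<lambda>e. h ` e) ` {e. e \<subseteq> W \<and> card e = 2}"
    proof
      fix e assume e: "e \<in> {e. e \<subseteq> {..<6 * m + 5} \<and> card e = 2}"
      hence "e \<subseteq> h ` W" using imgW by simp
      then obtain e' where e': "e' \<subseteq> W" "e = h ` e'" by (elim subset_imageE)
      hence "card e' = 2" using card_image[OF inj_on_subset[OF injW e'(1)]] e by simp
      thus "e \<in> (\<lambda>e. h ` e) ` {e. e \<subseteq> W \<and> card e = 2}" using e' by blast
    qed
  qed
  have he: "h ` {(0, 3), (1, 3)} = e" using ab by (auto simp: h_def)
  have "inj_on (\<lambda>e. h ` e) {e. e \<subseteq> W \<and> card e = 2}"
    by (rule inj_on_subset[OF inj_on_image_Pow[OF injW]]) auto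
  hence "(\<lambda>e. h ` e) ` edges G = (\<lambda>e. h ` e) ` {e. e \<subseteq> W \<and> card e = 2} - (\<lambda>e. h ` e) ` {{(0, 3), (1, 3)}}"
    unfolding G_def ugraph.simps by (rule inj_on_image_set_diff) (auto simp: W_def)
  hence "edges (delete_edge (complete_graph (6 * m + 5)) e) = (\<lambda>e. h ` e) ` edges G"
    using he by (simp add: pairs delete_edge_def complete_graph_def)
  moreover have "bij_betw h (verts G) (verts (delete_edge (complete_graph (6 * m + 5)) e))"
    using h by (simp add: G_def delete_edge_def complete_graph_def)
  moreover have "simple_graph G" using finW by (auto simp: simple_graph_def G_def)
  ultimately show ?thesis using decomposes_isomorphic_host[OF dec] by blast
qed

section \<open>Rooted trees as nested multisets\<close>

datatype mtree = MNode "mtree multiset"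

primrec msize :: "mtree \<Rightarrow> nat" where
  "msize (MNode M) = Suc (\<Sum>\<^sub># (image_mset msize M))"

text \<open>The root counts only when it is the whole tree. In larger trees a root of degree one is
  left out, so this may be one less than the number of graph leaves.\<close>

primrec mleaves :: "mtree \<Rightarrow> nat" where
  "mleaves (MNode M) = (if M = {#} then 1 else \<Sum>\<^sub># (image_mset mleaves M))"

text \<open>Ordered trees mediate between graphs and nested multisets: vertices of a nested multiset
  have no names, while those of an ordered tree are addressed by the child indices on the way from
  the root.\<close>

datatype ptree = PNode (kids: "ptree list")

primrec mtree_of :: "ptree \<Rightarrow> mtree" where
  "mtree_of (PNode ts) = MNode (mset (map mtree_of ts))"

primrec addr :: "nat list \<Rightarrow> ptree \<Rightarrow> bool" where
  "addr [] t = True"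
| "addr (i # p) t = (i < length (kids t) \<and> addr p (kids t ! i))"

primrec subtree :: "nat list \<Rightarrow> ptree \<Rightarrow> ptree" where
  "subtree [] t = t"
| "subtree (i # p) t = subtree p (kids t ! i)"

text \<open>The new child is appended at the end of the list, so that all old addresses keep their
  meaning.\<close>

primrec add_leaf :: "nat list \<Rightarrow> ptree \<Rightarrow> ptree" where
  "add_leaf [] t = PNode (kids t @ [PNode []])"
| "add_leaf (i # p) t = PNode ((kids t)[i := add_leaf p (kids t ! i)])"

definition pgraph :: "ptree \<Rightarrow> nat list ugraph" where
  "pgraph t = \<lparr>verts = {p. addr p t}, edges = {{p, p @ [i]} | p i. addr (p @ [i]) t}\<rparr>"

section \<open>Address graphs of ordered trees\<close>

lemma mtree_of_surj: "\<exists>t. mtree_of t = x"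
proof (induction x)
  case (MNode M)
  obtain xs where xs: "mset xs = M" using ex_mset by blast
  have "\<forall>x\<in>set xs. \<exists>t. mtree_of t = x" using MNode xs by auto
  then obtain g where "\<forall>x\<in>set xs. mtree_of (g x) = x" by metis
  hence "map mtree_of (map g xs) = xs" by (simp add: map_idI)
  hence "mtree_of (PNode (map g xs)) = MNode M"
    unfolding mtree_of.simps by (simp only: xs)
  thus ?case by blast
qed

lemma addr_append: "addr (p @ q) t \<longleftrightarrow> addr p t \<and> addr q (subtree p t)"
  by (induction p arbitrary: t) auto

lemma addr_snoc: "addr (p @ [i]) t \<longleftrightarrow> addr p t \<and> i < length (kids (subtree p t))"
  by (simp add: addr_append)

lemma subtree_append: "subtree (p @ q) t = subtree q (subtree p t)"
  by (induction p arbitrary: t) auto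

lemma addr_PNode:
  "{p. addr p (PNode ts)} = insert [] (\<Union>i<length ts. Cons i ` {p. addr p (ts ! i)})"
proof (intro Set.set_eqI iffI)
  fix p assume "p \<in> {p. addr p (PNode ts)}"
  thus "p \<in> insert [] (\<Union>i<length ts. Cons i ` {p. addr p (ts ! i)})" by (cases p) auto
qed auto

lemma addr_single: "addr p (PNode []) \<longleftrightarrow> p = []"
  by (cases p) auto

lemma card_addr_PNode:
  assumes "\<And>i. i < length ts \<Longrightarrow> finite (A i)"
  shows "card (\<Union>i<length ts. Cons i ` A i) = (\<Sum>i<length ts. card (A i))"
proof -
  have "card (\<Union>i<length ts. Cons i ` A i) = (\<Sum>i<length ts. card (Cons i ` A i))"
    using assms by (intro card_UN_disjoint) auto
  thus ?thesis by (simp add: card_image)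
qed

lemma finite_addr: "finite {p. addr p t}"
proof (induction t)
  case (PNode ts)
  thus ?case unfolding addr_PNode by auto
qed

lemma card_addr: "card {p. addr p t} = msize (mtree_of t)"
proof (induction t)
  case (PNode ts)
  have "card {p. addr p (PNode ts)} = Suc (\<Sum>i<length ts. card {p. addr p (ts ! i)})"
    unfolding addr_PNode
    by (subst card_insert_disjoint) (auto simp: finite_addr card_addr_PNode)
  also have "(\<Sum>i<length ts. card {p. addr p (ts ! i)}) = (\<Sum>i<length ts. msize (mtree_of (ts ! i)))"
    using PNode by (intro sum.cong) auto
  also have "\<dots> = sum_list (map (msize \<circ> mtree_of) ts)"
    by (simp add: sum_list_sum_nth atLeast0LessThan)
  also have "Suc \<dots> = msize (mtree_of (PNode ts))"
    by (simp add: mset_map[symmetric] sum_mset_sum_list del: mset_map)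
  finally show ?case .
qed

lemma card_terminal_addr: "card {p. addr p t \<and> kids (subtree p t) = []} = mleaves (mtree_of t)"
proof (induction t)
  case (PNode ts)
  show ?case
  proof (cases "ts = []")
    case True
    hence "{p. addr p (PNode ts) \<and> kids (subtree p (PNode ts)) = []} = {[]}"
      by (auto simp: addr_single)
    thus ?thesis using True by simp
  next
    case False
    have "{p. addr p (PNode ts) \<and> kids (subtree p (PNode ts)) = []} =
        (\<Union>i<length ts. Cons i ` {p. addr p (ts ! i) \<and> kids (subtree p (ts ! i)) = []})"
    proof (intro Set.set_eqI iffI)
      fix p assume "p \<in> {p. addr p (PNode ts) \<and> kids (subtree p (PNode ts)) = []}"
      thus "p \<in> (\<Union>i<length ts. Cons i ` {p. addr p (ts ! i) \<and> kids (subtree p (ts ! i)) = []})"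
        using False by (cases p) auto
    qed auto
    hence "card {p. addr p (PNode ts) \<and> kids (subtree p (PNode ts)) = []} =
        (\<Sum>i<length ts. card {p. addr p (ts ! i) \<and> kids (subtree p (ts ! i)) = []})"
      by (simp add: card_addr_PNode finite_addr)
    also have "\<dots> = (\<Sum>i<length ts. mleaves (mtree_of (ts ! i)))"
      using PNode by (intro sum.cong) auto
    also have "\<dots> = sum_list (map (mleaves \<circ> mtree_of) ts)"
      by (simp add: sum_list_sum_nth atLeast0LessThan)
    also have "\<dots> = mleaves (mtree_of (PNode ts))"
      using False by (simp add: mset_map[symmetric] sum_mset_sum_list del: mset_map)
    finally show ?thesis .
  qed
qed

lemma pgraph_edge_iff:
  "{p, q} \<in> edges (pgraph t) \<longleftrightarrow>
    (\<exists>i. q = p @ [i] \<and> addr q t) \<or> (\<exists>i. p = q @ [i] \<and> addr p t)"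
  by (auto simp: pgraph_def doubleton_eq_iff)

lemma simple_pgraph: "simple_graph (pgraph t)"
  unfolding simple_graph_def pgraph_def using finite_addr[of t] by (auto simp: addr_snoc)

text \<open>There is no cycle because both cycle neighbours of a longest address on it would have to
  be its parent. Connectedness goes through the root.\<close>

lemma is_tree_pgraph: "is_tree (pgraph t)"
proof -
  define R where "R = {(x, y). {x, y} \<in> edges (pgraph t)}"
  have path: "([], p) \<in> R\<^sup>*" if "addr p t" for p
    using that
  proof (induction p rule: rev_induct)
    case (snoc i p)
    hence "([], p) \<in> R\<^sup>*" by (simp add: addr_snoc)
    moreover have "(p, p @ [i]) \<in> R" using snoc.prems by (simp add: R_def pgraph_edge_iff)
    ultimately show ?case by (rule rtrancl_into_rtrancl)
  qed simp
  have "sym R" by (simp add: R_def sym_def insert_commute)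
  hence symR: "sym (R\<^sup>*)" by (rule sym_rtrancl)
  have "connected_graph (pgraph t)"
    unfolding connected_graph_def R_def[symmetric]
  proof (intro conjI ballI)
    have "[] \<in> verts (pgraph t)" by (simp add: pgraph_def)
    thus "verts (pgraph t) \<noteq> {}" by blast
    fix u v assume "u \<in> verts (pgraph t)" "v \<in> verts (pgraph t)"
    hence "([], u) \<in> R\<^sup>*" "([], v) \<in> R\<^sup>*" using path by (simp_all add: pgraph_def)
    thus "(u, v) \<in> R\<^sup>*" using symD[OF symR] by (meson rtrancl_trans)
  qed
  moreover have "\<not> is_cycle (pgraph t) c" for c
  proof
    assume c: "is_cycle (pgraph t) c"
    define n where "n = length c"
    have n: "n \<ge> 3" and d: "distinct c"
      and edge: "\<And>i. i < n \<Longrightarrow> {c ! i, c ! (Suc i mod n)} \<in> edges (pgraph t)"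
      using c by (auto simp: is_cycle_def n_def)
    have "{..<n} \<noteq> {}" using n by (auto simp: lessThan_eq_iff lessThan_empty_iff)
    then obtain k where "k \<in> {..<n}" and kmax: "Max ((\<lambda>j. length (c ! j)) ` {..<n}) = length (c ! k)"
      by (rule obtains_MAX[OF finite_lessThan])
    hence k: "k < n" "\<And>j. j < n \<Longrightarrow> length (c ! j) \<le> length (c ! k)"
      by (simp_all add: kmax[symmetric])
    define a where "a = Suc k mod n"
    define b where "b = (if k = 0 then n - 1 else k - 1)"
    have ab: "a < n" "b < n" "a \<noteq> b" using k(1) n by (auto simp: a_def b_def mod_Suc)
    have parent: "c ! j = butlast (c ! k)" if "j < n" "{c ! k, c ! j} \<in> edges (pgraph t)" for j
      using that k(2)[OF that(1)] by (auto simp: pgraph_edge_iff)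
    have "{c ! k, c ! a} \<in> edges (pgraph t)" using edge[OF k(1)] by (simp add: a_def)
    moreover have "{c ! k, c ! b} \<in> edges (pgraph t)"
    proof -
      have "Suc b mod n = k" using k(1) n by (auto simp: b_def)
      thus ?thesis using edge[OF ab(2)] by (simp add: insert_commute)
    qed
    ultimately have "c ! a = c ! b" using parent ab by metis
    thus False using d ab by (simp add: n_def nth_eq_iff_index_eq)
  qed
  ultimately show ?thesis using simple_pgraph by (simp add: is_tree_def)
qed

lemma add_leaf_addr:
  assumes "addr p t"
  shows "addr q (add_leaf p t) \<longleftrightarrow> addr q t \<or> q = p @ [length (kids (subtree p t))]"
  using assms
proof (induction p arbitrary: q t)
  case Nil
  show ?case by (cases q) (auto simp: nth_append less_Suc_eq addr_single)
next
  case (Cons i p)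
  show ?case
  proof (cases q)
    case (Cons j q')
    thus ?thesis using Cons.IH[of "kids t ! i" q'] \<open>addr (i # p) t\<close>
      by (cases "j = i") auto
  qed simp
qed

lemma tree_isomorphic_pgraph:
  assumes "is_tree G"
  shows "\<exists>t. isomorphic G (pgraph t)"
  using assms
proof (induction rule: tree_induct)
  case (single v)
  have "pgraph (PNode []) = \<lparr>verts = {[]}, edges = {}\<rparr>"
    by (simp add: pgraph_def addr_single)
  thus ?case unfolding isomorphic_def
    by (intro exI[of _ "PNode []"] exI[of _ "\<lambda>_. []"]) (simp add: bij_betw_def)
next
  case (leaf V E l w)
  have T: "is_tree \<lparr>verts = V, edges = E\<rparr>" by (rule leaf.hyps)
  have EV: "e \<subseteq> V" if "e \<in> E" for e using tree_edgeD(2)[OF T, of e] that by simp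
  obtain t f where f: "bij_betw f V (verts (pgraph t))" and fE: "edges (pgraph t) = (\<lambda>e. f ` e) ` E"
    using leaf.IH unfolding isomorphic_def ugraph.simps by (elim exE conjE)
  define p where "p = f w"
  have p: "addr p t" using f leaf.hyps(3) by (auto simp: bij_betw_def pgraph_def p_def)
  define n where "n = length (kids (subtree p t))"
  have addr: "addr q (add_leaf p t) \<longleftrightarrow> addr q t \<or> q = p @ [n]" for q
    unfolding n_def by (rule add_leaf_addr[OF p])
  have new: "\<not> addr (p @ [n]) t" by (simp add: addr_snoc n_def)
  let ?f = "f(l := p @ [n])"
  have agree: "?f x = f x" if "x \<in> V" for x using that leaf.hyps(2) by auto
  have "bij_betw ?f V (verts (pgraph t))" using f agree by (simp cong: bij_betw_cong)
  moreover have "verts (pgraph (add_leaf p t)) = insert (p @ [n]) (verts (pgraph t))"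
    by (auto simp: pgraph_def addr)
  ultimately have "bij_betw ?f (insert l V) (verts (pgraph (add_leaf p t)))"
    using leaf.hyps(2) new notIn_Un_bij_betw[of l V ?f "verts (pgraph t)"] by (simp add: pgraph_def)
  moreover have "edges (pgraph (add_leaf p t)) = insert {p, p @ [n]} (edges (pgraph t))"
    by (auto simp: pgraph_def addr)
  moreover have "(\<lambda>e. ?f ` e) ` insert {l, w} E = insert {p, p @ [n]} ((\<lambda>e. f ` e) ` E)"
  proof -
    have "(\<lambda>e. ?f ` e) ` E = (\<lambda>e. f ` e) ` E"
      using EV agree by (intro image_cong refl) blast
    moreover have "?f ` {l, w} = {p, p @ [n]}" using agree[OF leaf.hyps(3)] by (auto simp: p_def)
    ultimately show ?thesis by simp
  qed
  ultimately show ?case unfolding isomorphic_def ugraph.simps fE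
    by (intro exI[of _ "add_leaf p t"] exI[of _ ?f]) simp
qed

text \<open>Equal multisets of children are matched by a permutation, and the bijections between
  matched subtrees are glued under the permuted first index. The last clause, that parents go to
  parents, is the form in which adjacency passes through the induction.\<close>

lemma mtree_of_eq_imp_bij:
  assumes "mtree_of s = mtree_of t"
  shows "\<exists>f. bij_betw f {p. addr p s} {p. addr p t} \<and> f [] = [] \<and>
    (\<forall>p i. addr (p @ [i]) s \<longrightarrow> (\<exists>j. f (p @ [i]) = f p @ [j]))"
  using assms
proof (induction s arbitrary: t)
  case (PNode ts)
  obtain us where t: "t = PNode us" by (cases t)
  have "mset (map mtree_of ts) = mset (map mtree_of us)" using PNode.prems by (simp add: t)
  then obtain \<pi> where \<pi>: "\<pi> permutes {..<length us}"
    and perm: "permute_list \<pi> (map mtree_of us) = map mtree_of ts"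
    by (metis mset_eq_permutation length_map)
  have len: "length us = length ts" using perm by (metis length_map length_permute_list)
  have \<pi>l: "\<pi> i < length ts" if "i < length ts" for i
    using permutes_in_image[OF \<pi>, of i] that by (simp add: len)
  have eq: "mtree_of (ts ! i) = mtree_of (us ! \<pi> i)" if "i < length ts" for i
  proof -
    have "map mtree_of ts ! i = map mtree_of us ! \<pi> i"
      using permute_list_nth[of \<pi> "map mtree_of us" i] \<pi> that unfolding perm by (simp add: len)
    thus ?thesis using that \<pi>l len by simp
  qed
  have "\<forall>i<length ts. \<exists>f. bij_betw f {p. addr p (ts ! i)} {p. addr p (us ! \<pi> i)} \<and> f [] = [] \<and>
    (\<forall>p k. addr (p @ [k]) (ts ! i) \<longrightarrow> (\<exists>j. f (p @ [k]) = f p @ [j]))"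
    using PNode.IH[OF nth_mem eq] by blast
  then obtain F where F: "\<And>i. i < length ts \<Longrightarrow> bij_betw (F i) {p. addr p (ts ! i)} {p. addr p (us ! \<pi> i)}"
    "\<And>i. i < length ts \<Longrightarrow> F i [] = []"
    "\<And>i p k. i < length ts \<Longrightarrow> addr (p @ [k]) (ts ! i) \<Longrightarrow> \<exists>j. F i (p @ [k]) = F i p @ [j]"
    by metis
  define f where "f = (\<lambda>p. case p of [] \<Rightarrow> [] | i # q \<Rightarrow> \<pi> i # F i q)"
  have "inj_on f {p. addr p (PNode ts)}"
  proof (rule inj_onI)
    fix p q assume pq: "p \<in> {p. addr p (PNode ts)}" "q \<in> {p. addr p (PNode ts)}" "f p = f q"
    show "p = q"
    proof (cases p)
      case Nil
      thus ?thesis using pq(3) by (cases q) (auto simp: f_def)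
    next
      case (Cons i p')
      then obtain j q' where q: "q = j # q'" using pq(3) by (cases q) (auto simp: f_def)
      have ij: "\<pi> i = \<pi> j" "F i p' = F j q'" using pq(3) by (simp_all add: f_def Cons q)
      hence "i = j" using permutes_inj[OF \<pi>] by (simp add: inj_eq)
      moreover have "inj_on (F i) {p. addr p (ts ! i)}"
        using F(1)[of i] pq(1) by (simp add: Cons bij_betw_def)
      ultimately show ?thesis using ij pq(1,2) by (auto simp: Cons q dest: inj_onD)
    qed
  qed
  moreover have "f ` {p. addr p (PNode ts)} = {p. addr p (PNode us)}"
  proof
    show "f ` {p. addr p (PNode ts)} \<subseteq> {p. addr p (PNode us)}"
    proof
      fix x assume "x \<in> f ` {p. addr p (PNode ts)}"
      then obtain p where p: "addr p (PNode ts)" "x = f p" by blast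
      show "x \<in> {p. addr p (PNode us)}"
      proof (cases p)
        case (Cons i q)
        hence "i < length ts" "addr q (ts ! i)" using p(1) by simp_all
        hence "addr (F i q) (us ! \<pi> i)" using F(1)[of i] by (auto simp: bij_betw_def)
        thus ?thesis using \<pi>l[OF \<open>i < length ts\<close>] p(2) len by (simp add: Cons f_def)
      qed (use p in \<open>simp add: f_def\<close>)
    qed
    show "{p. addr p (PNode us)} \<subseteq> f ` {p. addr p (PNode ts)}"
    proof
      fix x assume "x \<in> {p. addr p (PNode us)}"
      hence x: "addr x (PNode us)" by simp
      show "x \<in> f ` {p. addr p (PNode ts)}"
      proof (cases x)
        case Nil
        thus ?thesis by (intro image_eqI[of _ _ "[]"]) (simp_all add: f_def)
      next
        case (Cons j y)
        define i where "i = inv_into UNIV \<pi> j"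
        have j: "\<pi> i = j" unfolding i_def using permutes_inverses(1)[OF \<pi>] .
        have "j < length us" "addr y (us ! j)" using x Cons by simp_all
        hence i: "i < length ts" using permutes_in_image[OF \<pi>, of i] j len by simp
        have "y \<in> F i ` {p. addr p (ts ! i)}"
          using F(1)[OF i] \<open>addr y (us ! j)\<close> j by (simp add: bij_betw_def)
        then obtain q where "addr q (ts ! i)" "y = F i q" by blast
        thus ?thesis using i j Cons by (intro image_eqI[of _ _ "i # q"]) (simp_all add: f_def)
      qed
    qed
  qed
  moreover have "\<forall>p i. addr (p @ [i]) (PNode ts) \<longrightarrow> (\<exists>j. f (p @ [i]) = f p @ [j])"
  proof (intro allI impI)
    fix p k assume a: "addr (p @ [k]) (PNode ts)"
    show "\<exists>j. f (p @ [k]) = f p @ [j]"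
    proof (cases p)
      case Nil
      thus ?thesis using a F(2)[of k] by (simp add: f_def)
    next
      case (Cons i q)
      thus ?thesis using a F(3)[of i q k] by (simp add: f_def)
    qed
  qed
  moreover have "f [] = []" by (simp add: f_def)
  ultimately show ?case unfolding t bij_betw_def by (intro exI[of _ f] conjI)
qed

text \<open>Sending parents to parents yields an inclusion of edge sets; it is an equality because
  trees with equally many vertices have equally many edges.\<close>

lemma mtree_of_eq_imp_isomorphic:
  assumes "mtree_of s = mtree_of t"
  shows "isomorphic (pgraph s) (pgraph t)"
proof -
  from mtree_of_eq_imp_bij[OF assms]
  obtain f where f: "bij_betw f {p. addr p s} {p. addr p t}" "f [] = []"
    "\<forall>p i. addr (p @ [i]) s \<longrightarrow> (\<exists>j. f (p @ [i]) = f p @ [j])" by (elim exE conjE)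
  have img: "f ` {p. addr p s} = {p. addr p t}" using f(1) by (simp add: bij_betw_def)
  have sub: "(\<lambda>e. f ` e) ` edges (pgraph s) \<subseteq> edges (pgraph t)"
  proof
    fix e assume "e \<in> (\<lambda>e. f ` e) ` edges (pgraph s)"
    then obtain p i where e: "addr (p @ [i]) s" "e = {f p, f (p @ [i])}"
      by (auto simp: pgraph_def)
    obtain j where j: "f (p @ [i]) = f p @ [j]" using f(3) e(1) by blast
    have "addr (f (p @ [i])) t" using img e(1) by blast
    thus "e \<in> edges (pgraph t)" unfolding e(2) pgraph_edge_iff using j by blast
  qed
  have "inj_on (\<lambda>e. f ` e) (edges (pgraph s))"
  proof (rule inj_on_subset[OF inj_on_image_Pow])
    show "inj_on f (verts (pgraph s))" using f(1) by (simp add: bij_betw_def pgraph_def)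
    show "edges (pgraph s) \<subseteq> Pow (verts (pgraph s))"
      using tree_edgeD(2)[OF is_tree_pgraph[of s]] by blast
  qed
  hence "card ((\<lambda>e. f ` e) ` edges (pgraph s)) = card (edges (pgraph s))" by (rule card_image)
  also have "\<dots> = card (edges (pgraph t))"
  proof -
    have "card (verts (pgraph s)) = card (verts (pgraph t))"
      using bij_betw_same_card[OF f(1)] by (simp add: pgraph_def)
    thus ?thesis using tree_card[OF is_tree_pgraph, of s] tree_card[OF is_tree_pgraph, of t] by simp
  qed
  finally have "(\<lambda>e. f ` e) ` edges (pgraph s) = edges (pgraph t)"
    by (intro card_subset_eq sub tree_finite(2)[OF is_tree_pgraph])
  thus ?thesis unfolding isomorphic_def using f(1) by (intro exI[of _ f]) (simp add: pgraph_def)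
qed

section \<open>Recovering the rooted tree from a graph\<close>

text \<open>The rooted tree seen from \<open>v\<close> when the vertices of \<open>X\<close> (the parent of \<open>v\<close>) are not visited,
  cut off at depth \<open>k\<close>.\<close>

primrec code :: "nat \<Rightarrow> 'a set set \<Rightarrow> 'a set \<Rightarrow> 'a \<Rightarrow> mtree" where
  "code 0 E X v = MNode {#}"
| "code (Suc k) E X v = MNode (image_mset (code k E {v}) (mset_set {w. {v, w} \<in> E \<and> w \<notin> X}))"

text \<open>This allows a rooted tree to be read off the chosen member of an isomorphism class
  instead of off \<open>pgraph t\<close>.\<close>

lemma code_isomorphic:
  assumes G: "simple_graph G" and f: "inj_on f (verts G)"
  shows "v \<in> verts G \<Longrightarrow> X \<subseteq> verts G \<Longrightarrow>
    code k ((\<lambda>e. f ` e) ` edges G) (f ` X) (f v) = code k (edges G) X v"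
proof (induction k arbitrary: v X)
  case (Suc k)
  let ?N = "{w. {v, w} \<in> edges G \<and> w \<notin> X}"
  have NV: "?N \<subseteq> verts G" using simple_graphD(2)[OF G] by blast
  have N: "{w'. {f v, w'} \<in> (\<lambda>e. f ` e) ` edges G \<and> w' \<notin> f ` X} = f ` ?N"
  proof (intro equalityI subsetI)
    fix w' assume "w' \<in> {w'. {f v, w'} \<in> (\<lambda>e. f ` e) ` edges G \<and> w' \<notin> f ` X}"
    then obtain e where e: "e \<in> edges G" "f ` e = {f v, w'}" and w': "w' \<notin> f ` X" by auto
    have eV: "e \<subseteq> verts G" "card e = 2" using G e(1) by (auto simp: simple_graph_def)
    have "f v \<in> f ` e" using e(2) by simp
    hence ve: "v \<in> e" using inj_on_image_mem_iff[OF f Suc.prems(1) eV(1)] by simp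
    obtain a b where ab: "e = {a, b}" "a \<noteq> b" using eV(2) unfolding card_2_iff by (elim exE conjE)
    obtain w where w: "e = {v, w}" "v \<noteq> w"
      using ve ab by (cases "a = v") (auto simp: insert_commute)
    have wV: "w \<in> verts G" using eV(1) w(1) by simp
    have "f v \<noteq> f w" using f Suc.prems(1) wV w(2) by (auto dest: inj_onD)
    moreover have "{f v, f w} = {f v, w'}" using e(2) by (simp add: w(1))
    ultimately have "w' = f w" by (simp add: doubleton_eq_iff)
    moreover have "w \<notin> X" using w' \<open>w' = f w\<close> by blast
    ultimately show "w' \<in> f ` ?N" using e(1) w(1) by simp
  next
    fix w' assume "w' \<in> f ` ?N"
    then obtain w where w: "{v, w} \<in> edges G" "w \<notin> X" "w' = f w" by blast
    have "w \<in> verts G" by (rule simple_graphD(2)[OF G w(1)])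
    hence "w' \<notin> f ` X" using w(2,3) inj_on_image_mem_iff[OF f _ Suc.prems(2)] by simp
    moreover have "{f v, w'} \<in> (\<lambda>e. f ` e) ` edges G"
      by (rule image_eqI[OF _ w(1)]) (simp add: w(3))
    ultimately show "w' \<in> {w'. {f v, w'} \<in> (\<lambda>e. f ` e) ` edges G \<and> w' \<notin> f ` X}" by simp
  qed
  have finN: "finite ?N" using NV G by (auto simp: simple_graph_def intro: finite_subset)
  have "image_mset (code k ((\<lambda>e. f ` e) ` edges G) {f v}) (mset_set (f ` ?N)) =
      image_mset (code k ((\<lambda>e. f ` e) ` edges G) {f v}) (image_mset f (mset_set ?N))"
    using inj_on_subset[OF f NV] by (simp add: image_mset_mset_set)
  also have "\<dots> = image_mset (\<lambda>w. code k ((\<lambda>e. f ` e) ` edges G) (f ` {v}) (f w)) (mset_set ?N)"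
    by (simp add: multiset.map_comp o_def)
  also have "\<dots> = image_mset (code k (edges G) {v}) (mset_set ?N)"
  proof (rule image_mset_cong)
    fix w assume "w \<in># mset_set ?N"
    hence "w \<in> verts G" using NV finN by auto
    thus "code k ((\<lambda>e. f ` e) ` edges G) (f ` {v}) (f w) = code k (edges G) {v} w"
      using Suc.IH[of w "{v}"] Suc.prems(1) by simp
  qed
  finally show ?case unfolding code.simps N by simp
qed simp

lemma msize_pos: "msize x > 0"
  by (cases x) simp

lemma msize_child:
  assumes "x \<in># M" shows "msize x < msize (MNode M)"
  using assms by (auto dest!: multi_member_split)

text \<open>With the parent hidden, the visible neighbours of an address are its children; the root
  has nothing to hide. Size bounds depth, so with \<open>k\<close> at least the size of the subtree
  the cut-off is never felt.\<close>

lemma code_pgraph: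
  assumes "addr p t" "msize (mtree_of (subtree p t)) \<le> k"
  shows "code k (edges (pgraph t)) (if p = [] then {} else {butlast p}) p = mtree_of (subtree p t)"
  using assms
proof (induction k arbitrary: p)
  case 0
  thus ?case using msize_pos[of "mtree_of (subtree p t)"] by simp
next
  case (Suc k)
  define ts where "ts = kids (subtree p t)"
  have st: "subtree p t = PNode ts" by (simp add: ts_def)
  let ?X = "if p = [] then {} else {butlast p}"
  have N: "{w. {p, w} \<in> edges (pgraph t) \<and> w \<notin> ?X} = (\<lambda>i. p @ [i]) ` {..<length ts}"
  proof (intro equalityI subsetI)
    fix w assume "w \<in> {w. {p, w} \<in> edges (pgraph t) \<and> w \<notin> ?X}"
    thus "w \<in> (\<lambda>i. p @ [i]) ` {..<length ts}"
      using Suc.prems(1) by (auto simp: pgraph_edge_iff addr_snoc ts_def split: if_splits)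
  next
    fix w assume "w \<in> (\<lambda>i. p @ [i]) ` {..<length ts}"
    then obtain i where i: "i < length ts" "w = p @ [i]" by blast
    have "w \<noteq> butlast p"
    proof
      assume "w = butlast p"
      hence "length w = length p - 1" by simp
      thus False using i(2) by simp
    qed
    thus "w \<in> {w. {p, w} \<in> edges (pgraph t) \<and> w \<notin> ?X}"
      using i Suc.prems(1) by (simp add: pgraph_edge_iff addr_snoc ts_def)
  qed
  have "code (Suc k) (edges (pgraph t)) ?X p =
      MNode (image_mset (code k (edges (pgraph t)) {p}) (image_mset (\<lambda>i. p @ [i]) (mset_set {..<length ts})))"
    unfolding code.simps N by (subst image_mset_mset_set) (auto simp: inj_on_def)
  also have "\<dots> = MNode (image_mset (\<lambda>i. code k (edges (pgraph t)) {p} (p @ [i])) (mset_set {..<length ts}))"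
    by (simp add: multiset.map_comp o_def)
  also have "image_mset (\<lambda>i. code k (edges (pgraph t)) {p} (p @ [i])) (mset_set {..<length ts}) =
      image_mset (\<lambda>i. mtree_of (ts ! i)) (mset_set {..<length ts})"
  proof (rule image_mset_cong)
    fix i assume "i \<in># mset_set {..<length ts}"
    hence i: "i < length ts" by simp
    have sub: "subtree (p @ [i]) t = ts ! i" by (simp add: subtree_append st)
    have "mtree_of (ts ! i) \<in># mset (map mtree_of ts)" using i by simp
    from msize_child[OF this] have "msize (mtree_of (ts ! i)) \<le> k" using Suc.prems(2) by (simp add: st)
    thus "code k (edges (pgraph t)) {p} (p @ [i]) = mtree_of (ts ! i)"
      using Suc.IH[of "p @ [i]"] Suc.prems(1) i by (simp add: sub addr_snoc ts_def)
  qed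
  also have "\<dots> = mset (map (\<lambda>i. mtree_of (ts ! i)) [0..<length ts])"
    by (simp add: mset_map atLeast0LessThan[symmetric] flip: mset_upt)
  also have "map (\<lambda>i. mtree_of (ts ! i)) [0..<length ts] = map mtree_of ts"
    by (rule nth_equalityI) simp_all
  finally show ?case by (simp add: st)
qed

lemma isomorphic_leaf_set:
  assumes f: "bij_betw f (verts G) (verts H)" "edges H = (\<lambda>e. f ` e) ` edges G" and G: "simple_graph G"
  shows "f ` leaf_set G \<subseteq> leaf_set H"
proof
  have inj: "inj_on f (verts G)" using f(1) by (simp add: bij_betw_def)
  fix x assume "x \<in> f ` leaf_set G"
  then obtain v where v: "v \<in> leaf_set G" "x = f v" by blast
  have vV: "v \<in> verts G" using v(1) by (simp add: leaf_set_def)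
  obtain w where w: "{v, w} \<in> edges G" and uniq: "\<And>z. {v, z} \<in> edges G \<Longrightarrow> z = w"
    using v(1) unfolding leaf_set_def by blast
  have "y = f w" if y: "{f v, y} \<in> edges H" for y
  proof -
    obtain e where e: "e \<in> edges G" "f ` e = {f v, y}" using y f(2) by auto
    have eV: "e \<subseteq> verts G" "card e = 2" using G e(1) by (auto simp: simple_graph_def)
    have "f v \<in> f ` e" using e(2) by simp
    hence ve: "v \<in> e" using inj_on_image_mem_iff[OF inj vV eV(1)] by simp
    obtain a b where ab: "e = {a, b}" "a \<noteq> b" using eV(2) unfolding card_2_iff by (elim exE conjE)
    obtain z where z: "e = {v, z}" "v \<noteq> z"
      using ve ab by (cases "a = v") (auto simp: insert_commute)
    have "z = w" by (rule uniq) (use e(1) z(1) in simp)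
    have "f v \<noteq> f z" using inj vV eV(1) z by (auto dest: inj_onD)
    moreover have "{f v, f z} = {f v, y}" using e(2) by (simp add: z(1))
    ultimately show "y = f w" using \<open>z = w\<close> by (simp add: doubleton_eq_iff)
  qed
  moreover have "{f v, f w} \<in> edges H" unfolding f(2) by (rule image_eqI[OF _ w]) simp
  ultimately have "\<exists>!y. {f v, y} \<in> edges H" by (intro ex1I[of "\<lambda>y. {f v, y} \<in> edges H" "f w"])
  moreover have "f v \<in> verts H" using f(1) vV by (auto simp: bij_betw_def)
  ultimately show "x \<in> leaf_set H" by (simp add: leaf_set_def v(2))
qed

text \<open>A terminal address other than the root is adjacent to its parent alone, and in a tree
  with at least two vertices the root is not terminal. A root with a single child is a leaf missed
  by \<open>mleaves\<close>, hence the inequality.\<close>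

lemma mleaves_le_leaf_set:
  assumes "isomorphic (pgraph t) G" and n: "card (verts G) \<ge> 2"
  shows "mleaves (mtree_of t) \<le> card (leaf_set G)"
proof -
  obtain f where f: "bij_betw f (verts (pgraph t)) (verts G)" "edges G = (\<lambda>e. f ` e) ` edges (pgraph t)"
    using assms(1) unfolding isomorphic_def by (elim exE conjE)
  have finG: "finite (verts G)"
    using bij_betw_finite[OF f(1)] finite_addr[of t] by (simp add: pgraph_def)
  have root: "kids t \<noteq> []"
  proof
    assume "kids t = []"
    hence "t = PNode []" by (cases t) simp
    hence "verts (pgraph t) = {[]}" by (simp add: pgraph_def addr_single)
    thus False using n bij_betw_same_card[OF f(1)] by simp
  qed
  have sub: "{p. addr p t \<and> kids (subtree p t) = []} \<subseteq> leaf_set (pgraph t)"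
  proof
    fix p assume "p \<in> {p. addr p t \<and> kids (subtree p t) = []}"
    hence p: "addr p t" "kids (subtree p t) = []" by auto
    have ne: "p \<noteq> []" using root p(2) by auto
    then obtain q i where q: "p = q @ [i]" by (metis rev_exhaust)
    have "{p, w} \<in> edges (pgraph t) \<longleftrightarrow> w = q" for w
      using p by (auto simp: pgraph_edge_iff addr_append subtree_append q)
    hence "\<exists>!w. {p, w} \<in> edges (pgraph t)" by simp
    thus "p \<in> leaf_set (pgraph t)" using p(1) by (simp add: leaf_set_def pgraph_def)
  qed
  have inj: "inj_on f (leaf_set (pgraph t))"
    using f(1) by (auto simp: bij_betw_def leaf_set_def intro: inj_on_subset)
  have "finite (leaf_set (pgraph t))"
    by (rule finite_subset[OF _ finite_addr[of t]]) (auto simp: leaf_set_def pgraph_def)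
  hence "mleaves (mtree_of t) \<le> card (leaf_set (pgraph t))"
    using card_mono[OF _ sub] by (simp add: card_terminal_addr)
  also have "\<dots> = card (f ` leaf_set (pgraph t))" using card_image[OF inj] by simp
  also have "\<dots> \<le> card (leaf_set G)"
    using isomorphic_leaf_set[OF f simple_pgraph] finG
    by (intro card_mono) (auto simp: leaf_set_def)
  finally show ?thesis .
qed

section \<open>Isomorphism classes compared with rooted trees\<close>

lemma unlabelled_trees_class:
  assumes "C \<in> unlabelled_trees k"
  shows "\<exists>T\<in>labelled_trees k. C = {S \<in> labelled_trees k. isomorphic T S}"
  using assms unfolding unlabelled_trees_def by (auto elim!: quotientE)

lemma unlabelled_treesI:
  assumes "T \<in> labelled_trees k"
  shows "{S \<in> labelled_trees k. isomorphic T S} \<in> unlabelled_trees k"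
proof -
  let ?R = "{(S, T). S \<in> labelled_trees k \<and> T \<in> labelled_trees k \<and> isomorphic S T}"
  have "?R `` {T} = {S \<in> labelled_trees k. isomorphic T S}" using assms by auto
  thus ?thesis unfolding unlabelled_trees_def using quotientI[OF assms, of ?R] by simp
qed

lemma labelled_treesD:
  assumes "T \<in> labelled_trees k"
  shows "is_tree T" "simple_graph T" "card (edges T) = k" "card (verts T) = Suc k"
  using assms tree_card[of T] by (simp_all add: labelled_trees_def is_tree_def)

lemma isomorphic_tree:
  assumes T: "is_tree G" and iso: "isomorphic G H"
  shows "is_tree H"
proof -
  obtain f where f: "bij_betw f (verts G) (verts H)" "edges H = (\<lambda>e. f ` e) ` edges G"
    using iso unfolding isomorphic_def by (elim exE conjE)
  have simpleG: "simple_graph G" and connG: "connected_graph G" using T by (auto simp: is_tree_def)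
  obtain g where g: "bij_betw g (verts H) (verts G)" "edges G = (\<lambda>e. g ` e) ` edges H"
    using isomorphic_sym[OF iso simpleG] unfolding isomorphic_def by (elim exE conjE)
  have inj: "inj_on f (verts G)" and img: "f ` verts G = verts H" using f(1) by (auto simp: bij_betw_def)
  have simple: "simple_graph H"
    unfolding simple_graph_def
  proof (intro conjI ballI)
    show "finite (verts H)" unfolding img[symmetric] using tree_finite(1)[OF T] by (rule finite_imageI)
  next
    fix e assume "e \<in> edges H"
    then obtain e' where e': "e' \<in> edges G" "e = f ` e'" using f(2) by blast
    have e'V: "card e' = 2" "e' \<subseteq> verts G" by (rule tree_edgeD[OF T e'(1)])+
    show "e \<subseteq> verts H" unfolding e'(2) img[symmetric] using e'V(2) by (rule image_mono)
    show "card e = 2" unfolding e'(2) using card_image[OF inj_on_subset[OF inj e'V(2)]] e'V(1) by simp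
  qed
  have walk: "(f a, f b) \<in> {(x, y). {x, y} \<in> edges H}\<^sup>*"
    if "(a, b) \<in> {(x, y). {x, y} \<in> edges G}\<^sup>*" for a b
    using that
  proof (induction rule: rtrancl_induct)
    case (step y z)
    have "f ` {y, z} \<in> edges H" unfolding f(2) using step.hyps(2) by blast
    hence "(f y, f z) \<in> {(x, y). {x, y} \<in> edges H}" by simp
    with step.IH show ?case by (rule rtrancl_into_rtrancl)
  qed simp
  have "connected_graph H"
    unfolding connected_graph_def
  proof (intro conjI ballI)
    show "verts H \<noteq> {}" unfolding img[symmetric] using connG by (simp add: connected_graph_def)
    fix u v assume "u \<in> verts H" "v \<in> verts H"
    then obtain a b where "a \<in> verts G" "b \<in> verts G" "u = f a" "v = f b" unfolding img[symmetric] by blast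
    thus "(u, v) \<in> {(x, y). {x, y} \<in> edges H}\<^sup>*" using walk connG by (simp add: connected_graph_def)
  qed
  moreover have "\<not> is_cycle H c" for c
  proof
    assume c: "is_cycle H c"
    have edge: "{c ! i, c ! (Suc i mod length c)} \<in> edges H" if "i < length c" for i
      using c that by (simp add: is_cycle_def)
    have "set c \<subseteq> verts H"
      using simple_graphD(1)[OF simple edge] by (auto simp: in_set_conv_nth)
    hence "distinct (map g c)"
      using c g(1) by (auto simp: is_cycle_def distinct_map bij_betw_def intro: inj_on_subset)
    moreover have "{map g c ! i, map g c ! (Suc i mod length (map g c))} \<in> edges G"
      if "i < length (map g c)" for i
    proof -
      have i: "i < length c" using that by simp
      have "Suc i mod length c < length c" using i by (cases c) simp_all
      hence "{map g c ! i, map g c ! (Suc i mod length (map g c))} = g ` {c ! i, c ! (Suc i mod length c)}"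
        using i by simp
      thus ?thesis unfolding g(2) using edge[OF i] by (simp only: imageI)
    qed
    ultimately have "is_cycle G (map g c)" using c by (simp add: is_cycle_def)
    thus False using T by (simp add: is_tree_def)
  qed
  ultimately show ?thesis using simple by (simp add: is_tree_def)
qed

lemma realize_mtree:
  assumes "msize x = Suc k"
  shows "\<exists>t T. mtree_of t = x \<and> T \<in> labelled_trees k \<and> isomorphic (pgraph t) T"
proof -
  obtain t where t: "mtree_of t = x" using mtree_of_surj by blast
  define T where "T = \<lparr>verts = to_nat ` verts (pgraph t), edges = (\<lambda>e. to_nat ` e) ` edges (pgraph t)\<rparr>"
  have iso: "isomorphic (pgraph t) T"
    unfolding isomorphic_def T_def by (rule exI[of _ to_nat]) (simp add: bij_betw_def)
  have tree: "is_tree T" by (rule isomorphic_tree[OF is_tree_pgraph iso])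
  have "card (verts T) = card (verts (pgraph t))" by (simp add: T_def card_image)
  hence "card (verts T) = Suc k" using assms card_addr[of t] by (simp add: pgraph_def t)
  hence "T \<in> labelled_trees k" using tree tree_card[OF tree] by (simp add: labelled_trees_def)
  thus ?thesis using t iso by blast
qed

text \<open>Every rooted tree arises as the \<open>code\<close> of a class representative at some
  vertex, and a tree with \<open>k\<close> edges has \<open>Suc k\<close> vertices. This transfers
  lower bounds from rooted trees to classes; finiteness of the rooted trees comes along.\<close>

lemma card_mtrees_le:
  "finite {x. msize x = Suc k}" "card {x. msize x = Suc k} \<le> Suc k * card (unlabelled_trees k)"
proof -
  define rep where "rep = (\<lambda>C :: nat ugraph set. SOME T. T \<in> C)"
  define codes where "codes = (\<lambda>C. (\<lambda>v. code (Suc k) (edges (rep C)) {} v) ` verts (rep C))"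
  have sub: "{x. msize x = Suc k} \<subseteq> (\<Union>C\<in>unlabelled_trees k. codes C)"
  proof
    fix x assume "x \<in> {x. msize x = Suc k}"
    hence x: "msize x = Suc k" by simp
    from realize_mtree[OF x] obtain t T where t: "mtree_of t = x" and T: "T \<in> labelled_trees k"
      and iso: "isomorphic (pgraph t) T" by (elim exE conjE)
    define C where "C = {S \<in> labelled_trees k. isomorphic T S}"
    have C: "C \<in> unlabelled_trees k" unfolding C_def by (rule unlabelled_treesI[OF T])
    have "T \<in> C" using T isomorphic_refl by (simp add: C_def)
    hence repC: "rep C \<in> C" unfolding rep_def by (rule someI)
    have "isomorphic T S" if "S \<in> C" for S using that by (simp add: C_def)
    hence "isomorphic (pgraph t) (rep C)" using isomorphic_trans[OF iso] repC by blast
    then obtain f where f: "bij_betw f (verts (pgraph t)) (verts (rep C))"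
      "edges (rep C) = (\<lambda>e. f ` e) ` edges (pgraph t)" unfolding isomorphic_def by (elim exE conjE)
    have inj: "inj_on f (verts (pgraph t))" using f(1) by (simp add: bij_betw_def)
    have root: "[] \<in> verts (pgraph t)" by (simp add: pgraph_def)
    have "code (Suc k) (edges (rep C)) {} (f []) = code (Suc k) (edges (pgraph t)) {} []"
      using code_isomorphic[OF simple_pgraph inj root, of "{}" "Suc k"] by (simp only: f(2) image_empty empty_subsetI)
    also have "\<dots> = x" using code_pgraph[of "[]" t "Suc k"] x by (simp add: t del: code.simps)
    finally have "x \<in> codes C" unfolding codes_def using f(1) root by (auto simp: bij_betw_def)
    thus "x \<in> (\<Union>C\<in>unlabelled_trees k. codes C)" using C by blast
  qed
  have codes: "finite (codes C) \<and> card (codes C) \<le> Suc k" if CU: "C \<in> unlabelled_trees k" for C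
  proof -
    obtain T where T: "T \<in> labelled_trees k" "C = {S \<in> labelled_trees k. isomorphic T S}"
      using unlabelled_trees_class[OF CU] by blast
    hence "T \<in> C" using isomorphic_refl by simp
    hence "rep C \<in> C" unfolding rep_def by (rule someI)
    hence "rep C \<in> labelled_trees k" using T(2) by simp
    hence "finite (verts (rep C))" "card (verts (rep C)) = Suc k"
      using labelled_treesD tree_finite(1) by blast+
    thus ?thesis unfolding codes_def using card_image_le by (metis finite_imageI)
  qed
  have fin: "finite (\<Union>C\<in>unlabelled_trees k. codes C)" using codes finite_unlabelled_trees by blast
  show "finite {x. msize x = Suc k}" by (rule finite_subset[OF sub fin])
  have "card {x. msize x = Suc k} \<le> card (\<Union>C\<in>unlabelled_trees k. codes C)" by (rule card_mono[OF fin sub])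
  also have "\<dots> \<le> (\<Sum>C\<in>unlabelled_trees k. card (codes C))" by (rule card_UN_le[OF finite_unlabelled_trees])
  also have "\<dots> \<le> (\<Sum>C\<in>unlabelled_trees k. Suc k)" using codes by (intro sum_mono) blast
  finally show "card {x. msize x = Suc k} \<le> Suc k * card (unlabelled_trees k)" by (simp add: mult.commute)
qed

text \<open>The converse comparison loses no factor: rooting one representative of each class is
  injective, as equal nested multisets come from isomorphic graphs. The representative is taken
  among the members with few leaves, so that the bound passes to \<open>mleaves\<close>.\<close>

lemma card_few_leaves_le:
  assumes "k \<ge> 1"
  shows "card {C \<in> unlabelled_trees k. \<exists>T\<in>C. card (leaf_set T) \<le> l} \<le>
    card {x. msize x = Suc k \<and> mleaves x \<le> l}"
proof -
  define B where "B = {C \<in> unlabelled_trees k. \<exists>T\<in>C. card (leaf_set T) \<le> l}"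
  define rep where "rep = (\<lambda>C :: nat ugraph set. SOME T. T \<in> C \<and> card (leaf_set T) \<le> l)"
  have rep: "rep C \<in> C" "card (leaf_set (rep C)) \<le> l" if "C \<in> B" for C
  proof -
    have "\<exists>T. T \<in> C \<and> card (leaf_set T) \<le> l" using that by (auto simp: B_def)
    from someI_ex[OF this] show "rep C \<in> C" "card (leaf_set (rep C)) \<le> l" by (simp_all add: rep_def)
  qed
  have repL: "rep C \<in> labelled_trees k" and cls: "C = {S \<in> labelled_trees k. isomorphic (rep C) S}"
    if C: "C \<in> B" for C
  proof -
    have "C \<in> unlabelled_trees k" using C by (simp add: B_def)
    then obtain T where T: "T \<in> labelled_trees k" "C = {S \<in> labelled_trees k. isomorphic T S}"
      using unlabelled_trees_class by blast
    have r: "rep C \<in> labelled_trees k" "isomorphic T (rep C)" using rep(1)[OF C] unfolding T(2) by simp_all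
    have r': "isomorphic (rep C) T" by (rule isomorphic_sym[OF r(2) labelled_treesD(2)[OF T(1)]])
    show "rep C \<in> labelled_trees k" by (rule r(1))
    have eq: "isomorphic T S \<longleftrightarrow> isomorphic (rep C) S" for S
      using isomorphic_trans[OF r(2), of S] isomorphic_trans[OF r', of S] by blast
    show "C = {S \<in> labelled_trees k. isomorphic (rep C) S}"
      by (rule trans[OF T(2)]) (simp only: eq)
  qed
  have "\<forall>C\<in>B. \<exists>t. isomorphic (rep C) (pgraph t)"
    using tree_isomorphic_pgraph labelled_treesD(1)[OF repL] by blast
  then obtain t where t: "\<And>C. C \<in> B \<Longrightarrow> isomorphic (rep C) (pgraph (t C))" by metis
  have t': "isomorphic (pgraph (t C)) (rep C)" if "C \<in> B" for C
    by (rule isomorphic_sym[OF t[OF that] labelled_treesD(2)[OF repL[OF that]]])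
  have "inj_on (\<lambda>C. mtree_of (t C)) B"
  proof (rule inj_onI)
    fix C D assume CD: "C \<in> B" "D \<in> B" "mtree_of (t C) = mtree_of (t D)"
    have "isomorphic (rep C) (rep D)"
      by (rule isomorphic_trans[OF t[OF CD(1)]
        isomorphic_trans[OF mtree_of_eq_imp_isomorphic[OF CD(3)] t'[OF CD(2)]]])
    hence "isomorphic (rep D) (rep C)" by (rule isomorphic_sym) (rule labelled_treesD(2)[OF repL[OF CD(1)]])
    hence eq: "isomorphic (rep C) S \<longleftrightarrow> isomorphic (rep D) S" for S
      using isomorphic_trans \<open>isomorphic (rep C) (rep D)\<close> by blast
    have "{S \<in> labelled_trees k. isomorphic (rep C) S} = {S \<in> labelled_trees k. isomorphic (rep D) S}"
      by (intro Collect_cong conj_cong refl eq)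
    thus "C = D" using cls[OF CD(1)] cls[OF CD(2)] by argo
  qed
  moreover have "(\<lambda>C. mtree_of (t C)) ` B \<subseteq> {x. msize x = Suc k \<and> mleaves x \<le> l}"
  proof (rule image_subsetI)
    fix C assume C: "C \<in> B"
    obtain f where "bij_betw f (verts (pgraph (t C))) (verts (rep C))"
      using t'[OF C] unfolding isomorphic_def by (elim exE conjE)
    from bij_betw_same_card[OF this] have "msize (mtree_of (t C)) = Suc k"
      using labelled_treesD(4)[OF repL[OF C]] card_addr[of "t C"] by (simp add: pgraph_def)
    moreover have "mleaves (mtree_of (t C)) \<le> card (leaf_set (rep C))"
      using mleaves_le_leaf_set[OF t'[OF C]] labelled_treesD(4)[OF repL[OF C]] assms by simp
    ultimately show "mtree_of (t C) \<in> {x. msize x = Suc k \<and> mleaves x \<le> l}" using rep(2)[OF C] by simp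
  qed
  moreover have "finite {x. msize x = Suc k \<and> mleaves x \<le> l}"
    by (rule finite_subset[OF _ card_mtrees_le(1)[of k]]) auto
  ultimately show ?thesis unfolding B_def[symmetric] by (rule card_inj_on_le)
qed

section \<open>Generating functions of rooted trees\<close>

text \<open>Capping the multiplicities keeps the set finite when \<open>X\<close> is; its weighted
  sum is a finite Euler product, whose factors become full geometric series as \<open>K\<close>
  grows.\<close>

definition mult_bounded :: "'a set \<Rightarrow> nat \<Rightarrow> 'a multiset set" where
  "mult_bounded X K = {M. set_mset M \<subseteq> X \<and> (\<forall>x. count M x \<le> K)}"

lemma mult_bounded_insert:
  assumes "x \<notin> X"
  shows "mult_bounded (insert x X) K = (\<lambda>(j, M). replicate_mset j x + M) ` ({..K} \<times> mult_bounded X K)"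
    and "inj_on (\<lambda>(j, M). replicate_mset j x + M) ({..K} \<times> mult_bounded X K)"
proof -
  have nx: "count M x = 0" if "M \<in> mult_bounded X K" for M
    using that assms by (auto simp: mult_bounded_def not_in_iff)
  show "mult_bounded (insert x X) K = (\<lambda>(j, M). replicate_mset j x + M) ` ({..K} \<times> mult_bounded X K)"
  proof (intro equalityI subsetI)
    fix M assume M: "M \<in> mult_bounded (insert x X) K"
    have "M = replicate_mset (count M x) x + filter_mset (\<lambda>y. y \<noteq> x) M"
      by (rule multiset_eqI) simp
    moreover have "filter_mset (\<lambda>y. y \<noteq> x) M \<in> mult_bounded X K" "count M x \<le> K"
      using M by (auto simp: mult_bounded_def)
    ultimately show "M \<in> (\<lambda>(j, M). replicate_mset j x + M) ` ({..K} \<times> mult_bounded X K)"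
      by (intro image_eqI[of _ _ "(count M x, filter_mset (\<lambda>y. y \<noteq> x) M)"]) auto
  next
    fix M assume "M \<in> (\<lambda>(j, M). replicate_mset j x + M) ` ({..K} \<times> mult_bounded X K)"
    then obtain j N where N: "j \<le> K" "N \<in> mult_bounded X K" "M = replicate_mset j x + N" by auto
    thus "M \<in> mult_bounded (insert x X) K" using nx[OF N(2)]
      by (auto simp: mult_bounded_def)
  qed
  show "inj_on (\<lambda>(j, M). replicate_mset j x + M) ({..K} \<times> mult_bounded X K)"
  proof (rule inj_onI, clarify)
    fix j M j' M' assume M: "M \<in> mult_bounded X K" "M' \<in> mult_bounded X K"
      and eq: "replicate_mset j x + M = replicate_mset j' x + M'"
    have "j = count (replicate_mset j x + M) x" using nx[OF M(1)] by simp
    also have "\<dots> = j'" unfolding eq using nx[OF M(2)] by simp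
    finally show "j = j' \<and> M = M'" using eq by simp
  qed
qed

lemma sum_mult_bounded:
  fixes w :: "'a \<Rightarrow> real"
  assumes "finite X"
  shows "finite (mult_bounded X K) \<and>
    (\<Sum>M\<in>mult_bounded X K. \<Prod>x\<in>#M. w x) = (\<Prod>x\<in>X. \<Sum>j\<le>K. w x ^ j)"
  using assms
proof (induction X)
  case empty
  have "mult_bounded ({} :: 'a set) K = {{#}}" by (auto simp: mult_bounded_def)
  thus ?case by simp
next
  case (insert x X)
  note ins = mult_bounded_insert[OF insert.hyps(2), of K]
  have "(\<Sum>M\<in>mult_bounded (insert x X) K. \<Prod>x\<in>#M. w x) =
      (\<Sum>(j, M)\<in>{..K} \<times> mult_bounded X K. w x ^ j * (\<Prod>x\<in>#M. w x))"
    unfolding ins(1) sum.reindex[OF ins(2)] by (simp add: case_prod_unfold o_def)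
  also have "\<dots> = (\<Sum>j\<le>K. w x ^ j) * (\<Sum>M\<in>mult_bounded X K. \<Prod>x\<in>#M. w x)"
    by (simp add: sum_product sum.cartesian_product)
  finally show ?case using insert ins(1) by simp
qed

section \<open>Exponential bounds for the factors of the Euler product\<close>

lemma sum_powers_le:
  assumes "0 \<le> w" "w < (1 :: real)"
  shows "(\<Sum>j\<le>K. w ^ j) \<le> 1 / (1 - w)"
proof -
  have "(1 - w) * (\<Sum>j\<le>K. w ^ j) = 1 - w ^ Suc K"
    by (simp add: sum_gp_basic)
  also have "\<dots> \<le> 1" using assms by simp
  finally show ?thesis using assms by (simp add: field_simps)
qed

text \<open>Both are upper bounds for \<open>- ln (1 - w)\<close>. The first is used where the sum
  is small; the second has the exact quadratic term \<open>w\<^sup>2 / 2\<close> and absorbs all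
  higher terms into its denominator, so that only one further sum, at squared arguments, is
  needed.\<close>

lemma inverse_one_minus_le_exp:
  assumes "0 \<le> w" "w < (1 :: real)"
  shows "1 / (1 - w) \<le> exp (w / (1 - w))" "1 / (1 - w) \<le> exp (w + w\<^sup>2 / (2 * (1 - w)))"
proof -
  have "1 / (1 - w) = 1 + w / (1 - w)" using assms by (simp add: field_simps)
  also have "\<dots> \<le> exp (w / (1 - w))" by (rule exp_ge_add_one_self)
  finally show "1 / (1 - w) \<le> exp (w / (1 - w))" .
  define g where "g = (\<lambda>w :: real. w + w\<^sup>2 / (2 * (1 - w)) + ln (1 - w))"
  have "g 0 \<le> g w"
  proof (rule DERIV_nonneg_imp_nondecreasing[OF assms(1)])
    fix x assume x: "0 \<le> x" "x \<le> w"
    hence x1: "1 - x > 0" using assms by simp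
    have "(g has_real_derivative 1 + (2 * x * (2 * (1 - x)) - x\<^sup>2 * (2 * (0 - 1))) / (2 * (1 - x))\<^sup>2
        + (0 - 1) / (1 - x)) (at x)"
      unfolding g_def using x1 by (auto intro!: derivative_eq_intros simp: power2_eq_square)
    moreover have "1 + (2 * x * (2 * (1 - x)) - x\<^sup>2 * (2 * (0 - 1))) / (2 * (1 - x))\<^sup>2
        + (0 - 1) / (1 - x) = x\<^sup>2 / (2 * (1 - x)\<^sup>2)"
    proof -
      define d where "d = 1 - x"
      have xd: "x = 1 - d" and "d > 0" using x1 by (simp_all add: d_def)
      thus ?thesis unfolding xd by (simp add: field_simps power2_eq_square)
    qed
    ultimately show "\<exists>y. (g has_real_derivative y) (at x) \<and> 0 \<le> y" by auto
  qed
  hence "- ln (1 - w) \<le> w + w\<^sup>2 / (2 * (1 - w))" by (simp add: g_def)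
  hence "exp (- ln (1 - w)) \<le> exp (w + w\<^sup>2 / (2 * (1 - w)))" by simp
  thus "1 / (1 - w) \<le> exp (w + w\<^sup>2 / (2 * (1 - w)))"
    using assms by (simp add: exp_minus inverse_eq_divide)
qed

text \<open>The logarithmic series cut after two terms. It drives the divergence argument and also,
  through small \<open>w\<close>, a numerical upper bound for \<open>exp\<close>.\<close>

lemma exp_le_inverse_one_minus:
  assumes "0 \<le> w" "w < (1 :: real)"
  shows "exp (w + w\<^sup>2 / 2) \<le> 1 / (1 - w)"
proof -
  define g where "g = (\<lambda>w :: real. - ln (1 - w) - w - w\<^sup>2 / 2)"
  have "g 0 \<le> g w"
  proof (rule DERIV_nonneg_imp_nondecreasing[OF assms(1)])
    fix x assume x: "0 \<le> x" "x \<le> w"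
    hence x1: "1 - x > 0" using assms by simp
    have "(g has_real_derivative - ((0 - 1) / (1 - x)) - 1 - x) (at x)"
      unfolding g_def using x1 by (auto intro!: derivative_eq_intros)
    moreover have "- ((0 - 1) / (1 - x)) - 1 - x = x\<^sup>2 / (1 - x)"
      using x1 by (simp add: field_simps power2_eq_square)
    ultimately show "\<exists>y. (g has_real_derivative y) (at x) \<and> 0 \<le> y" using x1 by auto
  qed
  hence "w + w\<^sup>2 / 2 \<le> - ln (1 - w)" by (simp add: g_def)
  hence "exp (w + w\<^sup>2 / 2) \<le> exp (- ln (1 - w))" by simp
  thus ?thesis using assms by (simp add: exp_minus inverse_eq_divide)
qed

section \<open>Weighted sums over rooted trees\<close>

definition weight :: "real \<Rightarrow> real \<Rightarrow> mtree \<Rightarrow> real" where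
  "weight z u x = z ^ msize x * u ^ mleaves x"

text \<open>Truncation by size keeps every sum finite, so an upper bound is proved by induction on
  \<open>N\<close> and needs no prior convergence.\<close>

definition tree_sum :: "nat \<Rightarrow> real \<Rightarrow> real \<Rightarrow> real" where
  "tree_sum N z u = (\<Sum>x | msize x \<le> N. weight z u x)"

lemma finite_msize_le: "finite {x. msize x \<le> N}"
proof -
  have "{x. msize x \<le> N} \<subseteq> (\<Union>k<N. {x. msize x = Suc k})"
  proof
    fix x assume x: "x \<in> {x. msize x \<le> N}"
    obtain k where "msize x = Suc k" using msize_pos[of x] gr0_implies_Suc by blast
    thus "x \<in> (\<Union>k<N. {x. msize x = Suc k})" using x by auto
  qed
  thus ?thesis by (rule finite_subset) (simp add: card_mtrees_le(1))
qed

lemma mleaves_pos: "mleaves x > 0"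
proof (induction x)
  case (MNode M)
  show ?case
  proof (cases "M = {#}")
    case False
    then obtain y where "y \<in># M" by blast
    thus ?thesis using MNode[of y] by (auto dest!: multi_member_split)
  qed simp
qed

lemma prod_mset_weight:
  "(\<Prod>x\<in>#M. weight z u x) = z ^ (\<Sum>x\<in>#M. msize x) * u ^ (\<Sum>x\<in>#M. mleaves x)"
  by (induction M) (simp_all add: weight_def power_add mult_ac)

lemma weight_MNode:
  "weight z u (MNode M) = (if M = {#} then z * u else z * (\<Prod>x\<in>#M. weight z u x))"
  unfolding prod_mset_weight by (simp add: weight_def)

lemma weight_nonneg: "0 \<le> z \<Longrightarrow> 0 \<le> u \<Longrightarrow> 0 \<le> weight z u x"
  by (simp add: weight_def)

lemma weight_le:
  assumes "0 \<le> z" "z \<le> 1" "0 \<le> u" "u \<le> 1"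
  shows "weight z u x \<le> z * u"
proof -
  have "z ^ msize x \<le> z ^ 1" using assms msize_pos[of x] by (intro power_decreasing) auto
  moreover have "u ^ mleaves x \<le> u ^ 1" using assms mleaves_pos[of x] by (intro power_decreasing) auto
  ultimately show ?thesis unfolding weight_def using assms by (intro mult_mono) auto
qed

lemma weight_power: "weight z u x ^ j = weight (z ^ j) (u ^ j) x"
  by (simp add: weight_def power_mult_distrib power_mult[symmetric] mult.commute)

lemma tree_sum_mono: "0 \<le> z \<Longrightarrow> 0 \<le> u \<Longrightarrow> M \<le> N \<Longrightarrow> tree_sum M z u \<le> tree_sum N z u"
  unfolding tree_sum_def by (rule sum_mono2[OF finite_msize_le]) (auto intro: weight_nonneg)

lemma sum_mset_ge:
  fixes f :: "'a \<Rightarrow> nat"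
  shows "(\<And>x. f x > 0) \<Longrightarrow> size M \<le> (\<Sum>x\<in>#M. f x)"
proof (induction M)
  case (add x M)
  from add.prems[of x] add.IH[OF add.prems] show ?case by simp
qed simp

text \<open>The functional equation as an inequality. Deleting the root leaves a multiset of total
  size at most \<open>N\<close>, and this range is enlarged to all multisets of trees of size at
  most \<open>N\<close> with multiplicities at most \<open>N\<close>. The one-vertex tree is split
  off because there the root itself carries the factor \<open>u\<close>.\<close>

lemma tree_sum_Suc_le:
  assumes z: "0 \<le> z" "0 \<le> u" and w: "\<And>x. weight z u x < 1"
  shows "tree_sum (Suc N) z u \<le> z * u + z * ((\<Prod>x | msize x \<le> N. 1 / (1 - weight z u x)) - 1)"
proof -
  let ?X = "{x. msize x \<le> N}"
  define MM where "MM = {M. (\<Sum>x\<in>#M. msize x) \<le> N}"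
  define P where "P = (\<lambda>M. \<Prod>x\<in>#M. weight z u x)"
  have P0: "P M \<ge> 0" for M unfolding P_def using z by (simp add: prod_mset_weight)
  have sub: "MM \<subseteq> mult_bounded ?X N"
  proof
    fix M assume M: "M \<in> MM"
    have "count M x \<le> N" for x
      using count_le_size[of M x] sum_mset_ge[of msize M, OF msize_pos] M by (simp add: MM_def)
    moreover have "msize x \<le> N" if "x \<in># M" for x
      using msize_child[OF that] M by (simp add: MM_def)
    ultimately show "M \<in> mult_bounded ?X N" by (auto simp: mult_bounded_def)
  qed
  note bnd = sum_mult_bounded[OF finite_msize_le, of N N "weight z u"]
  have finMM: "finite MM" using sub bnd by (blast intro: finite_subset)
  have e: "{#} \<in> MM" by (simp add: MM_def)
  have img: "{x. msize x \<le> Suc N} = MNode ` MM"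
  proof (intro equalityI subsetI)
    fix x assume "x \<in> {x. msize x \<le> Suc N}"
    thus "x \<in> MNode ` MM" by (cases x) (simp add: MM_def)
  qed (auto simp: MM_def)
  have "tree_sum (Suc N) z u = (\<Sum>M\<in>MM. weight z u (MNode M))"
    unfolding tree_sum_def img by (subst sum.reindex) (auto simp: inj_on_def)
  also have "\<dots> = z * u + (\<Sum>M\<in>MM - {{#}}. weight z u (MNode M))"
    using sum.remove[OF finMM e, of "\<lambda>M. weight z u (MNode M)"] by (simp add: weight_MNode)
  also have "(\<Sum>M\<in>MM - {{#}}. weight z u (MNode M)) = z * (\<Sum>M\<in>MM - {{#}}. P M)"
    unfolding sum_distrib_left P_def by (intro sum.cong) (auto simp: weight_MNode)
  also have "(\<Sum>M\<in>MM - {{#}}. P M) = (\<Sum>M\<in>MM. P M) - 1"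
    using sum.remove[OF finMM e, of P] by (simp add: P_def)
  also have "(\<Sum>M\<in>MM. P M) \<le> (\<Sum>M\<in>mult_bounded ?X N. P M)"
    using bnd P0 by (intro sum_mono2 sub) auto
  also have "\<dots> = (\<Prod>x\<in>?X. \<Sum>j\<le>N. weight z u x ^ j)" using bnd by (simp add: P_def)
  also have "\<dots> \<le> (\<Prod>x\<in>?X. 1 / (1 - weight z u x))"
    using w z by (intro prod_mono conjI sum_nonneg sum_powers_le) (auto intro: weight_nonneg zero_le_power)
  finally show ?thesis using z(1) by (simp add: mult_left_mono)
qed

lemma tree_sum_0: "tree_sum 0 z u = 0"
proof -
  have none: "{x. msize x \<le> 0} = {}"
  proof (rule equals0I)
    fix x assume "x \<in> {x. msize x \<le> 0}"
    thus False using msize_pos[of x] by simp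
  qed
  show ?thesis unfolding tree_sum_def none by simp
qed

text \<open>No weight exceeds \<open>z * u\<close>, so all denominators are replaced by the one for
  \<open>z * u\<close>; the exponents then add up to tree sums, squares of weights being weights at
  \<open>z\<^sup>2\<close> and \<open>u\<^sup>2\<close>.\<close>

lemma prod_inverse_le_exp:
  assumes z: "0 \<le> z" "z < 1" "0 \<le> u" "u \<le> 1"
  shows "(\<Prod>x | msize x \<le> N. 1 / (1 - weight z u x)) \<le> exp (tree_sum N z u / (1 - z * u))"
    and "(\<Prod>x | msize x \<le> N. 1 / (1 - weight z u x)) \<le>
      exp (tree_sum N z u + tree_sum N (z\<^sup>2) (u\<^sup>2) / (2 * (1 - z * u)))"
proof -
  have zu: "z * u < 1" using z mult_left_le[of u z] by linarith
  have w: "0 \<le> weight z u x" "weight z u x \<le> z * u" "weight z u x < 1" for x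
    using weight_nonneg[of z u x] weight_le[of z u x] z zu by auto
  have "(\<Prod>x | msize x \<le> N. 1 / (1 - weight z u x)) \<le> (\<Prod>x | msize x \<le> N. exp (weight z u x / (1 - z * u)))"
  proof (rule prod_mono, intro conjI)
    fix x
    show "0 \<le> 1 / (1 - weight z u x)" using w(3)[of x] by simp
    have "1 / (1 - weight z u x) \<le> exp (weight z u x / (1 - weight z u x))"
      by (rule inverse_one_minus_le_exp(1)[OF w(1,3)])
    also have "\<dots> \<le> exp (weight z u x / (1 - z * u))"
      using w[of x] zu by (simp add: frac_le)
    finally show "1 / (1 - weight z u x) \<le> exp (weight z u x / (1 - z * u))" .
  qed
  thus "(\<Prod>x | msize x \<le> N. 1 / (1 - weight z u x)) \<le> exp (tree_sum N z u / (1 - z * u))"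
    by (simp add: exp_sum[OF finite_msize_le, symmetric] tree_sum_def sum_divide_distrib)
  have "(\<Prod>x | msize x \<le> N. 1 / (1 - weight z u x)) \<le>
      (\<Prod>x | msize x \<le> N. exp (weight z u x + weight (z\<^sup>2) (u\<^sup>2) x / (2 * (1 - z * u))))"
  proof (rule prod_mono, intro conjI)
    fix x
    show "0 \<le> 1 / (1 - weight z u x)" using w(3)[of x] by simp
    have "1 / (1 - weight z u x) \<le> exp (weight z u x + (weight z u x)\<^sup>2 / (2 * (1 - weight z u x)))"
      by (rule inverse_one_minus_le_exp(2)[OF w(1,3)])
    also have "\<dots> \<le> exp (weight z u x + (weight z u x)\<^sup>2 / (2 * (1 - z * u)))"
      using w[of x] zu by (simp add: frac_le)
    finally show "1 / (1 - weight z u x) \<le> exp (weight z u x + weight (z\<^sup>2) (u\<^sup>2) x / (2 * (1 - z * u)))"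
      by (simp add: weight_power)
  qed
  thus "(\<Prod>x | msize x \<le> N. 1 / (1 - weight z u x)) \<le>
      exp (tree_sum N z u + tree_sum N (z\<^sup>2) (u\<^sup>2) / (2 * (1 - z * u)))"
    by (simp add: exp_sum[OF finite_msize_le, symmetric] tree_sum_def sum_divide_distrib sum.distrib)
qed

section \<open>Trees with few leaves\<close>

text \<open>The parameters nearly maximise \<open>z u\<^sup>1\<^sup>/\<^sup>3\<close> over the domain of convergence, whose maximum is about
  0.3517; the constants 0.0505 and 0.735 below are supersolutions found numerically.\<close>

definition sparse_z :: real where "sparse_z = 465 / 1000"
definition sparse_u :: real where "sparse_u = (3 / 4) ^ 3"

text \<open>At the squared parameters the sum is small enough for the first-order estimate. The
  bound feeds the second-order term in \<open>tree_sum_le\<close>.\<close>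

lemma tree_sum_squares_le: "tree_sum N (sparse_z\<^sup>2) (sparse_u\<^sup>2) \<le> 505 / 10000"
proof (induction N)
  case (Suc N)
  let ?z = "sparse_z\<^sup>2" and ?u = "sparse_u\<^sup>2"
  have b: "0 \<le> ?z" "?z < 1" "0 \<le> ?u" "?u \<le> 1" "1 - ?z * ?u > 0"
    by (simp_all add: sparse_z_def sparse_u_def power2_eq_square power3_eq_cube)
  have w: "weight ?z ?u x < 1" for x using weight_le[of ?z ?u x] b by linarith
  have "(\<Prod>x | msize x \<le> N. 1 / (1 - weight ?z ?u x)) \<le> exp (tree_sum N ?z ?u / (1 - ?z * ?u))"
    by (rule prod_inverse_le_exp(1)[OF b(1-4)])
  also have "\<dots> \<le> exp ((505 / 10000) / (1 - ?z * ?u))"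
    by (subst exp_le_cancel_iff, rule divide_right_mono[OF Suc.IH]) (use b(5) in linarith)
  also have "\<dots> \<le> exp (5253 / 100000)"
    by (simp add: sparse_z_def sparse_u_def power2_eq_square power3_eq_cube)
  also have "\<dots> \<le> 1 + 5253 / 100000 + (5253 / 100000)\<^sup>2" by (rule exp_bound) simp_all
  finally have P: "(\<Prod>x | msize x \<le> N. 1 / (1 - weight ?z ?u x)) - 1 \<le> 5253 / 100000 + (5253 / 100000)\<^sup>2"
    by simp
  have "tree_sum (Suc N) ?z ?u \<le> ?z * ?u + ?z * ((\<Prod>x | msize x \<le> N. 1 / (1 - weight ?z ?u x)) - 1)"
    by (rule tree_sum_Suc_le[OF b(1,3) w])
  also have "\<dots> \<le> ?z * ?u + ?z * (5253 / 100000 + (5253 / 100000)\<^sup>2)"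
    using mult_left_mono[OF P b(1)] by simp
  also have "\<dots> \<le> 505 / 10000" by (simp add: sparse_z_def sparse_u_def power2_eq_square power3_eq_cube)
  finally show ?case .
qed (simp add: tree_sum_0)

lemma exp_numeric_upper: "exp (7665 / 10000 :: real) \<le> 21587 / 10000"
proof -
  \<comment> \<open>One sixteenth of the exponent: \<open>16 * (w + w\<^sup>2 / 2)\<close> is about
    0.76666, and for so small a \<open>w\<close> the comparison of \<open>exp\<close> with
    \<open>1 / (1 - w)\<close> loses little.\<close>
  define w :: real where "w = 4682 / 100000"
  have "exp (7665 / 10000) \<le> exp (real 16 * (w + w\<^sup>2 / 2))" by (simp add: w_def power2_eq_square)
  also have "\<dots> = exp (w + w\<^sup>2 / 2) ^ 16" by (rule exp_of_nat_mult)
  also have "\<dots> \<le> (1 / (1 - w)) ^ 16"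
    by (intro power_mono exp_le_inverse_one_minus) (simp_all add: w_def)
  also have "\<dots> \<le> 21587 / 10000" by (simp add: w_def power_divide)
  finally show ?thesis .
qed

text \<open>The functional inequality maps the bound 0.735 to itself with only about 0.00003 to
  spare, so the rounding in the numerical steps has to be this fine.\<close>

lemma tree_sum_le: "tree_sum N sparse_z sparse_u \<le> 735 / 1000"
proof (induction N)
  case (Suc N)
  have b: "0 \<le> sparse_z" "sparse_z < 1" "0 \<le> sparse_u" "sparse_u \<le> 1" "1 - sparse_z * sparse_u > 0"
    by (simp_all add: sparse_z_def sparse_u_def power3_eq_cube)
  have w: "weight sparse_z sparse_u x < 1" for x using weight_le[of sparse_z sparse_u x] b by linarith
  have "(\<Prod>x | msize x \<le> N. 1 / (1 - weight sparse_z sparse_u x)) \<le>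
      exp (tree_sum N sparse_z sparse_u + tree_sum N (sparse_z\<^sup>2) (sparse_u\<^sup>2) / (2 * (1 - sparse_z * sparse_u)))"
    by (rule prod_inverse_le_exp(2)[OF b(1-4)])
  also have "\<dots> \<le> exp (735 / 1000 + (505 / 10000) / (2 * (1 - sparse_z * sparse_u)))"
  proof -
    have "tree_sum N (sparse_z\<^sup>2) (sparse_u\<^sup>2) / (2 * (1 - sparse_z * sparse_u)) \<le> (505 / 10000) / (2 * (1 - sparse_z * sparse_u))"
      using tree_sum_squares_le[of N] b(5) by (intro divide_right_mono) auto
    thus ?thesis using Suc.IH by simp
  qed
  also have "\<dots> \<le> exp (7665 / 10000)" by (simp add: sparse_z_def sparse_u_def power3_eq_cube)
  also have "\<dots> \<le> 21587 / 10000" by (rule exp_numeric_upper)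
  finally have P: "(\<Prod>x | msize x \<le> N. 1 / (1 - weight sparse_z sparse_u x)) - 1 \<le> 11587 / 10000" by simp
  have "tree_sum (Suc N) sparse_z sparse_u \<le> sparse_z * sparse_u + sparse_z * ((\<Prod>x | msize x \<le> N. 1 / (1 - weight sparse_z sparse_u x)) - 1)"
    by (rule tree_sum_Suc_le[OF b(1,3) w])
  also have "\<dots> \<le> sparse_z * sparse_u + sparse_z * (11587 / 10000)"
    using mult_left_mono[OF P b(1)] by simp
  also have "\<dots> \<le> 735 / 1000" by (simp add: sparse_z_def sparse_u_def power3_eq_cube)
  finally show ?case .
qed (simp add: tree_sum_0)

text \<open>A Chernoff bound: \<open>sparse_u\<close> is a cube, so with at most
  \<open>n / 3\<close> leaves the leaf factor is at least \<open>(3 / 4) ^ n\<close>, and each tree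
  counted contributes at least \<open>0.34875 ^ n\<close> to a sum bounded by 0.735.\<close>

lemma card_few_leaves_mtrees_le:
  "real (card {x. msize x = n \<and> 3 * mleaves x \<le> n}) * (sparse_z * (3 / 4)) ^ n \<le> 735 / 1000"
proof -
  have "real (card {x. msize x = n \<and> 3 * mleaves x \<le> n}) * (sparse_z * (3 / 4)) ^ n =
      (\<Sum>x | msize x = n \<and> 3 * mleaves x \<le> n. (sparse_z * (3 / 4)) ^ n)" by simp
  also have "\<dots> \<le> (\<Sum>x | msize x = n \<and> 3 * mleaves x \<le> n. weight sparse_z sparse_u x)"
  proof (rule sum_mono)
    fix x assume "x \<in> {x. msize x = n \<and> 3 * mleaves x \<le> n}"
    hence x: "msize x = n" "3 * mleaves x \<le> n" by auto
    have "(sparse_z * (3 / 4)) ^ n = sparse_z ^ n * (3 / 4) ^ n" by (rule power_mult_distrib)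
    also have "\<dots> \<le> sparse_z ^ n * (3 / 4) ^ (3 * mleaves x)"
      using x(2) by (intro mult_left_mono power_decreasing) (auto simp: sparse_z_def)
    also have "\<dots> = weight sparse_z sparse_u x" unfolding weight_def x(1) sparse_u_def by (simp only: power_mult)
    finally show "(sparse_z * (3 / 4)) ^ n \<le> weight sparse_z sparse_u x" .
  qed
  also have "\<dots> \<le> tree_sum n sparse_z sparse_u"
    unfolding tree_sum_def
    by (rule sum_mono2[OF finite_msize_le]) (auto simp: sparse_z_def sparse_u_def intro!: weight_nonneg)
  also have "\<dots> \<le> 735 / 1000" by (rule tree_sum_le)
  finally show ?thesis .
qed

text \<open>If the sums had supremum \<open>Y\<close>, the functional equation would give \<open>z e\<^sup>E e\<^sup>Y \<le> Y\<close> with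
  \<open>E = (z\<^sup>2 + z\<^sup>4) / 2\<close>, although \<open>e\<^sup>Y \<ge> e Y\<close>.\<close>

lemma tree_sum_unbounded:
  assumes "0 < z" "z < 1" and big: "z * exp (1 + (z\<^sup>2 + z ^ 4) / 2) > 1"
  shows "\<exists>N. tree_sum N z 1 > B"
proof (rule ccontr)
  assume "\<nexists>N. tree_sum N z 1 > B"
  hence B: "tree_sum N z 1 \<le> B" for N by (meson not_le)
  define Y where "Y = (SUP N. tree_sum N z 1)"
  have bdd: "bdd_above (range (\<lambda>N. tree_sum N z 1))" using B by (intro bdd_aboveI2)
  have leY: "tree_sum N z 1 \<le> Y" for N unfolding Y_def by (rule cSUP_upper[OF UNIV_I bdd])
  have w: "0 \<le> weight z 1 x" "weight z 1 x < 1" for x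
    using weight_nonneg[of z 1 x] weight_le[of z 1 x] assms by auto
  have P: "z * (\<Prod>x | msize x \<le> N. \<Sum>j\<le>K. weight z 1 x ^ j) \<le> Y" for N K
  proof -
    let ?M = "mult_bounded {x. msize x \<le> N} K"
    note bnd = sum_mult_bounded[OF finite_msize_le, of N K "weight z 1"]
    \<comment> \<open>The finitely many multisets give trees of bounded size, so their total weight
      lies below a single truncated sum.\<close>
    define N' where "N' = Max (msize ` MNode ` ?M)"
    have "z * (\<Prod>x | msize x \<le> N. \<Sum>j\<le>K. weight z 1 x ^ j) = (\<Sum>M\<in>?M. weight z 1 (MNode M))"
      using bnd by (auto simp: sum_distrib_left weight_MNode intro!: sum.cong simp flip: bnd[THEN conjunct2])
    also have "\<dots> = (\<Sum>x\<in>MNode ` ?M. weight z 1 x)" by (subst sum.reindex) (auto simp: inj_on_def)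
    also have "\<dots> \<le> tree_sum N' z 1"
      unfolding tree_sum_def
    proof (rule sum_mono2[OF finite_msize_le])
      show "MNode ` ?M \<subseteq> {x. msize x \<le> N'}" unfolding N'_def using bnd by (auto intro!: Max_ge)
    qed (rule w(1))
    also have "\<dots> \<le> Y" by (rule leY)
    finally show ?thesis .
  qed
  have P': "z * (\<Prod>x | msize x \<le> N. 1 / (1 - weight z 1 x)) \<le> Y" for N
  proof (rule LIMSEQ_le_const2)
    have "(\<lambda>K. \<Sum>j\<le>K. weight z 1 x ^ j) \<longlonglongrightarrow> 1 / (1 - weight z 1 x)" for x
    proof -
      have "(\<lambda>j. weight z 1 x ^ j) sums (1 / (1 - weight z 1 x))"
        using w[of x] by (intro geometric_sums) simp
      thus ?thesis unfolding sums_def_le .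
    qed
    thus "(\<lambda>K. z * (\<Prod>x | msize x \<le> N. \<Sum>j\<le>K. weight z 1 x ^ j)) \<longlonglongrightarrow>
        z * (\<Prod>x | msize x \<le> N. 1 / (1 - weight z 1 x))"
      by (intro tendsto_mult_left tendsto_prod)
  qed (use P in blast)
  define E where "E = (z\<^sup>2 + z ^ 4) / 2"
  have ex: "z * exp (tree_sum N z 1 + E) \<le> Y" if "N \<ge> 2" for N
  proof -
    \<comment> \<open>Only the trees with one and two vertices are kept, which is what
      \<open>N \<ge> 2\<close> provides for.\<close>
    have sq: "z\<^sup>2 + z ^ 4 \<le> tree_sum N (z\<^sup>2) 1"
    proof -
      let ?a = "MNode {#}" and ?b = "MNode {#MNode {#}#}"
      have "weight (z\<^sup>2) 1 ?a + weight (z\<^sup>2) 1 ?b = (\<Sum>x\<in>{?a, ?b}. weight (z\<^sup>2) 1 x)" by simp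
      also have "\<dots> \<le> tree_sum N (z\<^sup>2) 1"
        unfolding tree_sum_def using that
        by (intro sum_mono2[OF finite_msize_le]) (auto intro: weight_nonneg)
      finally show ?thesis by (simp add: weight_def power2_eq_square power4_eq_xxxx mult.assoc)
    qed
    have "tree_sum N z 1 + E \<le> (\<Sum>x | msize x \<le> N. weight z 1 x + (weight z 1 x)\<^sup>2 / 2)"
      using sq by (simp add: sum.distrib tree_sum_def E_def weight_power sum_divide_distrib[symmetric])
    hence "exp (tree_sum N z 1 + E) \<le> (\<Prod>x | msize x \<le> N. exp (weight z 1 x + (weight z 1 x)\<^sup>2 / 2))"
      by (simp add: exp_sum[OF finite_msize_le, symmetric])
    also have "\<dots> \<le> (\<Prod>x | msize x \<le> N. 1 / (1 - weight z 1 x))"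
      using w by (intro prod_mono conjI exp_le_inverse_one_minus) auto
    finally have "z * exp (tree_sum N z 1 + E) \<le> z * (\<Prod>x | msize x \<le> N. 1 / (1 - weight z 1 x))"
      using assms(1) by (intro mult_left_mono) auto
    thus ?thesis using P'[of N] by linarith
  qed
  have Ypos: "Y > 0" using ex[of 2] assms(1) by (meson exp_gt_zero less_le_trans mult_pos_pos order_refl)
  have "tree_sum N z 1 \<le> ln (Y / z) - E" for N
  proof -
    have "exp (tree_sum (max N 2) z 1 + E) \<le> Y / z"
      using ex[of "max N 2"] assms(1) by (simp add: field_simps)
    hence "tree_sum (max N 2) z 1 + E \<le> ln (Y / z)"
      using Ypos assms(1) by (simp add: ln_ge_iff)
    moreover have "tree_sum N z 1 \<le> tree_sum (max N 2) z 1"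
      using assms(1) by (intro tree_sum_mono) auto
    ultimately show ?thesis by linarith
  qed
  hence "Y \<le> ln (Y / z) - E" unfolding Y_def by (intro cSUP_least) auto
  hence "Y + E \<le> ln (Y / z)" by simp
  hence "exp (Y + E) \<le> Y / z" using Ypos assms(1) by (simp add: ln_ge_iff)
  hence "z * exp (Y + E) \<le> Y" using assms(1) by (simp add: field_simps)
  moreover have "exp (Y + E) = exp (1 + E) * exp (Y - 1)" by (simp add: exp_add[symmetric])
  moreover have "exp (1 + E) * Y \<le> exp (1 + E) * exp (Y - 1)"
    using exp_ge_add_one_self[of "Y - 1"] by (intro mult_left_mono) auto
  ultimately have "z * (exp (1 + E) * Y) \<le> Y"
    using assms(1) by (smt (verit) mult_left_mono)
  hence "z * exp (1 + E) \<le> 1" using Ypos by (simp add: mult.assoc[symmetric])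
  thus False using big by (simp add: E_def)
qed

section \<open>The growth rate of unlabelled trees\<close>

text \<open>Two trees are hung below a new root; the unordered pair of branches can be read in at
  most two orders.\<close>

lemma card_mtrees_supermultiplicative:
  "card {x. msize x = a} * card {x. msize x = b} \<le> 2 * card {x. msize x = Suc (a + b)}"
proof -
  have fin: "finite {x. msize x = n}" for n
    by (rule finite_subset[OF _ finite_msize_le[of n]]) auto
  let ?P = "{x. msize x = a} \<times> {x. msize x = b}" and ?C = "{x. msize x = Suc (a + b)}"
  define fib where "fib = (\<lambda>t. {(x, y). MNode {#x, y#} = t})"
  have fib: "finite (fib t) \<and> card (fib t) \<le> 2" for t
  proof (cases "fib t = {}")
    case False
    then obtain x y where t: "t = MNode {#x, y#}" by (auto simp: fib_def)
    have sub: "fib t \<subseteq> {(x, y), (y, x)}" by (auto simp: fib_def t add_eq_conv_ex)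
    have "card (fib t) \<le> card {(x, y), (y, x)}" by (rule card_mono[OF _ sub]) simp
    also have "\<dots> \<le> 2" using card_length[of "[(x, y), (y, x)]"] by simp
    finally show ?thesis using finite_subset[OF sub] by simp
  qed simp
  have "?P \<subseteq> (\<Union>t\<in>?C. fib t)" by (auto simp: fib_def)
  hence "card ?P \<le> card (\<Union>t\<in>?C. fib t)" using fin fib by (intro card_mono) auto
  also have "\<dots> \<le> (\<Sum>t\<in>?C. card (fib t))" by (rule card_UN_le[OF fin])
  also have "\<dots> \<le> (\<Sum>t\<in>?C. 2)" using fib by (intro sum_mono) blast
  finally show ?thesis by (simp add: card_cartesian_product)
qed

lemma card_mtrees_pos: "card {x. msize x = Suc n} > 0"
proof -
  have "\<exists>x. msize x = Suc n"
  proof (induction n)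
    case 0
    show ?case by (rule exI[of _ "MNode {#}"]) simp
  next
    case (Suc n)
    then obtain x where "msize x = Suc n" by blast
    thus ?case by (intro exI[of _ "MNode {#x#}"]) simp
  qed
  thus ?thesis using card_mtrees_le(1)[of n] by (auto simp: card_gt_0_iff)
qed

text \<open>Without the correction from the two smallest trees the left side would be about 0.94;
  with it, about 1.006. So 0.346 still lies in the range where this cheap argument proves
  divergence, and below 0.34875. The exponent is at least 1.067, taken in sixteen parts
  \<open>h\<close> for the quadratic Taylor bound.\<close>

lemma exp_numeric_lower: "(346 / 1000 :: real) * exp (1 + ((346 / 1000)\<^sup>2 + (346 / 1000) ^ 4) / 2) > 1"
proof -
  define h :: real where "h = 1067 / 16000"
  have "(1 :: real) < (346 / 1000) * (1 + h + h\<^sup>2 / 2) ^ 16"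
    by (simp add: h_def power2_eq_square power_divide)
  also have "\<dots> \<le> (346 / 1000) * exp h ^ 16"
    by (intro mult_left_mono power_mono exp_lower_Taylor_quadratic) (simp_all add: h_def)
  also have "exp h ^ 16 = exp (real 16 * h)" by (rule exp_of_nat_mult[symmetric])
  also have "(346 / 1000) * exp (real 16 * h) \<le> (346 / 1000) * exp (1 + ((346 / 1000)\<^sup>2 + (346 / 1000) ^ 4) / 2)"
    by (intro mult_left_mono exp_le_cancel_iff[THEN iffD2])
      (simp_all add: h_def power2_eq_square power4_eq_xxxx)
  finally show ?thesis .
qed

text \<open>Otherwise the series at 0.346 would be dominated by a geometric series of ratio 346/347.
  The bound 2 and the exponent \<open>Suc N\<close> are tailored to supermultiplicativity: they pay
  for the factor 2 and for the new root.\<close>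

lemma exists_large_mtree_count:
  "\<exists>N. real (card {x. msize x = N}) * (347 / 1000) ^ Suc N \<ge> 2"
proof (rule ccontr)
  assume "\<not> ?thesis"
  hence less: "real (card {x. msize x = N}) * (347 / 1000) ^ Suc N < 2" for N by (meson not_le)
  define q :: real where "q = 346 / 347"
  have small: "real (card {x. msize x = N}) * (346 / 1000) ^ N \<le> (2000 / 347) * q ^ N" for N
  proof -
    have "(346 / 1000 :: real) ^ N = (1000 / 347) * (347 / 1000) ^ Suc N * q ^ N"
      by (simp add: q_def power_mult_distrib[symmetric])
    hence "real (card {x. msize x = N}) * (346 / 1000) ^ N =
        (real (card {x. msize x = N}) * (347 / 1000) ^ Suc N) * ((1000 / 347) * q ^ N)" by simp
    also have "\<dots> \<le> 2 * ((1000 / 347) * q ^ N)"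
      using less[of N] by (intro mult_right_mono) (auto simp: q_def)
    finally show ?thesis by simp
  qed
  obtain N where N: "tree_sum N (346 / 1000) 1 > (2000 / 347) * (1 / (1 - q))"
    using tree_sum_unbounded[OF _ _ exp_numeric_lower] by auto
  have "tree_sum N (346 / 1000) 1 = (\<Sum>x | msize x \<le> N. (346 / 1000) ^ msize x)"
    by (simp add: tree_sum_def weight_def)
  also have "\<dots> = (\<Sum>n\<le>N. \<Sum>x | x \<in> {x. msize x \<le> N} \<and> msize x = n. (346 / 1000) ^ msize x)"
    by (rule sum.group[symmetric, OF finite_msize_le]) auto
  also have "\<dots> = (\<Sum>n\<le>N. real (card {x. msize x = n}) * (346 / 1000) ^ n)"
  proof (rule sum.cong[OF refl])
    fix n assume "n \<in> {..N}"
    hence "{x. x \<in> {x. msize x \<le> N} \<and> msize x = n} = {x. msize x = n}" by auto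
    thus "(\<Sum>x | x \<in> {x. msize x \<le> N} \<and> msize x = n. (346 / 1000 :: real) ^ msize x) =
        real (card {x. msize x = n}) * (346 / 1000) ^ n" by simp
  qed
  also have "\<dots> \<le> (\<Sum>n\<le>N. (2000 / 347) * q ^ n)" by (intro sum_mono small)
  also have "\<dots> = (2000 / 347) * (\<Sum>n\<le>N. q ^ n)" by (simp add: sum_distrib_left)
  also have "\<dots> \<le> (2000 / 347) * (1 / (1 - q))"
    by (intro mult_left_mono sum_powers_le) (simp_all add: q_def)
  finally show False using N by simp
qed

text \<open>Joining with trees of the one good size \<open>N\<close> shows that the normalised count
  does not drop when its index grows by \<open>Suc N\<close>; its minimum over the first
  \<open>Suc N\<close> indices therefore bounds it everywhere.\<close>

lemma mtree_count_lower_bound: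
  "\<exists>c>0. \<forall>n. c \<le> real (card {x. msize x = Suc n}) * (347 / 1000) ^ Suc n"
proof -
  obtain N where N: "real (card {x. msize x = N}) * (347 / 1000) ^ Suc N \<ge> 2"
    using exists_large_mtree_count by blast
  define a where "a = (\<lambda>n. real (card {x. msize x = Suc n}) * (347 / 1000 :: real) ^ Suc n)"
  define c where "c = Min (a ` {..N})"
  have step: "a n \<le> a (n + Suc N)" for n
  proof -
    have "2 * a n \<le> (real (card {x. msize x = N}) * (347 / 1000) ^ Suc N) * a n"
      using N by (intro mult_right_mono) (simp_all add: a_def)
    also have "\<dots> = real (card {x. msize x = Suc n} * card {x. msize x = N}) * (347 / 1000) ^ (Suc n + Suc N)"
      by (simp add: a_def power_add)
    also have "\<dots> \<le> real (2 * card {x. msize x = Suc (Suc n + N)}) * (347 / 1000) ^ (Suc n + Suc N)"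
      using card_mtrees_supermultiplicative[of "Suc n" N]
      by (intro mult_right_mono of_nat_mono) simp_all
    also have "\<dots> = 2 * a (n + Suc N)" by (simp add: a_def)
    finally show ?thesis by simp
  qed
  have "c \<le> a n" for n
  proof (induction n rule: less_induct)
    case (less n)
    show ?case
    proof (cases "n \<le> N")
      case True
      thus ?thesis unfolding c_def by (intro Min_le) auto
    next
      case False
      hence "n = (n - Suc N) + Suc N" by simp
      moreover have "c \<le> a (n - Suc N)" using False by (intro less) simp
      ultimately show ?thesis using step[of "n - Suc N"] by simp
    qed
  qed
  moreover have "c > 0"
  proof -
    have "c \<in> a ` {..N}" unfolding c_def by (intro Min_in) auto
    thus ?thesis using card_mtrees_pos by (auto simp: a_def)
  qed
  ultimately show ?thesis unfolding a_def by blast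
qed

text \<open>The two growth estimates meet here: rooting bounds the sparse classes from above, and
  re-rooting, at the cost of a factor \<open>Suc k\<close>, bounds all classes from below.\<close>

lemma few_leaves_probability:
  "\<exists>C. \<forall>k\<ge>1. real (card {K \<in> unlabelled_trees k. \<exists>T\<in>K. 3 * card (leaf_set T) < k}) \<le>
     C * real (Suc k) * (1388 / 1395) ^ Suc k * real (card (unlabelled_trees k))"
proof -
  obtain c where c: "c > 0" "\<And>n. c \<le> real (card {x. msize x = Suc n}) * (347 / 1000) ^ Suc n"
    using mtree_count_lower_bound by blast
  have "real (card {K \<in> unlabelled_trees k. \<exists>T\<in>K. 3 * card (leaf_set T) < k}) \<le>
     (735 / 1000 / c) * real (Suc k) * (1388 / 1395) ^ Suc k * real (card (unlabelled_trees k))"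
    if k: "k \<ge> 1" for k
  proof -
    let ?bad = "{K \<in> unlabelled_trees k. \<exists>T\<in>K. 3 * card (leaf_set T) < k}"
    let ?t = "real (card (unlabelled_trees k))"
    have third: "l \<le> k div 3" if "3 * l < k" for l using that by linarith
    have "card ?bad \<le> card {K \<in> unlabelled_trees k. \<exists>T\<in>K. card (leaf_set T) \<le> k div 3}"
      using finite_unlabelled_trees third by (intro card_mono) auto
    also have "\<dots> \<le> card {x. msize x = Suc k \<and> mleaves x \<le> k div 3}" by (rule card_few_leaves_le[OF k])
    also have "\<dots> \<le> card {x. msize x = Suc k \<and> 3 * mleaves x \<le> Suc k}"
      by (rule card_mono[OF finite_subset[OF _ card_mtrees_le(1)[of k]]]) auto
    finally have "real (card ?bad) * (sparse_z * (3 / 4)) ^ Suc k \<le>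
        real (card {x. msize x = Suc k \<and> 3 * mleaves x \<le> Suc k}) * (sparse_z * (3 / 4)) ^ Suc k"
      by (intro mult_right_mono) (simp_all add: sparse_z_def)
    also have "\<dots> \<le> 735 / 1000" by (rule card_few_leaves_mtrees_le)
    finally have bad: "real (card ?bad) * (sparse_z * (3 / 4)) ^ Suc k \<le> 735 / 1000" .
    have "c \<le> real (Suc k * card (unlabelled_trees k)) * (347 / 1000) ^ Suc k"
      using card_mtrees_le(2)[of k] by (intro order.trans[OF c(2)[of k]] mult_right_mono of_nat_mono) simp_all
    hence "1 \<le> (real (Suc k) * ?t * (347 / 1000) ^ Suc k) / c" using c(1) by (simp add: field_simps)
    hence "735 / 1000 * 1 \<le> 735 / 1000 * ((real (Suc k) * ?t * (347 / 1000) ^ Suc k) / c)"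
      by (intro mult_left_mono) simp_all
    with bad have "real (card ?bad) * (sparse_z * (3 / 4)) ^ Suc k \<le>
        735 / 1000 * ((real (Suc k) * ?t * (347 / 1000) ^ Suc k) / c)" by linarith
    \<comment> \<open>The ratio \<open>1388 / 1395\<close> is 0.347 divided by
      \<open>sparse_z * (3 / 4) = 0.34875\<close>; being below 1 it beats the linear factor.\<close>
    also have "(347 / 1000 :: real) ^ Suc k = (1388 / 1395) ^ Suc k * (sparse_z * (3 / 4)) ^ Suc k"
      unfolding power_mult_distrib[symmetric] by (simp add: sparse_z_def)
    finally have "real (card ?bad) * (sparse_z * (3 / 4)) ^ Suc k \<le>
        ((735 / 1000 / c) * real (Suc k) * (1388 / 1395) ^ Suc k * ?t) * (sparse_z * (3 / 4)) ^ Suc k"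
      by (simp only: mult_ac times_divide_eq_left times_divide_eq_right)
    thus ?thesis by (rule mult_right_le_imp_le) (simp add: sparse_z_def)
  qed
  thus ?thesis by blast
qed

theorem corollary2:
  fixes e :: "nat \<Rightarrow> nat set"
  assumes "\<And>m. m > 0 \<Longrightarrow> prime (2 * m + 1) \<Longrightarrow> e m \<in> edges (complete_graph (6 * m + 5))"
  shows "((\<lambda>m. measure_pmf.prob (random_tree (m + 1))
            {C. class_decomposes C (delete_edge (complete_graph (6 * m + 5)) (e m))})
          \<longlongrightarrow> 1) (inf sequentially (principal {m. m > 0 \<and> prime (2 * m + 1)}))"
proof -
  define pr where "pr = (\<lambda>m. measure_pmf.prob (random_tree (m + 1))
            {C. class_decomposes C (delete_edge (complete_graph (6 * m + 5)) (e m))})"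
  obtain C where C: "\<And>k. k \<ge> 1 \<Longrightarrow> real (card {K \<in> unlabelled_trees k. \<exists>T\<in>K. 3 * card (leaf_set T) < k}) \<le>
     C * real (Suc k) * (1388 / 1395) ^ Suc k * real (card (unlabelled_trees k))"
    using few_leaves_probability by blast
  define \<epsilon> where "\<epsilon> = (\<lambda>m. C * (real (Suc (m + 1)) * (1388 / 1395) ^ Suc (m + 1)))"
  have lower: "1 - \<epsilon> m \<le> pr m" if m: "m > 0" "prime (2 * m + 1)" for m
  proof -
    let ?U = "unlabelled_trees (m + 1)"
    let ?bad = "{K \<in> ?U. \<exists>T\<in>K. 3 * card (leaf_set T) < m + 1}"
    let ?A = "{C. class_decomposes C (delete_edge (complete_graph (6 * m + 5)) (e m))}"
    have Upos: "card ?U > 0" using finite_unlabelled_trees unlabelled_trees_nonempty by (simp add: card_gt_0_iff)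
    have "?U - ?bad \<subseteq> ?U \<inter> ?A"
    proof
      fix K assume K: "K \<in> ?U - ?bad"
      then obtain T where T: "T \<in> labelled_trees (m + 1)" "K = {S \<in> labelled_trees (m + 1). isomorphic T S}"
        using unlabelled_trees_class by blast
      have TK: "T \<in> K" using T isomorphic_refl by simp
      \<comment> \<open>A class is bad as soon as one member has few leaves, so in the other classes
        every member, in particular \<open>T\<close>, has enough.\<close>
      hence "m + 1 \<le> 3 * card (leaf_set T)" using K by force
      hence "decomposes T (delete_edge (complete_graph (6 * m + 5)) (e m))"
        using labelled_treesD[OF T(1)] m assms[OF m] by (intro leafy_tree_decomposes) auto
      thus "K \<in> ?U \<inter> ?A" using K TK by (auto simp: class_decomposes_def)
    qed
    hence "card (?U - ?bad) \<le> card (?U \<inter> ?A)" using finite_unlabelled_trees by (intro card_mono) auto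
    moreover have "card ?U \<le> card (?U - ?bad) + card ?bad"
      using card_Un_le[of "?U - ?bad" ?bad] by (simp add: Un_absorb2 subsetI)
    ultimately have "real (card ?U) - real (card ?bad) \<le> real (card (?U \<inter> ?A))" by linarith
    moreover have "real (card ?bad) \<le> \<epsilon> m * real (card ?U)"
      using C[of "m + 1"] by (simp only: \<epsilon>_def mult.assoc)
    ultimately have "(1 - \<epsilon> m) * real (card ?U) \<le> real (card (?U \<inter> ?A))" by (simp add: algebra_simps)
    hence "1 - \<epsilon> m \<le> real (card (?U \<inter> ?A)) / real (card ?U)" using Upos by (simp add: pos_le_divide_eq)
    also have "\<dots> = pr m"
      unfolding pr_def random_tree_def
      by (rule measure_pmf_of_set[OF unlabelled_trees_nonempty finite_unlabelled_trees, symmetric])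
    finally show ?thesis .
  qed
  have "(\<lambda>n. real n * (1388 / 1395) ^ n) \<longlonglongrightarrow> 0"
    by (rule powser_times_n_limit_0) simp
  hence "(\<lambda>m. real (Suc (m + 1)) * (1388 / 1395) ^ Suc (m + 1)) \<longlonglongrightarrow> 0"
    using LIMSEQ_ignore_initial_segment[of "\<lambda>n. real n * (1388 / 1395 :: real) ^ n" 0 2] by simp
  hence "(\<lambda>m. 1 - \<epsilon> m) \<longlonglongrightarrow> 1 - C * 0"
    unfolding \<epsilon>_def by (intro tendsto_intros)
  hence lim: "((\<lambda>m. 1 - \<epsilon> m) \<longlongrightarrow> 1) (inf sequentially (principal {m. m > 0 \<and> prime (2 * m + 1)}))"
    by (simp add: tendsto_mono[OF inf_le1])
  have "(pr \<longlongrightarrow> 1) (inf sequentially (principal {m. m > 0 \<and> prime (2 * m + 1)}))"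
  proof (rule tendsto_sandwich[OF _ _ lim tendsto_const])
    show "\<forall>\<^sub>F m in inf sequentially (principal {m. m > 0 \<and> prime (2 * m + 1)}). 1 - \<epsilon> m \<le> pr m"
      unfolding eventually_inf_principal using lower by (intro always_eventually) blast
    show "\<forall>\<^sub>F m in inf sequentially (principal {m. m > 0 \<and> prime (2 * m + 1)}). pr m \<le> 1"
      unfolding pr_def by (intro always_eventually allI measure_pmf.prob_le_1)
  qed
  thus ?thesis unfolding pr_def .
qed

end
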